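(* For $f_1,\dots,f_6\in L^2(\mathbb{R}\to\mathbb{C})$ there hold the representations $$\mathcal{E}_6(f_1,\dots,f_6)=\frac{1}{2\sqrt{3}\,\pi^2}\int_0^{2\pi}E_{R(\theta)}(f_1,f_2,f_3,f_4,f_5,f_6)\,d\theta,$$ $$\mathcal{T}_6(f_1,\dots,f_5)(x)=\frac{\sqrt{3}}{\pi^2}\int_0^{2\pi}T_{R(\theta)}(f_1,f_2,f_3,f_4,f_5)(x)\,d\theta,$$ where $R(\theta)$ is the rotation of $\mathbb{R}^3$ by $\theta$ radians about the axis $(1,1,1)$.
   Context: $H=-\Delta+x^2$ on $L^2(\mathbb{R})$, and $e^{itH}$ is the unitary propagator of $iu_t+Hu=0$ (so $e^{itH}\phi_n=e^{it(2n+1)}\phi_n$ for the Hermite functions $\phi_n$, $H\phi_n=(2n+1)\phi_n$). Define $$\mathcal{E}_6(f_1,\dots,f_6)=\frac{2}{\pi}\int_{-\pi/4}^{\pi/4}\int_{\mathbb{R}}(e^{itH}f_1)(e^{itH}f_2)(e^{itH}f_3)\overline{(e^{itH}f_4)(e^{itH}f_5)(e^{itH}f_6)}\,dx\,dt,$$ and $\mathcal{T}_6:(L^2)^5\to L^2$ by duality: $\langle\mathcal{T}_6(f_1,\dots,f_5),g\rangle_{L^2}=6\,\mathcal{E}_6(f_1,\dots,f_5,g)$, with $\langle f,g\rangle_{L^2}=\int f\overline{g}\,dx$. For a linear isometry $A:\mathbb{R}^3\to\mathbb{R}^3$, with $(Ax)_k=\langle Ax,e_k\rangle$, $$E_A(f_1,\dots,f_6)=\int_{\mathbb{R}^3}f_1((Ax)_1)f_2((Ax)_2)f_3((Ax)_3)\overline{f_4(x_1)f_5(x_2)f_6(x_3)}\,dx_1dx_2dx_3,$$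 and $T_A$ is defined by duality: $\langle T_A(f_1,\dots,f_5),g\rangle_{L^2}=E_A(f_1,\dots,f_5,g)$. *)

theory Defs
  imports "HOL-Analysis.Analysis"
begin

section \<open>The space of square-integrable functions\<close>

text \<open>Elements of the Hilbert space are represented by Borel functions; identities between
  elements are stated almost everywhere.\<close>

definition L2 :: "(real \<Rightarrow> complex) set" where
  "L2 = {f. f \<in> borel_measurable lborel \<and> integrable lborel (\<lambda>x. (cmod (f x))\<^sup>2)}"

definition l2_inner :: "(real \<Rightarrow> complex) \<Rightarrow> (real \<Rightarrow> complex) \<Rightarrow> complex" where
  "l2_inner f g = (LINT x|lborel. f x * cnj (g x))"

definition l2_norm :: "(real \<Rightarrow> complex) \<Rightarrow> real" where
  "l2_norm f = sqrt (LINT x|lborel. (cmod (f x))\<^sup>2)"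

definition l2_has_derivative_at ::
  "(real \<Rightarrow> real \<Rightarrow> complex) \<Rightarrow> (real \<Rightarrow> complex) \<Rightarrow> real \<Rightarrow> bool" where
  "l2_has_derivative_at u v t \<longleftrightarrow> v \<in> L2 \<and>
     ((\<lambda>h. l2_norm (\<lambda>x. (u (t + h) x - u t x) / of_real h - v x)) \<longlongrightarrow> 0) (at 0)"

section \<open>The operator \<open>H\<close> and its unitary propagator\<close>

text \<open>The graph of \<open>H\<close>, that is \<open>-d\<^sup>2/dx\<^sup>2 + x\<^sup>2\<close> with its self-adjoint
  domain, the \<open>f\<close> in \<open>L2\<close> with both the weak second derivative and \<open>x\<^sup>2 f\<close> in \<open>L2\<close>:
  \<open>u\<close> is the continuously differentiable representative of \<open>f\<close>, with derivative \<open>u1\<close> absolutely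
  continuous, and \<open>u2\<close> is the almost everywhere derivative of \<open>u1\<close>.\<close>

definition oscillator :: "(real \<Rightarrow> complex) \<Rightarrow> (real \<Rightarrow> complex) \<Rightarrow> bool" where
  "oscillator f g \<longleftrightarrow> f \<in> L2 \<and> g \<in> L2 \<and>
     (\<exists>u u1 u2. (AE x in lborel. f x = u x) \<and>
        (\<forall>x. (u has_vector_derivative u1 x) (at x)) \<and>
        (\<forall>a b. a \<le> b \<longrightarrow> set_integrable lborel {a..b} u2 \<and>
                          u1 b - u1 a = (LINT x:{a..b}|lborel. u2 x)) \<and>
        u2 \<in> L2 \<and> (\<lambda>x. of_real (x\<^sup>2) * u x) \<in> L2 \<and>
        (AE x in lborel. g x = - u2 x + of_real (x\<^sup>2) * u x))"

text \<open>\<open>U t\<close> is \<open>e\<^bsup>itH\<^esup>\<close>: \<open>U\<close> is the strongly continuous unitary group for which \<open>U t f\<close> solves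
  \<open>i u\<^sub>t + H u = 0\<close>, \<open>u(0) = f\<close>, for all \<open>f\<close> in the domain of \<open>H\<close>. Each \<open>U t\<close> is onto
  by the group law, so preservation of the inner product makes it unitary. By Stone's theorem
  exactly one such \<open>U\<close> exists, up to changes on null sets and outside \<open>L2\<close>.\<close>

definition oscillator_propagator :: "(real \<Rightarrow> (real \<Rightarrow> complex) \<Rightarrow> real \<Rightarrow> complex) \<Rightarrow> bool" where
  "oscillator_propagator U \<longleftrightarrow>
     (\<forall>t. \<forall>f\<in>L2. U t f \<in> L2) \<and>
     (\<forall>t a b. \<forall>f\<in>L2. \<forall>g\<in>L2.
        AE x in lborel. U t (\<lambda>y. a * f y + b * g y) x = a * U t f x + b * U t g x) \<and>
     (\<forall>t. \<forall>f\<in>L2. \<forall>g\<in>L2. l2_inner (U t f) (U t g) = l2_inner f g) \<and>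
     (\<forall>f\<in>L2. AE x in lborel. U 0 f x = f x) \<and>
     (\<forall>s t. \<forall>f\<in>L2. AE x in lborel. U (s + t) f x = U s (U t f) x) \<and>
     (\<forall>f\<in>L2. ((\<lambda>t. l2_norm (\<lambda>x. U t f x - f x)) \<longlongrightarrow> 0) (at 0)) \<and>
     (\<forall>f. (\<exists>g. oscillator f g) \<longrightarrow>
        (\<forall>t. \<exists>ut Hu. l2_has_derivative_at (\<lambda>s. U s f) ut t \<and> oscillator (U t f) Hu \<and>
               (AE x in lborel. \<i> * ut x + Hu x = 0)))"

section \<open>The multilinear forms and operators\<close>

definition sextic_integrand ::
  "(real \<Rightarrow> (real \<Rightarrow> complex) \<Rightarrow> real \<Rightarrow> complex) \<Rightarrow>
   (real \<Rightarrow> complex) \<Rightarrow> (real \<Rightarrow> complex) \<Rightarrow> (real \<Rightarrow> complex) \<Rightarrow>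
   (real \<Rightarrow> complex) \<Rightarrow> (real \<Rightarrow> complex) \<Rightarrow> (real \<Rightarrow> complex) \<Rightarrow> real \<Rightarrow> real \<Rightarrow> complex" where
  "sextic_integrand U f1 f2 f3 f4 f5 f6 t x =
     U t f1 x * U t f2 x * U t f3 x * cnj (U t f4 x * U t f5 x * U t f6 x)"

text \<open>The integral over \<open>x\<close> at each fixed \<open>t\<close> is independent of the choice of representatives
  \<open>U t f\<close>, so the iterated integral is well defined without joint measurability in \<open>(t, x)\<close>.\<close>

definition sextic_form ::
  "(real \<Rightarrow> (real \<Rightarrow> complex) \<Rightarrow> real \<Rightarrow> complex) \<Rightarrow>
   (real \<Rightarrow> complex) \<Rightarrow> (real \<Rightarrow> complex) \<Rightarrow> (real \<Rightarrow> complex) \<Rightarrow>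
   (real \<Rightarrow> complex) \<Rightarrow> (real \<Rightarrow> complex) \<Rightarrow> (real \<Rightarrow> complex) \<Rightarrow> complex" where
  "sextic_form U f1 f2 f3 f4 f5 f6 =
     of_real (2 / pi) *
     (LINT t:{- pi / 4..pi / 4}|lborel. LINT x|lborel. sextic_integrand U f1 f2 f3 f4 f5 f6 t x)"

text \<open>\<open>A\<close> is meant to be a linear isometry.\<close>

definition isometry_integrand ::
  "(real^3 \<Rightarrow> real^3) \<Rightarrow>
   (real \<Rightarrow> complex) \<Rightarrow> (real \<Rightarrow> complex) \<Rightarrow> (real \<Rightarrow> complex) \<Rightarrow>
   (real \<Rightarrow> complex) \<Rightarrow> (real \<Rightarrow> complex) \<Rightarrow> (real \<Rightarrow> complex) \<Rightarrow> real^3 \<Rightarrow> complex" where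
  "isometry_integrand A f1 f2 f3 f4 f5 f6 x =
     f1 (A x $ 1) * f2 (A x $ 2) * f3 (A x $ 3) * cnj (f4 (x $ 1) * f5 (x $ 2) * f6 (x $ 3))"

definition isometry_form ::
  "(real^3 \<Rightarrow> real^3) \<Rightarrow>
   (real \<Rightarrow> complex) \<Rightarrow> (real \<Rightarrow> complex) \<Rightarrow> (real \<Rightarrow> complex) \<Rightarrow>
   (real \<Rightarrow> complex) \<Rightarrow> (real \<Rightarrow> complex) \<Rightarrow> (real \<Rightarrow> complex) \<Rightarrow> complex" where
  "isometry_form A f1 f2 f3 f4 f5 f6 =
     (LINT x|lborel. isometry_integrand A f1 f2 f3 f4 f5 f6 x)"

text \<open>\<open>riesz_vector F\<close> is a choice of representative of the element of \<open>L2\<close> defined by duality;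
  it is meaningful when some \<open>h\<close> with \<open>represents h F\<close> exists.\<close>

definition represents :: "(real \<Rightarrow> complex) \<Rightarrow> ((real \<Rightarrow> complex) \<Rightarrow> complex) \<Rightarrow> bool" where
  "represents h F \<longleftrightarrow> h \<in> L2 \<and> (\<forall>g\<in>L2. l2_inner h g = F g)"

definition riesz_vector :: "((real \<Rightarrow> complex) \<Rightarrow> complex) \<Rightarrow> real \<Rightarrow> complex" where
  "riesz_vector F = (SOME h. represents h F)"

definition sextic_operator ::
  "(real \<Rightarrow> (real \<Rightarrow> complex) \<Rightarrow> real \<Rightarrow> complex) \<Rightarrow>
   (real \<Rightarrow> complex) \<Rightarrow> (real \<Rightarrow> complex) \<Rightarrow> (real \<Rightarrow> complex) \<Rightarrow>
   (real \<Rightarrow> complex) \<Rightarrow> (real \<Rightarrow> complex) \<Rightarrow> real \<Rightarrow> complex" where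
  "sextic_operator U f1 f2 f3 f4 f5 = riesz_vector (\<lambda>g. 6 * sextic_form U f1 f2 f3 f4 f5 g)"

definition isometry_operator ::
  "(real^3 \<Rightarrow> real^3) \<Rightarrow>
   (real \<Rightarrow> complex) \<Rightarrow> (real \<Rightarrow> complex) \<Rightarrow> (real \<Rightarrow> complex) \<Rightarrow>
   (real \<Rightarrow> complex) \<Rightarrow> (real \<Rightarrow> complex) \<Rightarrow> real \<Rightarrow> complex" where
  "isometry_operator A f1 f2 f3 f4 f5 = riesz_vector (\<lambda>g. isometry_form A f1 f2 f3 f4 f5 g)"

section \<open>Rotations and pointwise integrals of families in \<open>L2\<close>\<close>

text \<open>Rodrigues' formula; \<open>sgn a\<close> is the unit vector in the direction of the axis \<open>a\<close>.\<close>

definition rotation_about :: "real^3 \<Rightarrow> real \<Rightarrow> real^3 \<Rightarrow> real^3" where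
  "rotation_about a \<theta> x =
     cos \<theta> *\<^sub>R x + sin \<theta> *\<^sub>R cross3 (sgn a) x + ((1 - cos \<theta>) * (sgn a \<bullet> x)) *\<^sub>R sgn a"

definition diagonal_rotation :: "real \<Rightarrow> real^3 \<Rightarrow> real^3" where
  "diagonal_rotation = rotation_about (vector [1, 1, 1])"

text \<open>A family \<open>T \<theta>\<close> of elements of \<open>L2\<close> determines each \<open>T \<theta>\<close> only up to a null set, so the
  integral of \<open>T \<theta> x\<close> over \<open>\<theta>\<close> at a point \<open>x\<close> refers to a jointly measurable version \<open>K\<close> of the
  family; by Fubini's theorem any two versions yield the same function of \<open>x\<close> almost everywhere.\<close>

definition measurable_version ::
  "real set \<Rightarrow> (real \<Rightarrow> real \<Rightarrow> complex) \<Rightarrow> (real \<Rightarrow> real \<Rightarrow> complex) \<Rightarrow> bool" where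
  "measurable_version S T K \<longleftrightarrow>
     (\<lambda>(\<theta>, x). K \<theta> x) \<in> borel_measurable (lborel \<Otimes>\<^sub>M lborel) \<and>
     (\<forall>\<theta>\<in>S. AE x in lborel. K \<theta> x = T \<theta> x)"

end

theory Submission
  imports Defs "HOL-Probability.Probability"
begin

text \<open>Both sides of the first identity are sextilinear forms, and both can be computed on Gaussians
  \<open>exp (- x\<^sup>2/2 + a x)\<close> with complex \<open>a\<close>. The propagator moves \<open>a\<close> to \<open>exp (2it) a\<close>, so that the time
  side becomes the average of \<open>exp (P w + Q / w)\<close> over \<open>w = exp (4it)\<close> on the unit circle, where \<open>P\<close> depends on
  the first three parameters and \<open>Q\<close> on the last three. The rotation side becomes the average of
  \<open>exp (p exp (i\<theta>) + q exp (-i\<theta>))\<close>. Such averages depend only on the products \<open>PQ\<close> and \<open>pq\<close>, and these agree.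

  The form \<open>E\<^sub>R\<close> is bounded on \<open>L\<^sup>2\<close> because \<open>R\<close> preserves Lebesgue measure, so the identity
  on sums of Gaussians with all six functions equal is the Strichartz estimate \<open>L\<^sup>2 \<rightarrow> L\<^sup>6\<close>
  for them. Since these sums are dense, the estimate and then, slot by slot, the identity extend to \<open>L\<^sup>2\<close>.
  The operators are given by the kernel obtained by integrating out the first two coordinates.\<close>

section \<open>Square-integrable functions\<close>

text \<open>The products agree for a geometric reason. Let n be the unit axis, and let u and v be
  the components orthogonal to n of the vector of the first three parameters and of the vector of
  the conjugates of the last three. With the bilinear, not Hermitian, dot product, completing the
  square gives P = -(u.u)/4 and Q = -(v.v)/4. The rotation turns v against u and gives pq = ((u.v)^2
  + (n.(u x v))^2)/16. Lagrange's identity in the plane orthogonal to n equates PQ and pq. Two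
  obstacles shape the rest. The propagator is known only through its axioms, and each
  \<open>U t f\<close> only up to a null set depending on t. It is therefore identified explicitly
  on Gaussians; since it is isometric, one approximating sequence then serves all times at once,
  which yields a jointly measurable version. Likewise the operators are arbitrary representatives
  given by duality for each angle separately, so an explicit kernel has to supply measurability in
  the angle. Density comes from wrapping a compactly supported function around the circle and
  approximating it there by trigonometric polynomials.\<close>

lemma borel_measurable_cnj_comp [measurable (raw)]:
  "f \<in> borel_measurable M \<Longrightarrow> (\<lambda>x. cnj (f x)) \<in> borel_measurable M"
  by (rule borel_measurable_continuous_on[where f=cnj]) (auto intro: continuous_intros)

lemma integrable_mult_of_squares:
  fixes f g :: "'a \<Rightarrow> real"
  assumes [measurable]: "f \<in> borel_measurable M" "g \<in> borel_measurable M"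
    and f: "integrable M (\<lambda>x. (f x)\<^sup>2)" and g: "integrable M (\<lambda>x. (g x)\<^sup>2)"
  shows "integrable M (\<lambda>x. f x * g x)"
proof (rule Bochner_Integration.integrable_bound)
  show "integrable M (\<lambda>x. (f x)\<^sup>2 + (g x)\<^sup>2)" using f g by simp
  have "\<bar>a * b\<bar> \<le> a\<^sup>2 + b\<^sup>2" for a b :: real
    using sum_squares_bound[of "\<bar>a\<bar>" "\<bar>b\<bar>"] abs_ge_zero[of "a*b"] unfolding abs_mult power2_abs by linarith
  then show "AE x in M. norm (f x * g x) \<le> norm ((f x)\<^sup>2 + (g x)\<^sup>2)" by auto
qed simp

text \<open>The inequality for nonnegative integrals, transferred through finiteness of all three
  integrals. The squared form keeps square roots out of the estimates that follow.\<close>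

lemma Cauchy_Schwarz_integral:
  fixes f g :: "'a \<Rightarrow> real"
  assumes [measurable]: "f \<in> borel_measurable M" "g \<in> borel_measurable M"
    and f: "integrable M (\<lambda>x. (f x)\<^sup>2)" and g: "integrable M (\<lambda>x. (g x)\<^sup>2)"
    and nonneg: "\<And>x. 0 \<le> f x" "\<And>x. 0 \<le> g x"
  shows "(LINT x|M. f x * g x)\<^sup>2 \<le> (LINT x|M. (f x)\<^sup>2) * (LINT x|M. (g x)\<^sup>2)"
proof -
  have "(\<integral>\<^sup>+x. ennreal (f x) * ennreal (g x) \<partial>M)\<^sup>2 \<le>
      (\<integral>\<^sup>+x. ennreal (f x) ^ 2 \<partial>M) * (\<integral>\<^sup>+x. ennreal (g x) ^ 2 \<partial>M)"
    by (rule Cauchy_Schwarz_nn_integral) auto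
  moreover have "(\<integral>\<^sup>+x. ennreal (f x) * ennreal (g x) \<partial>M) = ennreal (LINT x|M. f x * g x)"
    using nonneg integrable_mult_of_squares[OF assms(1-4)]
    by (subst nn_integral_eq_integral[symmetric]) (auto simp: ennreal_mult)
  moreover have "(\<integral>\<^sup>+x. ennreal (f x) ^ 2 \<partial>M) = ennreal (LINT x|M. (f x)\<^sup>2)"
    using nonneg f by (subst nn_integral_eq_integral[symmetric]) (auto simp: ennreal_power)
  moreover have "(\<integral>\<^sup>+x. ennreal (g x) ^ 2 \<partial>M) = ennreal (LINT x|M. (g x)\<^sup>2)"
    using nonneg g by (subst nn_integral_eq_integral[symmetric]) (auto simp: ennreal_power)
  ultimately show ?thesis
    using nonneg by (simp add: ennreal_power ennreal_mult[symmetric] integral_nonneg_AE)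
qed

text \<open>The squared norm is multiplicative over coordinates and suited to dominated convergence;
  \<open>l2_norm\<close> serves where the triangle inequality is wanted.\<close>

definition l2_square :: "(real \<Rightarrow> complex) \<Rightarrow> real" where
  "l2_square f = (LINT x|lborel. (cmod (f x))\<^sup>2)"

lemma l2_square_nonneg [simp]: "0 \<le> l2_square f"
  unfolding l2_square_def by simp

lemma l2_norm_eq: "l2_norm f = sqrt (l2_square f)"
  unfolding l2_norm_def l2_square_def ..

lemma l2_norm_nonneg [simp]: "0 \<le> l2_norm f"
  by (simp add: l2_norm_eq)

lemma L2_measurable [measurable_dest]: "f \<in> L2 \<Longrightarrow> f \<in> borel_measurable borel"
  unfolding L2_def by simp

lemma L2_integrable: "f \<in> L2 \<Longrightarrow> integrable lborel (\<lambda>x. (cmod (f x))\<^sup>2)"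
  unfolding L2_def by simp

lemma L2_bound:
  assumes [measurable]: "f \<in> borel_measurable borel" and "integrable lborel g"
    and "\<And>x. (cmod (f x))\<^sup>2 \<le> g x"
  shows "f \<in> L2"
proof -
  have "integrable lborel (\<lambda>x. (cmod (f x))\<^sup>2)"
    by (rule Bochner_Integration.integrable_bound[OF assms(2)]) (use assms(3) in \<open>auto intro: order_trans[OF _ abs_ge_self]\<close>)
  then show ?thesis unfolding L2_def by simp
qed

lemma norm_add_square_le: "(cmod (a + b))\<^sup>2 \<le> 2 * (cmod a)\<^sup>2 + 2 * (cmod b)\<^sup>2"
proof -
  have "(cmod (a + b))\<^sup>2 \<le> (cmod a + cmod b)\<^sup>2"
    by (intro power_mono norm_triangle_ineq) auto
  also have "\<dots> \<le> 2 * (cmod a)\<^sup>2 + 2 * (cmod b)\<^sup>2"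
    using sum_squares_bound[of "cmod a" "cmod b"] by (simp add: power2_sum)
  finally show ?thesis .
qed

lemma L2_scale: "f \<in> L2 \<Longrightarrow> (\<lambda>x. a * f x) \<in> L2"
  by (rule L2_bound[where g="\<lambda>x. (cmod a)\<^sup>2 * (cmod (f x))\<^sup>2"])
    (auto simp: norm_mult power_mult_distrib intro!: L2_integrable dest: L2_measurable)

lemma L2_add: "f \<in> L2 \<Longrightarrow> g \<in> L2 \<Longrightarrow> (\<lambda>x. f x + g x) \<in> L2"
  by (rule L2_bound[where g="\<lambda>x. 2 * (cmod (f x))\<^sup>2 + 2 * (cmod (g x))\<^sup>2"])
    (auto intro!: L2_integrable norm_add_square_le dest: L2_measurable)

lemma L2_diff: "f \<in> L2 \<Longrightarrow> g \<in> L2 \<Longrightarrow> (\<lambda>x. f x - g x) \<in> L2"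
  using L2_add[OF _ L2_scale[of g "-1"]] by simp

lemma L2_cnj: "f \<in> L2 \<Longrightarrow> (\<lambda>x. cnj (f x)) \<in> L2"
  by (rule L2_bound[where g="\<lambda>x. (cmod (f x))\<^sup>2"]) (auto intro!: L2_integrable dest: L2_measurable)

lemma L2_mult_integrable:
  assumes f: "f \<in> L2" and g: "g \<in> L2"
  shows "integrable lborel (\<lambda>x. f x * g x)"
proof (rule Bochner_Integration.integrable_bound)
  show "integrable lborel (\<lambda>x. cmod (f x) * cmod (g x))"
    by (rule integrable_mult_of_squares) (use f g in \<open>auto intro!: L2_integrable\<close>)
qed (use f g in \<open>auto simp: norm_mult\<close>)

lemma L2_inner_integrable: "f \<in> L2 \<Longrightarrow> g \<in> L2 \<Longrightarrow> integrable lborel (\<lambda>x. f x * cnj (g x))"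
  by (rule L2_mult_integrable[OF _ L2_cnj])

lemma l2_norm_cong_AE:
  assumes "f \<in> borel_measurable borel" "g \<in> borel_measurable borel" "AE x in lborel. f x = g x"
  shows "l2_norm f = l2_norm g"
  unfolding l2_norm_def by (intro arg_cong[where f=sqrt] integral_cong_AE) (use assms in auto)

lemma l2_square_cong_AE:
  assumes "f \<in> borel_measurable borel" "g \<in> borel_measurable borel" "AE x in lborel. f x = g x"
  shows "l2_square f = l2_square g"
  unfolding l2_square_def by (intro integral_cong_AE) (use assms in auto)

lemma l2_square_inner: "of_real (l2_square f) = l2_inner f f"
  unfolding l2_square_def l2_inner_def
  by (simp add: complex_norm_square[symmetric] del: of_real_power flip: integral_of_real)

lemma l2_square_scale: "l2_square (\<lambda>x. a * f x) = (cmod a)\<^sup>2 * l2_square f"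
  unfolding l2_square_def by (simp add: norm_mult power_mult_distrib)

lemma l2_norm_scale: "l2_norm (\<lambda>x. a * f x) = cmod a * l2_norm f"
  unfolding l2_norm_eq by (simp add: l2_square_scale real_sqrt_mult)

lemma l2_norm_triangle:
  assumes f: "f \<in> L2" and g: "g \<in> L2"
  shows "l2_norm (\<lambda>x. f x + g x) \<le> l2_norm f + l2_norm g"
proof -
  have fg: "integrable lborel (\<lambda>x. cmod (f x) * cmod (g x))"
    by (rule integrable_mult_of_squares) (use f g in \<open>auto intro!: L2_integrable\<close>)
  have cs: "(LINT x|lborel. cmod (f x) * cmod (g x))\<^sup>2 \<le> l2_square f * l2_square g"
    unfolding l2_square_def
    by (rule Cauchy_Schwarz_integral) (use f g in \<open>auto intro!: L2_integrable\<close>)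
  then have cs': "(LINT x|lborel. cmod (f x) * cmod (g x)) \<le> l2_norm f * l2_norm g"
    unfolding l2_norm_eq real_sqrt_mult[symmetric] by (rule real_le_rsqrt)
  have "l2_square (\<lambda>x. f x + g x) \<le>
      (LINT x|lborel. (cmod (f x))\<^sup>2 + (cmod (g x))\<^sup>2 + 2 * (cmod (f x) * cmod (g x)))"
    unfolding l2_square_def
  proof (rule integral_mono)
    show "integrable lborel (\<lambda>x. (cmod (f x + g x))\<^sup>2)" by (intro L2_integrable L2_add f g)
    show "integrable lborel (\<lambda>x. (cmod (f x))\<^sup>2 + (cmod (g x))\<^sup>2 + 2 * (cmod (f x) * cmod (g x)))"
      using L2_integrable[OF f] L2_integrable[OF g] fg by simp
    fix x
    have "(cmod (f x + g x))\<^sup>2 \<le> (cmod (f x) + cmod (g x))\<^sup>2"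
      by (intro power_mono norm_triangle_ineq) auto
    then show "(cmod (f x + g x))\<^sup>2 \<le> (cmod (f x))\<^sup>2 + (cmod (g x))\<^sup>2 + 2 * (cmod (f x) * cmod (g x))"
      by (simp add: power2_sum)
  qed
  also have "\<dots> = l2_square f + l2_square g + 2 * (LINT x|lborel. cmod (f x) * cmod (g x))"
    unfolding l2_square_def using L2_integrable[OF f] L2_integrable[OF g] fg by simp
  also have "\<dots> \<le> (l2_norm f + l2_norm g)\<^sup>2"
    using cs' by (simp add: power2_sum l2_norm_eq)
  finally have "sqrt (l2_square (\<lambda>x. f x + g x)) \<le> sqrt ((l2_norm f + l2_norm g)\<^sup>2)"
    by (rule real_sqrt_le_mono)
  then show ?thesis by (simp add: l2_norm_eq)
qed

lemma l2_norm_diff_triangle: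
  assumes f: "f \<in> L2" and g: "g \<in> L2" and h: "h \<in> L2"
  shows "l2_norm (\<lambda>x. f x - h x) \<le> l2_norm (\<lambda>x. f x - g x) + l2_norm (\<lambda>x. g x - h x)"
  using l2_norm_triangle[OF L2_diff[OF f g] L2_diff[OF g h]] by simp

lemma l2_norm_minus_commute: "l2_norm (\<lambda>x. f x - g x) = l2_norm (\<lambda>x. g x - f x)"
  unfolding l2_norm_def by (simp add: norm_minus_commute)

lemma l2_square_0_AE:
  assumes "f \<in> L2" and "l2_square f = 0"
  shows "AE x in lborel. f x = 0"
  using integral_nonneg_eq_0_iff_AE[OF L2_integrable[OF assms(1)]] assms(2)
  unfolding l2_square_def by simp

text \<open>Testing both functions against \<open>h - k\<close> makes the norm of the difference
  vanish. This pins down the choice hidden in \<open>riesz_vector\<close> up to null sets.\<close>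

lemma represents_unique:
  assumes "represents h F" "represents k F"
  shows "AE x in lborel. h x = k x"
proof -
  have h: "h \<in> L2" and k: "k \<in> L2" using assms unfolding represents_def by auto
  note d = L2_diff[OF h k]
  have "l2_inner h (\<lambda>x. h x - k x) = l2_inner k (\<lambda>x. h x - k x)"
    using assms d unfolding represents_def by metis
  then have "l2_inner (\<lambda>x. h x - k x) (\<lambda>x. h x - k x) = 0"
    unfolding l2_inner_def
    by (subst left_diff_distrib, subst Bochner_Integration.integral_diff)
      (use L2_inner_integrable[OF h d] L2_inner_integrable[OF k d] in auto)
  then have "l2_square (\<lambda>x. h x - k x) = 0"
    unfolding l2_square_inner[symmetric] by simp
  from l2_square_0_AE[OF d this] show ?thesis by simp
qed

section \<open>Gaussian integrals and the graph of the oscillator\<close>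

text \<open>This is the characteristic function of the standard normal distribution, freed of its
  normalisation.\<close>

lemma has_bochner_integral_gaussian_iexp:
  "has_bochner_integral lborel (\<lambda>x. exp (complex_of_real (- x\<^sup>2 / 2) + \<i> * of_real (t * x)))
     (of_real (sqrt (2 * pi)) * exp (- of_real (t\<^sup>2 / 2)))"
proof -
  have eq: "exp (complex_of_real (- x\<^sup>2 / 2) + \<i> * of_real (t * x)) =
      of_real (sqrt (2 * pi)) * (std_normal_density x *\<^sub>R iexp (t * x))" for x
    unfolding std_normal_density_def exp_add exp_of_real by (simp add: scaleR_conv_of_real)
  have m: "(\<lambda>x. iexp (t * x)) \<in> borel_measurable borel" by measurable
  have "integrable lborel (\<lambda>x. std_normal_density x *\<^sub>R iexp (t * x))"
    by (rule Bochner_Integration.integrable_bound[where f=std_normal_density])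
      (use m in \<open>auto simp: integrable_normal_density\<close>)
  moreover have "(LINT x|lborel. std_normal_density x *\<^sub>R iexp (t * x)) = exp (- of_real (t\<^sup>2 / 2))"
    using fun_cong[OF char_std_normal_distribution, of t] m
    unfolding char_def by (simp add: integral_density exp_of_real[symmetric])
  ultimately have "has_bochner_integral lborel (\<lambda>x. std_normal_density x *\<^sub>R iexp (t * x)) (exp (- of_real (t\<^sup>2 / 2)))"
    unfolding has_bochner_integral_iff by blast
  then show ?thesis unfolding eq by (intro has_bochner_integral_mult_right)
qed

text \<open>The real part of \<open>c\<close> is removed by completing the square with a real shift,
  and the imaginary part is a Fourier frequency, so no contour has to be moved.\<close>

lemma has_bochner_integral_gaussian:
  fixes s :: real and c :: complex
  assumes s: "0 < s"
  shows "has_bochner_integral lborel (\<lambda>x. exp (of_real (- s * x\<^sup>2) + c * of_real x))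
    (of_real (sqrt (pi / s)) * exp (c\<^sup>2 / of_real (4 * s)))"
proof -
  \<comment> \<open>The substitution is x to \<open>T + C * x\<close>: \<open>C\<close> normalises
    the quadratic term, \<open>T\<close> absorbs \<open>Re c\<close>, \<open>t\<close> is the
    frequency that \<open>Im c\<close> leaves, and \<open>k\<close> collects the constants.\<close>
  define C where "C = sqrt (2 * s)"
  define T where "T = - Re c / C"
  define t where "t = Im c / C"
  define k where "k = exp (of_real (T\<^sup>2 / 2) - \<i> * of_real (t * T))"
  have C: "C > 0" "C\<^sup>2 = 2 * s" unfolding C_def using s by auto
  have TC: "T * C = - Re c" "t * C = Im c" using C by (auto simp: T_def t_def)
  have T2: "T\<^sup>2 = (Re c)\<^sup>2 / (2 * s)" "t\<^sup>2 = (Im c)\<^sup>2 / (2 * s)" "t * T = - (Re c * Im c) / (2 * s)"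
    using C by (auto simp: T_def t_def power_divide power2_eq_square[symmetric])
  have eq: "k * exp (complex_of_real (- (T + C * x)\<^sup>2 / 2) + \<i> * of_real (t * (T + C * x))) =
      exp (of_real (- s * x\<^sup>2) + c * of_real x)" for x
  proof -
    have "(T + C * x)\<^sup>2 = T\<^sup>2 + 2 * (T * C) * x + C\<^sup>2 * x\<^sup>2" by algebra
    then have *: "(T + C * x)\<^sup>2 = T\<^sup>2 - 2 * Re c * x + 2 * s * x\<^sup>2" using TC C by simp
    have "t * (T + C * x) = t * T + (t * C) * x" by algebra
    then have "t * (T + C * x) = t * T + Im c * x" using TC by simp
    with * have "(of_real (T\<^sup>2 / 2) - \<i> * of_real (t * T)) +
       (complex_of_real (- (T + C * x)\<^sup>2 / 2) + \<i> * of_real (t * (T + C * x))) =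
       of_real (- s * x\<^sup>2) + c * of_real x"
      by (simp add: complex_eq_iff diff_divide_distrib add_divide_distrib)
    then show ?thesis by (simp only: k_def exp_add[symmetric])
  qed
  have "has_bochner_integral lborel
      (\<lambda>x. exp (complex_of_real (- (T + C * x)\<^sup>2 / 2) + \<i> * of_real (t * (T + C * x))))
      ((of_real (sqrt (2 * pi)) * exp (- of_real (t\<^sup>2 / 2))) /\<^sub>R \<bar>C\<bar>)"
    using lborel_has_bochner_integral_real_affine_iff[of C, THEN iffD1, OF _ has_bochner_integral_gaussian_iexp] C
    by simp
  then have "has_bochner_integral lborel
      (\<lambda>x. k * exp (complex_of_real (- (T + C * x)\<^sup>2 / 2) + \<i> * of_real (t * (T + C * x))))
      (k * ((of_real (sqrt (2 * pi)) * exp (- of_real (t\<^sup>2 / 2))) /\<^sub>R \<bar>C\<bar>))"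
    by (intro has_bochner_integral_mult_right)
  then have "has_bochner_integral lborel (\<lambda>x. exp (of_real (- s * x\<^sup>2) + c * of_real x))
      (k * ((of_real (sqrt (2 * pi)) * exp (- of_real (t\<^sup>2 / 2))) /\<^sub>R \<bar>C\<bar>))"
    unfolding eq .
  also have "k * ((of_real (sqrt (2 * pi)) * exp (- of_real (t\<^sup>2 / 2))) /\<^sub>R \<bar>C\<bar>) =
      of_real (sqrt (2 * pi) / C) * (k * exp (- of_real (t\<^sup>2 / 2)))"
    using C by (simp add: scaleR_conv_of_real field_simps)
  also have "sqrt (2 * pi) / C = sqrt (pi / s)"
    unfolding C_def real_sqrt_divide[symmetric] using s by (simp add: field_simps)
  also have "k * exp (- of_real (t\<^sup>2 / 2)) = exp (c\<^sup>2 / of_real (4 * s))"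
  proof -
    have "of_real (T\<^sup>2 / 2) - \<i> * of_real (t * T) + - of_real (t\<^sup>2 / 2) = c\<^sup>2 / of_real (4 * s)"
      unfolding T2 using s
      by (simp add: complex_eq_iff Re_divide_of_real Im_divide_of_real power2_eq_square field_simps)
    then show ?thesis by (simp only: k_def exp_add[symmetric])
  qed
  finally show ?thesis .
qed

section \<open>Values of H on smooth functions\<close>

lemma interval_integrals_zero_AE:
  fixes d :: "real \<Rightarrow> complex"
  assumes int: "\<And>a b. set_integrable lborel {a..b} d"
    and zero: "\<And>a b. (LINT x:{a..b}|lborel. d x) = 0"
  shows "AE x in lborel. d x = 0"
proof -
  \<comment> \<open>The cutoff makes \<open>d\<close> integrable on the whole line. Intervals
    generate the Borel sets, and complements are handled by subtracting from the integral over the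
    window, which is zero.\<close>
  have "AE x in lborel. indicator {- real n..real n} x *\<^sub>R d x = 0" for n
  proof (rule sigma_finite_measure.density_zero[OF lborel.sigma_finite_measure_axioms])
    let ?S = "{- real n..real n}"
    let ?d = "\<lambda>x. indicator ?S x *\<^sub>R d x"
    show i: "integrable lborel ?d"
      using int unfolding set_integrable_def by simp
    fix A :: "real set" assume "A \<in> sets lborel"
    then have "A \<in> sets borel" by simp
    then show "set_lebesgue_integral lborel A ?d = 0"
    proof (induction A rule: borel_set_induct)
      case empty then show ?case by (simp add: set_lebesgue_integral_def)
    next
      case (interval a b)
      have "set_lebesgue_integral lborel {a..b} ?d = (LINT x:{max a (- real n)..min b (real n)}|lborel. d x)"
        unfolding set_lebesgue_integral_def by (intro Bochner_Integration.integral_cong) (auto simp: indicator_def)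
      then show ?case using zero by simp
    next
      case (compl A)
      have iA: "integrable lborel (\<lambda>x. indicator A x *\<^sub>R ?d x)"
        by (rule integrable_mult_indicator) (use compl i in auto)
      have "set_lebesgue_integral lborel (- A) ?d = integral\<^sup>L lborel ?d - set_lebesgue_integral lborel A ?d"
        unfolding set_lebesgue_integral_def Bochner_Integration.integral_diff[OF i iA, symmetric]
        by (intro Bochner_Integration.integral_cong) (auto simp: indicator_def)
      then show ?case using compl zero[of "- real n" "real n"] by (simp add: set_lebesgue_integral_def)
    next
      case (union A)
      have "set_lebesgue_integral lborel (\<Union>i. A i) ?d = (\<Sum>i. set_lebesgue_integral lborel (A i) ?d)"
      proof (rule lebesgue_integral_countable_add)
        show "set_integrable lborel (\<Union>i. A i) ?d"
          unfolding set_integrable_def by (rule integrable_mult_indicator) (use union i in auto)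
      qed (use union in \<open>auto simp: disjoint_family_on_def\<close>)
      then show ?case using union by simp
    qed
  qed
  then have "AE x in lborel. \<forall>n. indicator {- real n..real n} x *\<^sub>R d x = 0"
    unfolding AE_all_countable by blast
  then show ?thesis
  proof eventually_elim
    case (elim x)
    obtain n where "\<bar>x\<bar> \<le> real n" using real_arch_simple by blast
    then have "x \<in> {- real n..real n}" by auto
    then show ?case using elim[rule_format, of n] by simp
  qed
qed

text \<open>The set where two continuous functions differ is open, and a nonempty open set is not
  null.\<close>

lemma continuous_AE_eq:
  fixes u v :: "real \<Rightarrow> complex"
  assumes "continuous_on UNIV u" "continuous_on UNIV v" "AE x in lborel. u x = v x"
  shows "u = v"
proof -
  have "open {x. u x \<noteq> v x}" by (intro open_Collect_neq assms)
  moreover have "negligible {x. u x \<noteq> v x}"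
    using AE_completion[OF assms(3)] AE_iff_null_sets[of "{x. u x \<noteq> v x}" lebesgue] \<open>open {x. u x \<noteq> v x}\<close>
    by (auto simp: negligible_iff_null_sets)
  ultimately have "{x. u x \<noteq> v x} = {}" using open_not_negligible by blast
  then show ?thesis by auto
qed

text \<open>\<open>oscillator\<close> only asserts that some representatives \<open>u\<close>,
  \<open>u1\<close>, \<open>u2\<close> exist. For a twice continuously differentiable function they
  are forced: \<open>u\<close> by continuity, \<open>u1\<close> as its derivative, and
  \<open>u2\<close> almost everywhere because it has the same integrals over intervals as the
  classical second derivative.\<close>

lemma oscillator_unique:
  assumes osc: "oscillator f g" and f: "AE x in lborel. f x = \<phi> x"
    and d1: "\<And>x. (\<phi> has_vector_derivative \<phi>1 x) (at x)"
    and d2: "\<And>x. (\<phi>1 has_vector_derivative \<phi>2 x) (at x)" and cont: "continuous_on UNIV \<phi>2"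
  shows "AE x in lborel. g x = - \<phi>2 x + of_real (x\<^sup>2) * \<phi> x"
proof -
  obtain u u1 u2 where u: "AE x in lborel. f x = u x" "\<And>x. (u has_vector_derivative u1 x) (at x)"
    "\<And>a b. a \<le> b \<Longrightarrow> set_integrable lborel {a..b} u2 \<and> u1 b - u1 a = (LINT x:{a..b}|lborel. u2 x)"
    "AE x in lborel. g x = - u2 x + of_real (x\<^sup>2) * u x"
    using osc unfolding oscillator_def by blast
  have "u = \<phi>"
  proof (rule continuous_AE_eq)
    show "continuous_on UNIV u" "continuous_on UNIV \<phi>"
      using u(2) d1 by (auto intro!: continuous_at_imp_continuous_on has_vector_derivative_continuous)
    show "AE x in lborel. u x = \<phi> x" using u(1) f by eventually_elim simp
  qed
  moreover have "u1 = \<phi>1"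
    using u(2) d1 \<open>u = \<phi>\<close> vector_derivative_unique_at by (intro ext) blast
  moreover have "AE x in lborel. u2 x - \<phi>2 x = 0"
  proof (rule interval_integrals_zero_AE)
    fix a b :: real
    have c: "continuous_on {a..b} \<phi>2" using cont continuous_on_subset by blast
    show i: "set_integrable lborel {a..b} (\<lambda>x. u2 x - \<phi>2 x)"
      using u(3)[of a b] borel_integrable_atLeastAtMost'[OF c]
      by (cases "a \<le> b") (auto simp: set_integrable_def dest: set_integral_diff(1)[unfolded set_integrable_def])
    show "(LINT x:{a..b}|lborel. u2 x - \<phi>2 x) = 0"
    proof (cases "a \<le> b")
      case True
      have "(LINT x:{a..b}|lborel. \<phi>2 x) = \<phi>1 b - \<phi>1 a"
        unfolding set_lebesgue_integral_def
        by (rule integral_FTC_Icc[OF True _ c]) (use d2 in \<open>auto intro: has_vector_derivative_at_within\<close>)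
      then show ?thesis
        using u(3)[OF True] borel_integrable_atLeastAtMost'[OF c] \<open>u1 = \<phi>1\<close>
        by (simp add: set_integral_diff)
    qed (simp add: set_lebesgue_integral_def)
  qed
  ultimately show ?thesis using u(4) by (auto elim!: AE_mp simp: algebra_simps)
qed

section \<open>The flow of Gaussian wave packets\<close>

text \<open>The factor comes from the Hermite generating function: exp(-x^2/2 + a x - a^2/4) is the
  sum over n of (a/2)^n/n! times the n-th Hermite polynomial times exp(-x^2/2). The eigenvalue 2n+1
  multiplies the n-th term by exp(it) exp(2it)^n, hence \<open>a\<close> by exp(2it).\<close>

definition phase :: "complex \<Rightarrow> complex" where
  "phase z = exp (2 * \<i> * z)"

text \<open>\<open>evol a t\<close> is \<open>e\<^bsup>itH\<^esup>\<close> applied to \<open>exp (- x\<^sup>2/2 + a x)\<close>, and \<open>evolH a t\<close> is its image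
  under \<open>H\<close>. The argument of \<open>phase\<close> is complex so that \<open>t\<close>-derivatives can be computed holomorphically.\<close>

definition evol :: "complex \<Rightarrow> real \<Rightarrow> real \<Rightarrow> complex" where
  "evol a t x = exp (\<i> * of_real t + a\<^sup>2 / 4 - (phase (of_real t) * a)\<^sup>2 / 4 - (of_real x)\<^sup>2 / 2 + phase (of_real t) * a * of_real x)"

definition evolH :: "complex \<Rightarrow> real \<Rightarrow> real \<Rightarrow> complex" where
  "evolH a t x = (1 - (phase (of_real t) * a)\<^sup>2 + 2 * (phase (of_real t) * a) * of_real x) * evol a t x"

lemma norm_phase [simp]: "cmod (phase (of_real t)) = 1"
  by (simp add: phase_def norm_exp_eq_Re)

lemma has_vector_derivative_evol_x:
  "((\<lambda>x. evol a t x) has_vector_derivative (phase (of_real t) * a - of_real x) * evol a t x) (at x)"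
  unfolding evol_def
  by (rule has_vector_derivative_real_field) (auto intro!: derivative_eq_intros simp: algebra_simps)

lemma has_vector_derivative_evol_xx:
  "((\<lambda>x. (phase (of_real t) * a - of_real x) * evol a t x) has_vector_derivative
     ((phase (of_real t) * a - of_real x)\<^sup>2 - 1) * evol a t x) (at x)"
  unfolding evol_def
  by (rule has_vector_derivative_real_field) (auto intro!: derivative_eq_intros simp: algebra_simps power2_eq_square)

lemma has_field_derivative_evol_t:
  "((\<lambda>z. exp (\<i> * z + a\<^sup>2 / 4 - (phase z * a)\<^sup>2 / 4 - (of_real x)\<^sup>2 / 2 + phase z * a * of_real x))
    has_field_derivative \<i> * evolH a t x) (at (of_real t))"
  unfolding evol_def evolH_def phase_def
  by (auto intro!: derivative_eq_intros simp: algebra_simps power2_eq_square)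

lemma has_vector_derivative_evol_t:
  "((\<lambda>t. evol a t x) has_vector_derivative \<i> * evolH a t x) (at t)"
  using has_field_derivative_evol_t[of a x t] unfolding evol_def[abs_def]
  by (rule has_vector_derivative_real_field)

lemma continuous_on_evol [continuous_intros]:
  "continuous_on S f \<Longrightarrow> continuous_on S g \<Longrightarrow> continuous_on S (\<lambda>z. evol a (f z) (g z))"
  unfolding evol_def phase_def by (intro continuous_intros) auto

lemma borel_measurable_evol [measurable]:
  "(\<lambda>x. evol a t x) \<in> borel_measurable borel"
  by (intro borel_measurable_continuous_onI continuous_intros)

lemma borel_measurable_evolH [measurable]:
  "(\<lambda>x. evolH a t x) \<in> borel_measurable borel"
  unfolding evolH_def by measurable

text \<open>With r the modulus of \<open>a\<close>, the two terms quadratic in \<open>a\<close> cost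
  exp(r^2/2). Absorbing (r+2)|x| into x^2/4 costs exp((r+2)^2), where the 2 pays for a quadratic
  factor in x. The last factor covers coefficients quadratic in r.\<close>

definition gauss_const :: "complex \<Rightarrow> real" where
  "gauss_const a = exp ((cmod a)\<^sup>2 / 2 + (cmod a + 2)\<^sup>2) * (1 + cmod a)\<^sup>2"

lemma gauss_const_pos: "0 < gauss_const a"
  using norm_ge_zero[of a] unfolding gauss_const_def by (intro mult_pos_pos zero_less_power) (auto simp del: norm_ge_zero)

text \<open>The bound is uniform in \<open>t\<close>, and its polynomial weight is room for the
  coefficients produced by two derivatives or by multiplication with x^2.\<close>

lemma norm_evol_bound:
  "cmod (evol a t x) * ((1 + cmod a)\<^sup>2 * (1 + \<bar>x\<bar>)\<^sup>2) \<le> gauss_const a * exp (- x\<^sup>2 / 4)"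
proof -
  let ?w = "phase (of_real t) * a" and ?r = "cmod a"
  have w: "cmod ?w = ?r" by (simp add: norm_mult)
  have 1: "\<bar>Re (a\<^sup>2)\<bar> \<le> ?r\<^sup>2" using abs_Re_le_cmod[of "a\<^sup>2"] by (simp add: norm_power)
  have 2: "\<bar>Re (?w\<^sup>2)\<bar> \<le> ?r\<^sup>2" using abs_Re_le_cmod[of "?w\<^sup>2"] w by (simp add: norm_power)
  have 3: "Re ?w * x \<le> ?r * \<bar>x\<bar>"
  proof -
    have "Re ?w * x \<le> \<bar>Re ?w * x\<bar>" by (rule abs_ge_self)
    also have "\<dots> = \<bar>Re ?w\<bar> * \<bar>x\<bar>" by (rule abs_mult)
    also have "\<dots> \<le> cmod ?w * \<bar>x\<bar>" by (intro mult_right_mono abs_Re_le_cmod) simp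
    finally show ?thesis using w by simp
  qed
  have "cmod (evol a t x) = exp (Re (a\<^sup>2) / 4 - Re (?w\<^sup>2) / 4 - x\<^sup>2 / 2 + Re ?w * x)"
    unfolding evol_def norm_exp_eq_Re
    by (simp flip: of_real_power add: Re_divide_numeral)
  also have "\<dots> \<le> exp (?r\<^sup>2 / 2 + ?r * \<bar>x\<bar> - x\<^sup>2 / 2)" using 1 2 3 by simp
  finally have e: "cmod (evol a t x) \<le> exp (?r\<^sup>2 / 2 + ?r * \<bar>x\<bar> - x\<^sup>2 / 2)" .
  have "(1 + \<bar>x\<bar>)\<^sup>2 \<le> (exp \<bar>x\<bar>)\<^sup>2" by (intro power_mono) auto
  then have p: "(1 + \<bar>x\<bar>)\<^sup>2 \<le> exp (2 * \<bar>x\<bar>)" by (simp flip: exp_of_nat_mult)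
  have "cmod (evol a t x) * (1 + \<bar>x\<bar>)\<^sup>2 \<le> exp (?r\<^sup>2 / 2 + ?r * \<bar>x\<bar> - x\<^sup>2 / 2) * exp (2 * \<bar>x\<bar>)"
    by (intro mult_mono e p) auto
  also have "\<dots> = exp (?r\<^sup>2 / 2 + (?r + 2) * \<bar>x\<bar> - x\<^sup>2 / 2)"
    by (simp add: exp_add[symmetric] algebra_simps)
  also have "\<dots> \<le> exp (?r\<^sup>2 / 2 + (?r + 2)\<^sup>2 + - x\<^sup>2 / 4)"
  proof -
    have "(?r + 2) * \<bar>x\<bar> \<le> (?r + 2)\<^sup>2 + x\<^sup>2 / 4"
    proof -
      have "q * y \<le> q\<^sup>2 + y\<^sup>2 / 4" for q y :: real
        using zero_le_power2[of "q - y / 2"] by (simp add: power2_eq_square algebra_simps)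
      from this[of "?r + 2" "\<bar>x\<bar>"] show ?thesis by simp
    qed
    then show ?thesis by simp
  qed
  finally have "cmod (evol a t x) * (1 + \<bar>x\<bar>)\<^sup>2 \<le> exp (?r\<^sup>2 / 2 + (?r + 2)\<^sup>2) * exp (- x\<^sup>2 / 4)"
    by (simp only: exp_add)
  from mult_right_mono[OF this, of "(1 + ?r)\<^sup>2"] show ?thesis
    unfolding gauss_const_def by (simp add: mult_ac)
qed

lemma norm_evol_mult_bound:
  assumes "cmod p \<le> (1 + cmod a)\<^sup>2 * (1 + \<bar>x\<bar>)\<^sup>2"
  shows "cmod (p * evol a t x) \<le> gauss_const a * exp (- x\<^sup>2 / 4)"
proof -
  have "cmod (p * evol a t x) = cmod (evol a t x) * cmod p" by (simp add: norm_mult)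
  also have "\<dots> \<le> cmod (evol a t x) * ((1 + cmod a)\<^sup>2 * (1 + \<bar>x\<bar>)\<^sup>2)"
    by (intro mult_left_mono assms) auto
  also note norm_evol_bound
  finally show ?thesis .
qed

text \<open>These are the coefficients that occur in front of a packet: 1 for the packet itself,
  then those of its second derivative, of \<open>evolH\<close>, and of the potential term.\<close>

lemma poly_bounds:
  fixes r y :: real assumes "0 \<le> r" "0 \<le> y"
  shows "1 \<le> (1 + r)\<^sup>2 * (1 + y)\<^sup>2" "(r + y)\<^sup>2 + 1 \<le> (1 + r)\<^sup>2 * (1 + y)\<^sup>2"
    "1 + r\<^sup>2 + 2 * r * y \<le> (1 + r)\<^sup>2 * (1 + y)\<^sup>2" "y\<^sup>2 \<le> (1 + r)\<^sup>2 * (1 + y)\<^sup>2"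
proof -
  have "(r + y)\<^sup>2 + 1 \<le> (1 + r + y)\<^sup>2" using assms by (simp add: power2_sum power2_eq_square algebra_simps)
  also have "\<dots> \<le> ((1 + r) * (1 + y))\<^sup>2" using assms by (intro power_mono) (auto simp: algebra_simps)
  finally show *: "(r + y)\<^sup>2 + 1 \<le> (1 + r)\<^sup>2 * (1 + y)\<^sup>2" by (simp add: power_mult_distrib)
  show "1 \<le> (1 + r)\<^sup>2 * (1 + y)\<^sup>2" using * zero_le_power2[of "r + y"] by linarith
  show "1 + r\<^sup>2 + 2 * r * y \<le> (1 + r)\<^sup>2 * (1 + y)\<^sup>2"
    using * zero_le_power2[of y] by (simp only: power2_sum)
  have "0 \<le> r * y" using assms by simp
  then show "y\<^sup>2 \<le> (1 + r)\<^sup>2 * (1 + y)\<^sup>2"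
    using * zero_le_power2[of r] power2_sum[of r y] by linarith
qed

lemma norm_evol_le: "cmod (evol a t x) \<le> gauss_const a * exp (- x\<^sup>2 / 4)"
  using norm_evol_mult_bound[of 1 a x t] poly_bounds(1)[of "cmod a" "\<bar>x\<bar>"] by simp

lemma norm_evolH_le: "cmod (evolH a t x) \<le> gauss_const a * exp (- x\<^sup>2 / 4)"
  unfolding evolH_def
proof (rule norm_evol_mult_bound)
  let ?w = "phase (of_real t) * a"
  have "cmod (1 - ?w\<^sup>2 + 2 * ?w * of_real x) \<le> 1 + (cmod a)\<^sup>2 + 2 * cmod a * \<bar>x\<bar>"
    by (rule norm_triangle_le, rule add_mono, rule norm_triangle_le_diff) (auto simp: norm_mult norm_power)
  then show "cmod (1 - ?w\<^sup>2 + 2 * ?w * of_real x) \<le> (1 + cmod a)\<^sup>2 * (1 + \<bar>x\<bar>)\<^sup>2"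
    using poly_bounds(3)[of "cmod a" "\<bar>x\<bar>"] by simp
qed

lemma integrable_real_gaussian:
  assumes "0 < s" shows "integrable lborel (\<lambda>x::real. exp (- s * x\<^sup>2))"
  using integrable_norm[OF has_bochner_integral_gaussian[OF assms, of 0, unfolded has_bochner_integral_iff, THEN conjunct1]]
  by (simp add: norm_exp_eq_Re)

lemma L2_gaussian_bound:
  assumes m: "f \<in> borel_measurable borel" and b: "\<And>x. cmod (f x) \<le> K * exp (- x\<^sup>2 / 4)"
  shows "f \<in> L2"
proof (rule L2_bound[OF m, where g="\<lambda>x. K\<^sup>2 * exp (- (1/2) * x\<^sup>2)"])
  show "integrable lborel (\<lambda>x::real. K\<^sup>2 * exp (- (1/2) * x\<^sup>2))"
    by (intro integrable_mult_right integrable_real_gaussian) simp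
  fix x
  have "(cmod (f x))\<^sup>2 \<le> (K * exp (- x\<^sup>2 / 4))\<^sup>2" by (intro power_mono b) auto
  also have "\<dots> = K\<^sup>2 * exp (- (1/2) * x\<^sup>2)"
    by (simp add: power_mult_distrib flip: exp_of_nat_mult)
  finally show "(cmod (f x))\<^sup>2 \<le> K\<^sup>2 * exp (- (1/2) * x\<^sup>2)" .
qed

lemma evol_L2: "evol a t \<in> L2" and evolH_L2: "evolH a t \<in> L2"
  by (rule L2_gaussian_bound, measurable, rule norm_evol_le)
    (rule L2_gaussian_bound, measurable, rule norm_evolH_le)

lemma evolH_eq: "evolH a t x =
   - (((phase (of_real t) * a - of_real x)\<^sup>2 - 1) * evol a t x) + of_real (x\<^sup>2) * evol a t x"
  unfolding evolH_def by (simp add: algebra_simps power2_eq_square)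

lemma continuous_on_evol_xx:
  "continuous_on S (\<lambda>x. ((phase (of_real t) * a - of_real x)\<^sup>2 - 1) * evol a t x)"
  by (intro continuous_intros)

text \<open>This puts the packets into the domain of H, where the propagator is known to satisfy the
  evolution equation. The witnesses are the classical derivatives.\<close>

lemma oscillator_evol: "oscillator (evol a t) (evolH a t)"
  unfolding oscillator_def
proof (intro conjI exI)
  let ?u2 = "\<lambda>x. ((phase (of_real t) * a - of_real x)\<^sup>2 - 1) * evol a t x"
  show "evol a t \<in> L2" "evolH a t \<in> L2" by (rule evol_L2 evolH_L2)+
  show "AE x in lborel. evol a t x = evol a t x" by simp
  show "\<forall>x. (evol a t has_vector_derivative (phase (of_real t) * a - of_real x) * evol a t x) (at x)"
    using has_vector_derivative_evol_x by blast
  show "?u2 \<in> L2"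
  proof (rule L2_gaussian_bound, measurable, rule norm_evol_mult_bound)
    fix x
    have "cmod ((phase (of_real t) * a - of_real x)\<^sup>2 - 1) \<le> (cmod a + \<bar>x\<bar>)\<^sup>2 + 1"
    proof (rule norm_triangle_le_diff, rule add_mono)
      have "cmod (phase (of_real t) * a - of_real x) \<le> cmod a + \<bar>x\<bar>"
        by (rule norm_triangle_le_diff) (simp add: norm_mult)
      then show "cmod ((phase (of_real t) * a - of_real x)\<^sup>2) \<le> (cmod a + \<bar>x\<bar>)\<^sup>2"
        unfolding norm_power by (rule power_mono) simp
    qed simp
    then show "cmod ((phase (of_real t) * a - of_real x)\<^sup>2 - 1) \<le> (1 + cmod a)\<^sup>2 * (1 + \<bar>x\<bar>)\<^sup>2"
      using poly_bounds(2)[of "cmod a" "\<bar>x\<bar>"] by simp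
  qed
  show "(\<lambda>x. of_real (x\<^sup>2) * evol a t x) \<in> L2"
  proof (rule L2_gaussian_bound, measurable, rule norm_evol_mult_bound)
    fix x :: real
    show "cmod (complex_of_real (x\<^sup>2)) \<le> (1 + cmod a)\<^sup>2 * (1 + \<bar>x\<bar>)\<^sup>2"
      using poly_bounds(4)[of "cmod a" "\<bar>x\<bar>"] by (simp add: norm_power)
  qed
  show "AE x in lborel. evolH a t x = - ?u2 x + of_real (x\<^sup>2) * evol a t x" by (simp add: evolH_eq)
  show "\<forall>c b. c \<le> b \<longrightarrow> set_integrable lborel {c..b} ?u2 \<and>
      (phase (of_real t) * a - of_real b) * evol a t b - (phase (of_real t) * a - of_real c) * evol a t c =
      (LINT x:{c..b}|lborel. ?u2 x)"
  proof (intro allI impI conjI)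
    fix c b :: real assume "c \<le> b"
    show "set_integrable lborel {c..b} ?u2" by (rule borel_integrable_atLeastAtMost'[OF continuous_on_evol_xx])
    show "(phase (of_real t) * a - of_real b) * evol a t b - (phase (of_real t) * a - of_real c) * evol a t c =
      (LINT x:{c..b}|lborel. ?u2 x)"
      unfolding set_lebesgue_integral_def
      by (rule integral_FTC_Icc[OF \<open>c \<le> b\<close> _ continuous_on_evol_xx, symmetric])
        (auto intro: has_vector_derivative_at_within has_vector_derivative_evol_xx)
  qed
qed

text \<open>The mean value inequality turns the uniform bound on \<open>evolH\<close> into a
  majorant of the difference quotients in \<open>t\<close> that does not depend on the
  increment.\<close>

lemma norm_evol_diff_le:
  "cmod (evol a (t + h) x - evol a t x) \<le> gauss_const a * exp (- x\<^sup>2 / 4) * \<bar>h\<bar>"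
proof -
  have "norm (evol a (t + h) x - evol a t x) \<le> gauss_const a * exp (- x\<^sup>2 / 4) * norm (t + h - t)"
  proof (rule differentiable_bound[of UNIV])
    fix s
    show "((\<lambda>t. evol a t x) has_derivative (\<lambda>k. k *\<^sub>R (\<i> * evolH a s x))) (at s within UNIV)"
      using has_vector_derivative_evol_t[of a x s] unfolding has_vector_derivative_def by simp
    show "onorm (\<lambda>k. k *\<^sub>R (\<i> * evolH a s x)) \<le> gauss_const a * exp (- x\<^sup>2 / 4)"
      by (rule onorm_bound) (use norm_evolH_le[of a s x] gauss_const_pos[of a] in
        \<open>auto simp: norm_mult intro!: mult_left_mono simp: mult.commute\<close>)
  qed auto
  then show ?thesis by simp
qed

text \<open>The pointwise limit is the derivative in \<open>t\<close>. Dominated convergence along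
  an arbitrary sequence of increments turns it into a limit in norm.\<close>

lemma evol_quotient_tendsto:
  "((\<lambda>h. l2_norm (\<lambda>x. (evol a (t + h) x - evol a t x) / of_real h - \<i> * evolH a t x)) \<longlongrightarrow> 0) (at 0)"
  unfolding tendsto_at_iff_sequentially
proof (intro allI impI)
  fix X :: "nat \<Rightarrow> real" assume X0: "\<forall>i. X i \<in> UNIV - {0}" and X: "X \<longlonglongrightarrow> 0"
  let ?q = "\<lambda>i x. (evol a (t + X i) x - evol a t x) / of_real (X i) - \<i> * evolH a t x"
  let ?M = "\<lambda>x. gauss_const a * exp (- x\<^sup>2 / 4)"
  have bound: "cmod (?q i x) \<le> 2 * ?M x" for i x
  proof -
    have "cmod (evol a (t + X i) x - evol a t x) / \<bar>X i\<bar> \<le> ?M x"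
      using norm_evol_diff_le[of a t "X i" x] X0 by (simp add: pos_divide_le_eq)
    then have "cmod ((evol a (t + X i) x - evol a t x) / of_real (X i)) \<le> ?M x"
      by (simp add: norm_divide)
    then show ?thesis
      by (intro norm_triangle_le_diff) (use norm_evolH_le[of a t x] in \<open>auto simp: norm_mult\<close>)
  qed
  have lim: "(\<lambda>i. ?q i x) \<longlonglongrightarrow> 0" for x
  proof -
    have "(\<lambda>i. (evol a (t + X i) x - evol a t x) / of_real (X i)) \<longlonglongrightarrow> \<i> * evolH a t x"
    proof -
      have "\<forall>i. complex_of_real (X i) \<in> UNIV - {0}" "(\<lambda>i. complex_of_real (X i)) \<longlonglongrightarrow> 0"
        using X0 tendsto_of_real[OF X] by auto
      then show ?thesis
        using has_field_derivative_evol_t[of a x t, unfolded DERIV_def tendsto_at_iff_sequentially comp_def,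
            rule_format, of "\<lambda>i. of_real (X i)"]
        by (simp only: evol_def of_real_add)
    qed
    then show ?thesis by (simp add: LIM_zero)
  qed
  have "(\<lambda>i. LINT x|lborel. (cmod (?q i x))\<^sup>2) \<longlonglongrightarrow> (LINT x::real|lborel. (0::real))"
  proof (rule integral_dominated_convergence[where w="\<lambda>x::real. (2 * gauss_const a)\<^sup>2 * exp (- (1/2) * x\<^sup>2)"])
    show "integrable lborel (\<lambda>x::real. (2 * gauss_const a)\<^sup>2 * exp (- (1/2) * x\<^sup>2))"
      by (intro integrable_mult_right integrable_real_gaussian) simp
    show "AE x in lborel. (\<lambda>i. (cmod (?q i x))\<^sup>2) \<longlonglongrightarrow> 0"
      using tendsto_norm_zero[OF lim] by (intro AE_I2 tendsto_null_power) simp_all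
    show "AE x in lborel. norm ((cmod (?q i x))\<^sup>2) \<le> (2 * gauss_const a)\<^sup>2 * exp (- (1/2) * x\<^sup>2)" for i
    proof (intro AE_I2)
      fix x :: real
      have "(cmod (?q i x))\<^sup>2 \<le> (2 * ?M x)\<^sup>2" by (intro power_mono bound) auto
      also have "\<dots> = (2 * gauss_const a)\<^sup>2 * exp (- (1/2) * x\<^sup>2)"
        by (simp add: power_mult_distrib flip: exp_of_nat_mult)
      finally show "norm ((cmod (?q i x))\<^sup>2) \<le> (2 * gauss_const a)\<^sup>2 * exp (- (1/2) * x\<^sup>2)" by simp
    qed
  qed measurable
  then show "((\<lambda>h. l2_norm (\<lambda>x. (evol a (t + h) x - evol a t x) / of_real h - \<i> * evolH a t x)) \<circ> X) \<longlonglongrightarrow> 0"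
    unfolding l2_norm_def comp_def by (intro tendsto_eq_intros) (auto intro: tendsto_real_sqrt)
qed

section \<open>Consequences of the propagator axioms\<close>

context
  fixes U assumes U: "oscillator_propagator U"
begin

lemma propagator_L2: "f \<in> L2 \<Longrightarrow> U t f \<in> L2"
  using U unfolding oscillator_propagator_def by blast

lemma propagator_linear:
  "f \<in> L2 \<Longrightarrow> g \<in> L2 \<Longrightarrow> AE x in lborel. U t (\<lambda>y. a * f y + b * g y) x = a * U t f x + b * U t g x"
  using U unfolding oscillator_propagator_def by blast

lemma propagator_zero: "f \<in> L2 \<Longrightarrow> AE x in lborel. U 0 f x = f x"
  using U unfolding oscillator_propagator_def by blast

lemma propagator_add: "f \<in> L2 \<Longrightarrow> AE x in lborel. U (s + t) f x = U s (U t f) x"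
  using U unfolding oscillator_propagator_def by blast

lemma propagator_square: "f \<in> L2 \<Longrightarrow> l2_square (U t f) = l2_square f"
  using U unfolding oscillator_propagator_def by (metis l2_square_inner of_real_eq_iff)

lemma propagator_norm: "f \<in> L2 \<Longrightarrow> l2_norm (U t f) = l2_norm f"
  by (simp add: l2_norm_eq propagator_square)

lemma propagator_diff:
  assumes "f \<in> L2" "g \<in> L2"
  shows "AE x in lborel. U t (\<lambda>y. f y - g y) x = U t f x - U t g x"
  using propagator_linear[OF assms, of t 1 "-1"] by simp

lemma propagator_norm_diff:
  assumes f: "f \<in> L2" and g: "g \<in> L2"
  shows "l2_norm (\<lambda>x. U t f x - U t g x) = l2_norm (\<lambda>x. f x - g x)"
proof -
  have "l2_norm (\<lambda>x. U t f x - U t g x) = l2_norm (U t (\<lambda>x. f x - g x))"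
    by (rule l2_norm_cong_AE)
      (use propagator_diff[OF f g, of t] L2_measurable[OF L2_diff[OF propagator_L2[OF f] propagator_L2[OF g]]]
        L2_measurable[OF propagator_L2[OF L2_diff[OF f g]]] in auto)
  also have "\<dots> = l2_norm (\<lambda>x. f x - g x)" by (intro propagator_norm L2_diff f g)
  finally show ?thesis .
qed

text \<open>The axiom provides some derivative \<open>ut\<close> and some image \<open>Hu\<close> of
  the packet. \<open>oscillator_unique\<close> forces \<open>Hu\<close> to be \<open>evolH\<close>,
  and the equation then determines \<open>ut\<close>.\<close>

lemma propagator_quotient_tendsto:
  "((\<lambda>h. l2_norm (\<lambda>x. (U h (evol a s) x - evol a s x) / of_real h - \<i> * evolH a s x)) \<longlongrightarrow> 0) (at 0)"
proof -
  let ?f = "evol a s"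
  obtain ut Hu where D: "l2_has_derivative_at (\<lambda>t. U t ?f) ut 0" and H: "oscillator (U 0 ?f) Hu"
    and eq: "AE x in lborel. \<i> * ut x + Hu x = 0"
    using U oscillator_evol unfolding oscillator_propagator_def by metis
  note f0 = propagator_zero[OF evol_L2, of a s]
  have "AE x in lborel. Hu x = - (((phase (of_real s) * a - of_real x)\<^sup>2 - 1) * ?f x) + of_real (x\<^sup>2) * ?f x"
    by (rule oscillator_unique[OF H f0 has_vector_derivative_evol_x has_vector_derivative_evol_xx continuous_on_evol_xx])
  then have "AE x in lborel. Hu x = evolH a s x" by (simp add: evolH_eq)
  with eq have ut: "AE x in lborel. ut x = \<i> * evolH a s x"
  proof eventually_elim
    case (elim x)
    then have "\<i> * (\<i> * ut x + evolH a s x) = 0" by simp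
    then have "- ut x + \<i> * evolH a s x = 0" by (simp add: algebra_simps)
    then show ?case by simp
  qed
  have ut2: "ut \<in> L2" using D unfolding l2_has_derivative_at_def by blast
  have "l2_norm (\<lambda>x. (U h ?f x - ?f x) / of_real h - \<i> * evolH a s x) =
      l2_norm (\<lambda>x. (U (0 + h) ?f x - U 0 ?f x) / of_real h - ut x)" for h
  proof (rule l2_norm_cong_AE)
    have [measurable]: "U t ?f \<in> borel_measurable borel" for t
      by (intro L2_measurable propagator_L2 evol_L2)
    have [measurable]: "?f \<in> borel_measurable borel" by (intro L2_measurable evol_L2)
    have [measurable]: "ut \<in> borel_measurable borel" by (intro L2_measurable ut2)
    show "(\<lambda>x. (U h ?f x - ?f x) / of_real h - \<i> * evolH a s x) \<in> borel_measurable borel"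
      "(\<lambda>x. (U (0 + h) ?f x - U 0 ?f x) / of_real h - ut x) \<in> borel_measurable borel"
      by measurable
    show "AE x in lborel. (U h ?f x - ?f x) / of_real h - \<i> * evolH a s x =
        (U (0 + h) ?f x - U 0 ?f x) / of_real h - ut x"
      using f0 ut by eventually_elim simp
  qed
  then show ?thesis using D unfolding l2_has_derivative_at_def by simp
qed

text \<open>Both flows have the same generator on the Gaussians, so the distance between them has
  vanishing derivative; only the group law and the equation at time 0 enter.\<close>

lemma propagator_evol: "AE x in lborel. U t (evol a 0) x = evol a t x"
proof -
  define N where "N t = l2_norm (\<lambda>x. U t (evol a 0) x - evol a t x)" for t
  note L = evol_L2 evolH_L2 propagator_L2 L2_diff L2_scale
  define Q where "Q s h = l2_norm (\<lambda>x. (U h (evol a s) x - evol a s x) / of_real h - \<i> * evolH a s x)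
      + l2_norm (\<lambda>x. (evol a (s + h) x - evol a s x) / of_real h - \<i> * evolH a s x)" for s h
  \<comment> \<open>Since \<open>U h\<close> is isometric, \<open>N s\<close> is also the distance
    from \<open>U h (U s (evol a 0))\<close> to \<open>U h (evol a s)\<close>. Hence
    \<open>N\<close> changes by at most the distance between \<open>U h (evol a s)\<close> and
    \<open>evol a (s + h)\<close>, and both have the same first-order expansion in
    \<open>h\<close>.\<close>
  have step: "\<bar>N (s + h) - N s\<bar> \<le> \<bar>h\<bar> * Q s h" if "h \<noteq> 0" for s h
  proof -
    let ?u = "U h (U s (evol a 0))"
    let ?q1 = "\<lambda>x. (U h (evol a s) x - evol a s x) / of_real h - \<i> * evolH a s x"
    let ?q2 = "\<lambda>x. (evol a (s + h) x - evol a s x) / of_real h - \<i> * evolH a s x"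
    have q: "?q1 \<in> L2" "?q2 \<in> L2"
      using L2_diff[OF L2_scale[OF L2_diff[OF propagator_L2[OF evol_L2] evol_L2]] L2_scale[OF evolH_L2], of "1 / of_real h" h a s a s "\<i>" a s]
        L2_diff[OF L2_scale[OF L2_diff[OF evol_L2 evol_L2]] L2_scale[OF evolH_L2], of "1 / of_real h" a "s + h" a s "\<i>" a s]
      by simp_all
    have 1: "N s = l2_norm (\<lambda>x. ?u x - U h (evol a s) x)"
      unfolding N_def by (rule propagator_norm_diff[symmetric]) (intro L)+
    have 2: "N (s + h) = l2_norm (\<lambda>x. ?u x - evol a (s + h) x)"
      unfolding N_def
    proof (rule l2_norm_cong_AE)
      show "AE x in lborel. U (s + h) (evol a 0) x - evol a (s + h) x = ?u x - evol a (s + h) x"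
        using propagator_add[OF evol_L2, of h s a 0] by (simp add: add.commute)
    qed (intro L2_measurable L)+
    have "l2_norm (\<lambda>x. U h (evol a s) x - evol a (s + h) x) = l2_norm (\<lambda>x. of_real h * (?q1 x - ?q2 x))"
      by (intro arg_cong[where f=l2_norm] ext) (use that in \<open>simp add: right_diff_distrib diff_divide_distrib\<close>)
    also have "\<dots> = \<bar>h\<bar> * l2_norm (\<lambda>x. ?q1 x - ?q2 x)" by (simp add: l2_norm_scale)
    also have "\<dots> \<le> \<bar>h\<bar> * Q s h"
      unfolding Q_def using l2_norm_triangle[OF q(1) L2_scale[OF q(2), of "-1"]] l2_norm_scale[of "-1" ?q2]
      by (intro mult_left_mono) auto
    finally have "l2_norm (\<lambda>x. U h (evol a s) x - evol a (s + h) x) \<le> \<bar>h\<bar> * Q s h" .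
    moreover have "N (s + h) \<le> N s + l2_norm (\<lambda>x. U h (evol a s) x - evol a (s + h) x)"
      unfolding 1 2 by (rule l2_norm_diff_triangle) (intro L)+
    moreover have "N s \<le> N (s + h) + l2_norm (\<lambda>x. U h (evol a s) x - evol a (s + h) x)"
      unfolding 1 2 l2_norm_minus_commute[of "U h (evol a s)" "evol a (s + h)"]
      by (rule l2_norm_diff_triangle) (intro L)+
    ultimately show ?thesis by linarith
  qed
  have "(N has_real_derivative 0) (at s)" for s
    unfolding DERIV_def
  proof (rule Lim_null_comparison)
    show "((\<lambda>h. Q s h) \<longlongrightarrow> 0) (at 0)"
      unfolding Q_def using tendsto_add[OF propagator_quotient_tendsto[of a s] evol_quotient_tendsto[of a s]] by simp
    have "norm ((N (s + h) - N s) / h) \<le> Q s h" if "h \<noteq> 0" for h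
      using step[OF that, of s] that by (simp add: abs_divide pos_divide_le_eq mult.commute)
    then show "\<forall>\<^sub>F h in at 0. norm ((N (s + h) - N s) / h) \<le> Q s h"
      by (auto simp: eventually_at_filter)
  qed
  then have "N t = N 0" using DERIV_isconst_all by blast
  also have "N 0 = l2_norm (\<lambda>x. 0)"
    unfolding N_def
    by (rule l2_norm_cong_AE) (use propagator_zero[OF evol_L2, of a 0] in \<open>auto intro!: L2_measurable L\<close>)
  finally have "l2_square (\<lambda>x. U t (evol a 0) x - evol a t x) = 0"
    unfolding N_def l2_norm_eq by (simp add: l2_square_def)
  from l2_square_0_AE[OF L2_diff[OF propagator_L2[OF evol_L2] evol_L2] this] show ?thesis by simp
qed

end

section \<open>Rotations of three-dimensional space\<close>

definition vec3 :: "real \<times> real \<times> real \<Rightarrow> real^3" where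
  "vec3 = (\<lambda>(x, y, z). x *\<^sub>R axis 1 1 + y *\<^sub>R axis 2 1 + z *\<^sub>R axis 3 1)"

lemma vec3_nth [simp]: "vec3 (x, y, z) $ 1 = x" "vec3 (x, y, z) $ 2 = y" "vec3 (x, y, z) $ 3 = z"
  by (simp_all add: vec3_def axis_def)

lemma borel_measurable_vec3 [measurable]: "vec3 \<in> borel_measurable (lborel \<Otimes>\<^sub>M (lborel \<Otimes>\<^sub>M lborel))"
  unfolding vec3_def by measurable

lemma borel_measurable_vec_nth [measurable]: "(\<lambda>x::real^3. x $ i) \<in> borel_measurable borel"
  by (intro borel_measurable_continuous_onI continuous_intros)

lemma prod_UNIV_3: "prod f (UNIV :: 3 set) = f 1 * f 2 * (f 3 :: 'a::comm_monoid_mult)"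
  unfolding UNIV_3 by (simp add: ac_simps)

text \<open>Lebesgue measure is determined by the volumes of boxes. This opens integrals over
  \<open>real^3\<close> to Fubini's theorem on a triple product.\<close>

lemma lborel_vec3: "(lborel :: (real^3) measure) = distr (lborel \<Otimes>\<^sub>M (lborel \<Otimes>\<^sub>M lborel)) borel vec3"
proof (rule lborel_eqI)
  fix l u :: "real^3" assume le: "\<And>b. b \<in> Basis \<Longrightarrow> l \<bullet> b \<le> u \<bullet> b"
  have le': "l $ i \<le> u $ i" for i
    using le[of "axis i 1"] by (simp add: axis_in_Basis_iff cart_eq_inner_axis)
  have eq: "vec3 -` box l u = {l$1<..<u$1} \<times> {l$2<..<u$2} \<times> {l$3<..<u$3}"
    by (auto simp: mem_box_cart forall_3)
  have "emeasure (distr (lborel \<Otimes>\<^sub>M (lborel \<Otimes>\<^sub>M lborel)) borel vec3) (box l u) =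
      emeasure (lborel \<Otimes>\<^sub>M (lborel \<Otimes>\<^sub>M lborel)) ({l$1<..<u$1} \<times> {l$2<..<u$2} \<times> {l$3<..<u$3})"
    by (subst emeasure_distr) (auto simp: eq space_pair_measure)
  also have "\<dots> = ennreal ((u$1 - l$1) * ((u$2 - l$2) * (u$3 - l$3)))"
    using le' by (simp add: lborel.emeasure_pair_measure_Times sigma_finite_measure.emeasure_pair_measure_Times[OF sigma_finite_pair_measure] lborel.sigma_finite_measure_axioms ennreal_mult)
  also have "(u$1 - l$1) * ((u$2 - l$2) * (u$3 - l$3)) = (\<Prod>i\<in>UNIV. (u - l) $ i)"
    by (simp only: prod_UNIV_3 vector_minus_component mult.assoc)
  also have "\<dots> = (\<Prod>b\<in>Basis. (u - l) \<bullet> b)"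
  proof -
    have B: "(Basis :: (real^3) set) = range (\<lambda>i. axis i 1)" by (auto simp: Basis_vec_def)
    have "inj (\<lambda>i::3. axis i (1::real))" by (rule injI) (simp add: axis_eq_axis)
    then show ?thesis unfolding B by (simp add: prod.reindex cart_eq_inner_axis)
  qed
  finally show "emeasure (distr (lborel \<Otimes>\<^sub>M (lborel \<Otimes>\<^sub>M lborel)) borel vec3) (box l u) = ennreal (\<Prod>b\<in>Basis. (u - l) \<bullet> b)" .
qed simp

lemma borel_measurable_orthogonal_transformation:
  fixes A :: "'a::euclidean_space \<Rightarrow> 'a"
  assumes "orthogonal_transformation A"
  shows "A \<in> borel_measurable borel"
  using assms by (intro borel_measurable_continuous_onI linear_continuous_on)
    (simp add: linear_conv_bounded_linear[symmetric] orthogonal_transformation_linear)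

text \<open>The preimage of a box is its image under the inverse isometry, which has the same
  Lebesgue measure.\<close>

lemma distr_orthogonal_transformation:
  fixes A :: "real^3 \<Rightarrow> real^3"
  assumes A: "orthogonal_transformation A"
  shows "distr lborel borel A = lborel"
proof (rule lborel_eqI[symmetric])
  fix l u :: "real^3" assume le: "\<And>b. b \<in> Basis \<Longrightarrow> l \<bullet> b \<le> u \<bullet> b"
  have [measurable]: "A \<in> borel_measurable borel"
    by (rule borel_measurable_orthogonal_transformation[OF A])
  have bij: "bij A" using A orthogonal_transformation_bij by blast
  have inv: "orthogonal_transformation (inv A)" using A orthogonal_transformation_inv by blast
  have eq: "A -` box l u = inv A ` box l u" using bij by (simp add: bij_vimage_eq_inv_image)
  have m: "inv A ` box l u \<in> lmeasurable" "measure lebesgue (inv A ` box l u) = measure lebesgue (box l u)"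
    using measurable_orthogonal_image[OF inv, of "box l u"] measure_orthogonal_image[OF inv, of "box l u"] by auto
  have s: "A -` box l u \<in> sets borel" using measurable_sets[of A borel borel "box l u"] by simp
  have "emeasure (distr lborel borel A) (box l u) = emeasure lborel (A -` box l u)"
    by (simp add: emeasure_distr)
  also have "\<dots> = emeasure lebesgue (inv A ` box l u)" using s eq by simp
  also have "\<dots> = ennreal (measure lebesgue (box l u))" using m by (simp add: emeasure_eq_measure2)
  also have "\<dots> = emeasure lborel (box l u)"
    using emeasure_lborel_box_finite[of l u] by (simp add: emeasure_eq_ennreal_measure)
  also have "\<dots> = (\<Prod>b\<in>Basis. (u - l) \<bullet> b)" using le by (simp add: emeasure_lborel_box)
  finally show "emeasure (distr lborel borel A) (box l u) = (\<Prod>b\<in>Basis. (u - l) \<bullet> b)" .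
qed simp

lemma (in pair_sigma_finite) has_bochner_integral_times:
  fixes f :: "'a \<Rightarrow> 'c::{real_normed_field, banach, second_countable_topology}"
  assumes f: "has_bochner_integral M1 f a" and g: "has_bochner_integral M2 g b"
  shows "has_bochner_integral (M1 \<Otimes>\<^sub>M M2) (\<lambda>(x, y). f x * g y) (a * b)"
proof -
  have fi: "integrable M1 f" "integral\<^sup>L M1 f = a" and gi: "integrable M2 g" "integral\<^sup>L M2 g = b"
    using f g by (auto simp: has_bochner_integral_iff)
  have [measurable]: "f \<in> borel_measurable M1" "g \<in> borel_measurable M2" using fi gi by auto
  have i: "integrable (M1 \<Otimes>\<^sub>M M2) (\<lambda>(x, y). f x * g y)"
    by (rule Fubini_integrable) (use fi gi in \<open>auto simp: norm_mult\<close>)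
  moreover have "integral\<^sup>L (M1 \<Otimes>\<^sub>M M2) (\<lambda>(x, y). f x * g y) = a * b"
    using integral_fst'[OF i] fi gi by simp
  ultimately show ?thesis by (simp add: has_bochner_integral_iff)
qed

lemma pair_sigma_finite_lborel2: "pair_sigma_finite (lborel :: real measure) (lborel \<Otimes>\<^sub>M lborel :: (real \<times> real) measure)"
  by (intro pair_sigma_finite.intro sigma_finite_pair_measure lborel.sigma_finite_measure_axioms)

lemma has_bochner_integral_vec3_times:
  fixes f g h :: "real \<Rightarrow> 'c::{real_normed_field, banach, second_countable_topology}"
  assumes f: "has_bochner_integral lborel f a" and g: "has_bochner_integral lborel g b"
    and h: "has_bochner_integral lborel h c"
  shows "has_bochner_integral lborel (\<lambda>x::real^3. f (x $ 1) * (g (x $ 2) * h (x $ 3))) (a * (b * c))"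
proof -
  have [measurable]: "f \<in> borel_measurable borel" "g \<in> borel_measurable borel" "h \<in> borel_measurable borel"
    using assms by (auto simp: has_bochner_integral_iff dest: borel_measurable_integrable)
  have "has_bochner_integral (lborel \<Otimes>\<^sub>M (lborel \<Otimes>\<^sub>M lborel)) (\<lambda>(x, p). f x * (case p of (y, z) \<Rightarrow> g y * h z)) (a * (b * c))"
    by (intro pair_sigma_finite.has_bochner_integral_times pair_sigma_finite_lborel2 lborel_pair.pair_sigma_finite_axioms f
       lborel_pair.has_bochner_integral_times g h)
  then have "has_bochner_integral (distr (lborel \<Otimes>\<^sub>M (lborel \<Otimes>\<^sub>M lborel)) borel vec3) (\<lambda>x. f (x $ 1) * (g (x $ 2) * h (x $ 3))) (a * (b * c))"
  proof (intro has_bochner_integral_distr)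
    assume "has_bochner_integral (lborel \<Otimes>\<^sub>M (lborel \<Otimes>\<^sub>M lborel)) (\<lambda>(x, p). f x * (case p of (y, z) \<Rightarrow> g y * h z)) (a * (b * c))"
    moreover have "(\<lambda>p. f (vec3 p $ 1) * (g (vec3 p $ 2) * h (vec3 p $ 3))) = (\<lambda>(x, p). f x * (case p of (y, z) \<Rightarrow> g y * h z))"
      by auto
    ultimately show "has_bochner_integral (lborel \<Otimes>\<^sub>M (lborel \<Otimes>\<^sub>M lborel)) (\<lambda>p. f (vec3 p $ 1) * (g (vec3 p $ 2) * h (vec3 p $ 3))) (a * (b * c))"
      by simp
  qed measurable
  then show ?thesis unfolding lborel_vec3[symmetric] .
qed

text \<open>\<open>E_A\<close> is the inner product on three-dimensional space of
  \<open>tri f1 f2 f3\<close> composed with \<open>A\<close> and \<open>tri f4 f5 f6\<close>; its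
  boundedness comes from this splitting into two square-integrable halves.\<close>

definition tri :: "(real \<Rightarrow> complex) \<Rightarrow> (real \<Rightarrow> complex) \<Rightarrow> (real \<Rightarrow> complex) \<Rightarrow> real^3 \<Rightarrow> complex" where
  "tri f g h x = f (x $ 1) * (g (x $ 2) * h (x $ 3))"

lemma isometry_integrand_tri:
  "isometry_integrand A f1 f2 f3 f4 f5 f6 x = tri f1 f2 f3 (A x) * cnj (tri f4 f5 f6 x)"
  by (simp add: isometry_integrand_def tri_def)

lemma borel_measurable_tri:
  assumes "f \<in> L2" "g \<in> L2" "h \<in> L2" shows "tri f g h \<in> borel_measurable borel"
proof -
  have [measurable]: "f \<in> borel_measurable borel" "g \<in> borel_measurable borel" "h \<in> borel_measurable borel"
    using assms by (auto intro: L2_measurable)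
  show ?thesis unfolding tri_def[abs_def] by measurable
qed

lemma has_bochner_integral_tri:
  assumes "f \<in> L2" "g \<in> L2" "h \<in> L2"
  shows "has_bochner_integral lborel (\<lambda>x. (cmod (tri f g h x))\<^sup>2) (l2_square f * (l2_square g * l2_square h))"
proof -
  have "has_bochner_integral lborel (\<lambda>x. (cmod (f x))\<^sup>2) (l2_square f)" if "f \<in> L2" for f
    using L2_integrable[OF that] by (simp add: has_bochner_integral_iff l2_square_def)
  from has_bochner_integral_vec3_times[OF this this this, OF assms]
  show ?thesis by (simp add: tri_def norm_mult power_mult_distrib)
qed

lemma has_bochner_integral_tri_orthogonal:
  fixes A :: "real^3 \<Rightarrow> real^3"
  assumes "f \<in> L2" "g \<in> L2" "h \<in> L2" and A: "orthogonal_transformation A"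
  shows "has_bochner_integral lborel (\<lambda>x. (cmod (tri f g h (A x)))\<^sup>2) (l2_square f * (l2_square g * l2_square h))"
proof -
  have [measurable]: "A \<in> borel_measurable borel"
    by (rule borel_measurable_orthogonal_transformation[OF A])
  have [measurable]: "tri f g h \<in> borel_measurable borel" by (rule borel_measurable_tri) fact+
  have 1: "has_bochner_integral (distr lborel borel A) (\<lambda>x. (cmod (tri f g h x))\<^sup>2) (l2_square f * (l2_square g * l2_square h))"
    unfolding distr_orthogonal_transformation[OF A] by (rule has_bochner_integral_tri) fact+
  then have "integrable lborel (\<lambda>x. (cmod (tri f g h (A x)))\<^sup>2)"
    by (simp add: has_bochner_integral_iff integrable_distr_eq)
  with 1 show ?thesis by (simp add: has_bochner_integral_iff integral_distr)
qed

text \<open>The elementary bound of a product by the sum of the two squares replaces Cauchy-Schwarz.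
  The resulting estimate is not homogeneous, but it is finite on bounded sets, and scaling one slot
  recovers smallness in the density argument.\<close>

lemma isometry_integrand_bound:
  fixes A :: "real^3 \<Rightarrow> real^3"
  assumes A: "orthogonal_transformation A"
    and L: "f1 \<in> L2" "f2 \<in> L2" "f3 \<in> L2" "f4 \<in> L2" "f5 \<in> L2" "f6 \<in> L2"
  shows "integrable lborel (isometry_integrand A f1 f2 f3 f4 f5 f6)" (is ?A)
    and "(LINT x|lborel. cmod (isometry_integrand A f1 f2 f3 f4 f5 f6 x)) \<le>
      l2_square f1 * (l2_square f2 * l2_square f3) + l2_square f4 * (l2_square f5 * l2_square f6)" (is ?B)
proof -
  let ?F = "\<lambda>x. (cmod (tri f1 f2 f3 (A x)))\<^sup>2 + (cmod (tri f4 f5 f6 x))\<^sup>2"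
  have [measurable]: "A \<in> borel_measurable borel"
    by (rule borel_measurable_orthogonal_transformation[OF A])
  have [measurable]: "tri f1 f2 f3 \<in> borel_measurable borel" "tri f4 f5 f6 \<in> borel_measurable borel"
    by (rule borel_measurable_tri; fact)+
  have F: "has_bochner_integral lborel ?F
     (l2_square f1 * (l2_square f2 * l2_square f3) + l2_square f4 * (l2_square f5 * l2_square f6))"
    by (intro has_bochner_integral_add has_bochner_integral_tri has_bochner_integral_tri_orthogonal A L)
  have le: "cmod (isometry_integrand A f1 f2 f3 f4 f5 f6 x) \<le> ?F x" for x
  proof -
    have "a * b \<le> a\<^sup>2 + b\<^sup>2" if "0 \<le> a" "0 \<le> b" for a b :: real
      using sum_squares_bound[of a b] that mult_nonneg_nonneg[OF that] by linarith
    then show ?thesis unfolding isometry_integrand_tri by (simp add: norm_mult)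
  qed
  show i: ?A
    by (rule Bochner_Integration.integrable_bound[of _ ?F])
      (use F le in \<open>auto simp: has_bochner_integral_iff isometry_integrand_tri[abs_def] intro: order_trans[OF _ abs_ge_self]\<close>)
  have "(LINT x|lborel. cmod (isometry_integrand A f1 f2 f3 f4 f5 f6 x)) \<le> integral\<^sup>L lborel ?F"
    by (rule integral_mono) (use i F le in \<open>auto simp: has_bochner_integral_iff\<close>)
  then show ?B using F by (simp add: has_bochner_integral_iff)
qed

section \<open>The rotation about the diagonal\<close>

definition rot_p :: "real \<Rightarrow> real" where "rot_p \<theta> = (1 + 2 * cos \<theta>) / 3"
definition rot_q :: "real \<Rightarrow> real" where "rot_q \<theta> = (1 - cos \<theta>) / 3 - sin \<theta> / sqrt 3"
definition rot_r :: "real \<Rightarrow> real" where "rot_r \<theta> = (1 - cos \<theta>) / 3 + sin \<theta> / sqrt 3"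

text \<open>The rotation commutes with cyclic shifts of the coordinates, so its matrix is circulant,
  with first row \<open>rot_p\<close>, \<open>rot_q\<close>, \<open>rot_r\<close>.\<close>

lemma diagonal_rotation_nth:
  "diagonal_rotation \<theta> x $ 1 = rot_p \<theta> * x $ 1 + rot_q \<theta> * x $ 2 + rot_r \<theta> * x $ 3" (is ?A)
  "diagonal_rotation \<theta> x $ 2 = rot_r \<theta> * x $ 1 + rot_p \<theta> * x $ 2 + rot_q \<theta> * x $ 3" (is ?B)
  "diagonal_rotation \<theta> x $ 3 = rot_q \<theta> * x $ 1 + rot_r \<theta> * x $ 2 + rot_p \<theta> * x $ 3" (is ?C)
proof -
  \<comment> \<open>The square root becomes an unknown governed by one polynomial relation, which
    leaves polynomial identities to check.\<close>
  define w where "w = 1 / sqrt 3"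
  have w: "3 * w * w = 1" by (simp add: w_def)
  have n: "norm (vector [1, 1, 1] :: real^3) = sqrt 3"
    by (simp add: norm_vec_def L2_set_def sum_3)
  have s: "sgn (vector [1, 1, 1] :: real^3) = w *\<^sub>R vector [1, 1, 1]"
    by (simp add: sgn_div_norm n inverse_eq_divide w_def)
  have d: "vector [1, 1, 1] \<bullet> x = x $ 1 + x $ 2 + x $ 3"
    by (simp add: inner_vec_def sum_3)
  have p: "3 * rot_p \<theta> = 1 + 2 * cos \<theta>" "3 * rot_q \<theta> = 1 - cos \<theta> - 3 * sin \<theta> * w"
    "3 * rot_r \<theta> = 1 - cos \<theta> + 3 * sin \<theta> * w"
    by (simp_all add: rot_p_def rot_q_def rot_r_def w_def)
  have R: "diagonal_rotation \<theta> x $ i = cos \<theta> * x $ i + sin \<theta> * (w * cross3 (vector [1, 1, 1]) x $ i)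
      + (1 - cos \<theta>) * (w * (x $ 1 + x $ 2 + x $ 3)) * (w * vector [1, 1, 1] $ i)" for i
    unfolding diagonal_rotation_def rotation_about_def s by (simp add: d cross_mult_left)
  show ?A ?B ?C
    using w p unfolding R by (simp_all add: cross3_def, algebra+)
qed

lemma rot_sum: "rot_p \<theta> + rot_q \<theta> + rot_r \<theta> = 1"
  by (simp add: rot_p_def rot_q_def rot_r_def add_divide_distrib[symmetric])

text \<open>For a circulant matrix these two relations say that the rows have length one and are
  pairwise orthogonal. The first follows from the second by squaring \<open>rot_sum\<close>.\<close>

lemma rot_squares: "(rot_p \<theta>)\<^sup>2 + (rot_q \<theta>)\<^sup>2 + (rot_r \<theta>)\<^sup>2 = 1"
  and rot_products: "rot_p \<theta> * rot_q \<theta> + rot_q \<theta> * rot_r \<theta> + rot_r \<theta> * rot_p \<theta> = 0"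
proof -
  define s where "s = sin \<theta> / sqrt 3"
  have "s\<^sup>2 = (1 - (cos \<theta>)\<^sup>2) / 3" by (simp add: s_def power_divide sin_squared_eq)
  then have *: "3 * s\<^sup>2 = 1 - (cos \<theta>)\<^sup>2" by simp
  show "rot_p \<theta> * rot_q \<theta> + rot_q \<theta> * rot_r \<theta> + rot_r \<theta> * rot_p \<theta> = 0"
    unfolding rot_p_def rot_q_def rot_r_def s_def[symmetric] using * by (simp add: field_simps power2_eq_square)
  then show "(rot_p \<theta>)\<^sup>2 + (rot_q \<theta>)\<^sup>2 + (rot_r \<theta>)\<^sup>2 = 1"
    using rot_sum[of \<theta>] by algebra
qed

lemma orthogonal_transformation_diagonal_rotation: "orthogonal_transformation (diagonal_rotation \<theta>)"
  unfolding orthogonal_transformation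
proof (intro conjI allI)
  show "linear (diagonal_rotation \<theta>)"
    by (rule linearI) (simp_all add: vec_eq_iff forall_3 diagonal_rotation_nth algebra_simps)
  fix v :: "real^3"
  have "(rot_p \<theta> * v $ 1 + rot_q \<theta> * v $ 2 + rot_r \<theta> * v $ 3)\<^sup>2
     + (rot_r \<theta> * v $ 1 + rot_p \<theta> * v $ 2 + rot_q \<theta> * v $ 3)\<^sup>2
     + (rot_q \<theta> * v $ 1 + rot_r \<theta> * v $ 2 + rot_p \<theta> * v $ 3)\<^sup>2 = (v $ 1)\<^sup>2 + (v $ 2)\<^sup>2 + (v $ 3)\<^sup>2"
    using rot_squares[of \<theta>] rot_products[of \<theta>] by algebra
  then show "norm (diagonal_rotation \<theta> v) = norm v"
    by (simp add: norm_vec_def L2_set_def sum_3 diagonal_rotation_nth)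
qed

lemma borel_measurable_diagonal_rotation [measurable]:
  "(\<lambda>(\<theta>, x). diagonal_rotation \<theta> x) \<in> borel_measurable (borel \<Otimes>\<^sub>M borel)"
proof -
  have eq: "diagonal_rotation \<theta> x =
      (rot_p \<theta> * x $ 1 + rot_q \<theta> * x $ 2 + rot_r \<theta> * x $ 3) *\<^sub>R axis 1 1 +
      (rot_r \<theta> * x $ 1 + rot_p \<theta> * x $ 2 + rot_q \<theta> * x $ 3) *\<^sub>R axis 2 1 +
      (rot_q \<theta> * x $ 1 + rot_r \<theta> * x $ 2 + rot_p \<theta> * x $ 3) *\<^sub>R axis 3 1" for \<theta> x
    by (simp add: vec_eq_iff forall_3 diagonal_rotation_nth axis_def)
  show ?thesis unfolding eq rot_p_def rot_q_def rot_r_def by measurable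
qed

section \<open>The identity for Gaussians\<close>

abbreviation slab :: "real \<Rightarrow> real \<Rightarrow> real measure" where
  "slab a b \<equiv> restrict_space lborel {a..b}"

lemma finite_measure_slab: "finite_measure (slab a b)"
  by (rule finite_measureI) (simp add: space_restrict_space emeasure_restrict_space emeasure_lborel_Icc_eq)

lemma measure_slab: "a \<le> b \<Longrightarrow> measure (slab a b) (space (slab a b)) = b - a"
  by (simp add: space_restrict_space measure_restrict_space)

lemma set_integrable_slab: "set_integrable lborel {a..b} f \<longleftrightarrow> integrable (slab a b) f"
  for f :: "real \<Rightarrow> 'a::{banach, second_countable_topology}"
  unfolding set_integrable_def by (subst integrable_restrict_space) auto

lemma set_integral_slab: "set_lebesgue_integral lborel {a..b} f = integral\<^sup>L (slab a b) f"
  for f :: "real \<Rightarrow> 'a::{banach, second_countable_topology}"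
  unfolding set_lebesgue_integral_def by (subst integral_restrict_space) auto

lemma integrable_slab_continuous:
  "continuous_on {a..b} f \<Longrightarrow> integrable (slab a b) f"
  for f :: "real \<Rightarrow> 'a::{banach, second_countable_topology}"
  unfolding set_integrable_slab[symmetric] by (rule borel_integrable_atLeastAtMost')

text \<open>Orthogonality of characters. The starting point \<open>c\<close> is free because the
  time interval begins at -pi/4 and the interval of angles at 0.\<close>

lemma integral_slab_cis:
  fixes m :: int
  assumes k: "0 < k"
  shows "(LINT s|slab c (c + 2 * pi / k). cis (of_int m * k * s)) = (if m = 0 then of_real (2 * pi / k) else 0)"
proof (cases "m = 0")
  case True
  interpret finite_measure "slab c (c + 2 * pi / k)" by (rule finite_measure_slab)
  show ?thesis using True k measure_slab[of c "c + 2 * pi / k"] by (simp add: scaleR_conv_of_real)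
next
  case False
  let ?d = "c + 2 * pi / k"
  define \<kappa> where "\<kappa> = of_int m * k"
  have nz: "\<kappa> \<noteq> 0" using False k by (simp add: \<kappa>_def)
  let ?F = "\<lambda>s. cis (\<kappa> * s) / (\<i> * of_real \<kappa>)"
  have "(LINT s|slab c ?d. cis (\<kappa> * s)) = ?F ?d - ?F c"
    unfolding set_integral_slab[symmetric] set_lebesgue_integral_def
  proof (rule integral_FTC_Icc)
    show "c \<le> ?d" using k by simp
    show "continuous_on {c..?d} (\<lambda>s. cis (\<kappa> * s))" by (intro continuous_intros)
    fix x
    have "((\<lambda>z. exp (\<i> * of_real \<kappa> * z) / (\<i> * of_real \<kappa>)) has_field_derivative
        exp (\<i> * of_real \<kappa> * of_real x)) (at (of_real x))"
      using nz by (auto intro!: derivative_eq_intros)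
    then have "((\<lambda>s. exp (\<i> * of_real \<kappa> * of_real s) / (\<i> * of_real \<kappa>)) has_vector_derivative
        exp (\<i> * of_real \<kappa> * of_real x)) (at x)"
      by (rule has_vector_derivative_real_field)
    then have "(?F has_vector_derivative cis (\<kappa> * x)) (at x)"
      by (simp only: cis_conv_exp of_real_mult mult.assoc)
    then show "(?F has_vector_derivative cis (\<kappa> * x)) (at x within {c..?d})"
      by (rule has_vector_derivative_at_within)
  qed
  also have "\<kappa> * ?d = \<kappa> * c + 2 * pi * of_int m"
    using k by (simp add: \<kappa>_def field_simps)
  also have "cis (\<kappa> * c + 2 * pi * of_int m) = cis (\<kappa> * c) * cis (2 * pi * of_int m)"
    by (simp only: cis_mult)
  also have "cis (2 * pi * of_int m) = 1" by (rule cis_multiple_2pi) simp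
  finally show ?thesis using False by (simp add: \<kappa>_def)
qed

text \<open>Termwise integration is justified by the absolutely convergent exponential series of the
  modulus of \<open>p\<close>, because \<open>u\<close> has modulus one. The weight \<open>g\<close>
  lets the two exponentials of an average be expanded one after the other.\<close>

lemma sums_integral_exp_series:
  fixes g u :: "real \<Rightarrow> complex"
  assumes g: "continuous_on {c..d} g" and u: "continuous_on {c..d} u"
    and u1: "\<And>s. cmod (u s) = 1"
  shows "(\<lambda>n. p ^ n / fact n * (LINT s|slab c d. u s ^ n * g s)) sums (LINT s|slab c d. exp (p * u s) * g s)"
proof -
  let ?f = "\<lambda>n s. (p * u s) ^ n /\<^sub>R fact n * g s"
  have e: "(\<lambda>n. ?f n s) sums (exp (p * u s) * g s)" for s
    by (intro sums_mult2 exp_converges)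
  have n: "cmod (?f n s) = cmod p ^ n / fact n * cmod (g s)" for n s
    using u1 by (simp add: norm_mult norm_power power_mult_distrib divide_inverse)
  have sm: "summable (\<lambda>n. cmod p ^ n / fact n * K)" for K
    using summable_mult2[OF summable_exp[of "cmod p"], of K] by (simp add: divide_inverse mult.commute)
  have i: "integrable (slab c d) (?f n)" for n
    by (intro integrable_slab_continuous continuous_intros u g)
  have "(\<lambda>n. integral\<^sup>L (slab c d) (?f n)) sums (LINT s|slab c d. (\<Sum>n. ?f n s))"
  proof (rule sums_integral)
    show "AE s in slab c d. summable (\<lambda>n. cmod (?f n s))"
      unfolding n by (intro AE_I2 sm)
    have "(\<lambda>n. LINT s|slab c d. cmod (?f n s)) = (\<lambda>n. cmod p ^ n / fact n * (LINT s|slab c d. cmod (g s)))"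
      unfolding n by simp
    then show "summable (\<lambda>n. LINT s|slab c d. cmod (?f n s))"
      by (simp only: sm)
  qed (rule i)
  moreover have "(\<Sum>n. ?f n s) = exp (p * u s) * g s" for s using e by (rule sums_unique[symmetric])
  moreover have "integral\<^sup>L (slab c d) (?f n) = p ^ n / fact n * (LINT s|slab c d. u s ^ n * g s)" for n
  proof -
    have "?f n s = p ^ n / fact n * (u s ^ n * g s)" for s
      by (simp add: power_mult_distrib scaleR_conv_of_real divide_inverse)
    then show ?thesis by simp
  qed
  ultimately show ?thesis by simp
qed

text \<open>The value is a Bessel series in the product \<open>p q\<close>; this is what matches the time average
  with the average over rotations.\<close>

lemma sums_integral_exp_cis:
  assumes k: "0 < k"
  shows "(\<lambda>n. of_real (2 * pi / k) * (p * q) ^ n / (fact n)\<^sup>2) sums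
    (LINT s|slab c (c + 2 * pi / k). exp (p * cis (k * s) + q * cis (- (k * s))))"
proof -
  let ?M = "slab c (c + 2 * pi / k)"
  have inner: "(LINT s|?M. cis (k * s) ^ n * exp (q * cis (- (k * s)))) = of_real (2 * pi / k) * q ^ n / fact n" for n
  proof -
    have "(\<lambda>m. q ^ m / fact m * (LINT s|?M. cis (- (k * s)) ^ m * cis (k * s) ^ n)) sums
        (LINT s|?M. exp (q * cis (- (k * s))) * cis (k * s) ^ n)"
      by (rule sums_integral_exp_series) (auto intro!: continuous_intros)
    \<comment> \<open>Only equal powers of the two opposite characters survive the average, so the
      inner series collapses to a single term.\<close>
    moreover have "(LINT s|?M. cis (- (k * s)) ^ m * cis (k * s) ^ n) = (if m = n then of_real (2 * pi / k) else 0)" for m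
    proof -
      have "cis (- (k * s)) ^ m * cis (k * s) ^ n = cis (of_int (int n - int m) * k * s)" for s
        by (simp add: Complex.DeMoivre cis_mult algebra_simps)
      then show ?thesis using integral_slab_cis[OF k, of c "int n - int m"] by simp
    qed
    ultimately have "(\<lambda>m. q ^ m / fact m * (if m = n then of_real (2 * pi / k) else 0)) sums
        (LINT s|?M. exp (q * cis (- (k * s))) * cis (k * s) ^ n)" by simp
    moreover have "(\<lambda>m. q ^ m / fact m * (if m = n then of_real (2 * pi / k) else 0)) sums
        (q ^ n / fact n * of_real (2 * pi / k))"
      using sums_single[of n "\<lambda>m. q ^ m / fact m * complex_of_real (2 * pi / k)"] by (simp add: if_distrib cong: if_cong)
    ultimately show ?thesis by (simp add: sums_unique2 mult.commute)
  qed
  have "(\<lambda>n. p ^ n / fact n * (LINT s|?M. cis (k * s) ^ n * exp (q * cis (- (k * s))))) sums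
      (LINT s|?M. exp (p * cis (k * s)) * exp (q * cis (- (k * s))))"
    by (rule sums_integral_exp_series) (auto intro!: continuous_intros)
  moreover have "p ^ n / fact n * (of_real (2 * pi / k) * q ^ n / fact n) =
      of_real (2 * pi / k) * (p * q) ^ n / (fact n)\<^sup>2" for n
    by (simp add: power_mult_distrib power2_eq_square mult_ac)
  ultimately show ?thesis unfolding inner exp_add by (simp only:)
qed

text \<open>Multiplication by the frequency cancels the length of the period, so that both sides sum
  the same series with terms \<open>2 * pi * (p * q) ^ n / (fact n)\<^sup>2\<close>.\<close>

lemma integral_exp_cis_eq:
  assumes "0 < k" "0 < l" "p * q = p' * q'"
  shows "of_real k * (LINT s|slab c (c + 2 * pi / k). exp (p * cis (k * s) + q * cis (- (k * s)))) =
    of_real l * (LINT s|slab d (d + 2 * pi / l). exp (p' * cis (l * s) + q' * cis (- (l * s))))"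
proof -
  have *: "(\<lambda>n. of_real (2 * pi) * (p * q) ^ n / (fact n)\<^sup>2) sums
    (of_real k * (LINT s|slab c (c + 2 * pi / k). exp (p * cis (k * s) + q * cis (- (k * s)))))"
    if "0 < k" for k p q c
  proof -
    have "of_real k * (of_real (2 * pi / k) * (p * q) ^ n / (fact n)\<^sup>2) = of_real (2 * pi) * (p * q) ^ n / (fact n)\<^sup>2" for n
      using that by simp
    with sums_mult[OF sums_integral_exp_cis[OF that, of p q c], of "of_real k"] show ?thesis
      by (simp only:)
  qed
  show ?thesis
    by (rule sums_unique2[OF *[OF assms(1), of p q c] *[OF assms(2), of p' q' d, folded assms(3)]])
qed

section \<open>Products indexed by six slots\<close>

definition six :: "(nat \<Rightarrow> complex) \<Rightarrow> complex" where
  "six z = z 0 * z 1 * z 2 * cnj (z 3 * z 4 * z 5)"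

lemma less_6_cases: "k < (6::nat) \<longleftrightarrow> k = 0 \<or> k = 1 \<or> k = 2 \<or> k = 3 \<or> k = 4 \<or> k = 5"
  by auto

text \<open>Numbering the slots allows one argument for all of them. The scalars are real because
  the first three slots are linear and the last three conjugate linear; real scalars are treated
  alike by both.\<close>

lemma six_slot:
  "k < 6 \<Longrightarrow> six (z(k := of_real r * a + of_real s * b)) =
    of_real r * six (z(k := a)) + of_real s * six (z(k := b))"
  unfolding less_6_cases six_def by (elim disjE) (simp_all add: algebra_simps)

lemma six_mult: "six (\<lambda>k. c k * z k) = six c * six z"
  by (simp add: six_def mult_ac)

lemma norm_six: "cmod (six z) = (\<Prod>k<6. cmod (z k))"
  by (simp add: six_def norm_mult eval_nat_numeral lessThan_Suc mult_ac)

lemma six_const: "six (\<lambda>k. z) = of_real ((cmod z) ^ 6)"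
proof -
  have "six (\<lambda>k. z) = (z * cnj z) ^ 3" by (simp add: six_def power3_eq_cube mult_ac)
  also have "\<dots> = of_real ((cmod z) ^ 6)" by (simp add: complex_norm_square[symmetric] flip: power_mult)
  finally show ?thesis .
qed

definition rot_args :: "real \<Rightarrow> real^3 \<Rightarrow> nat \<Rightarrow> real" where
  "rot_args \<theta> x k = [diagonal_rotation \<theta> x $ 1, diagonal_rotation \<theta> x $ 2, diagonal_rotation \<theta> x $ 3, x $ 1, x $ 2, x $ 3] ! k"

lemma rot_args_simps [simp]:
  "rot_args \<theta> x 0 = diagonal_rotation \<theta> x $ 1" "rot_args \<theta> x 1 = diagonal_rotation \<theta> x $ 2"
  "rot_args \<theta> x 2 = diagonal_rotation \<theta> x $ 3" "rot_args \<theta> x 3 = x $ 1"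
  "rot_args \<theta> x 4 = x $ 2" "rot_args \<theta> x 5 = x $ 3" "rot_args \<theta> x (Suc 0) = diagonal_rotation \<theta> x $ 2"
  by (simp_all add: rot_args_def)

definition rot_integrand :: "(nat \<Rightarrow> real \<Rightarrow> complex) \<Rightarrow> real \<Rightarrow> real^3 \<Rightarrow> complex" where
  "rot_integrand F \<theta> x = six (\<lambda>k. F k (rot_args \<theta> x k))"

lemma rot_integrand_eq:
  "rot_integrand F \<theta> = isometry_integrand (diagonal_rotation \<theta>) (F 0) (F 1) (F 2) (F 3) (F 4) (F 5)"
  by (rule ext) (simp add: rot_integrand_def six_def isometry_integrand_def)

text \<open>\<open>SA\<close> and \<open>QA\<close> are the sum and the bilinear square of the first
  three parameters, \<open>SB\<close> and \<open>QB\<close> those of the conjugated last three.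
  \<open>P\<close> and \<open>Q\<close> are -1/4 times the bilinear squares of their components
  orthogonal to the diagonal. \<open>G\<close> is the part of the exponent common to all times and
  all angles.\<close>

context
  fixes a :: "nat \<Rightarrow> complex" and SA SB QA QB G P Q
  defines "SA \<equiv> a 0 + a 1 + a 2" and "SB \<equiv> cnj (a 3 + a 4 + a 5)"
    and "QA \<equiv> (a 0)\<^sup>2 + (a 1)\<^sup>2 + (a 2)\<^sup>2" and "QB \<equiv> cnj ((a 3)\<^sup>2 + (a 4)\<^sup>2 + (a 5)\<^sup>2)"
    and "G \<equiv> (QA + QB) / 4 + SA * SB / 6"
    and "P \<equiv> SA\<^sup>2 / 12 - QA / 4" and "Q \<equiv> SB\<^sup>2 / 12 - QB / 4"
begin

text \<open>The factors exp(it) cancel between the first and the last three packets. What remains is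
  a Gaussian with quadratic term -3x^2; in its completed square the cross term between
  \<open>SA\<close> and \<open>SB\<close> carries \<open>w * cnj w = 1\<close> and is therefore free
  of \<open>t\<close>.\<close>

lemma integral_six_evol:
  "(LINT x|lborel. six (\<lambda>k. evol (a k) t x)) =
     of_real (sqrt (pi / 3)) * (exp G * exp (P * cis (4 * t) + Q * cis (- (4 * t))))"
proof -
  define w where "w = phase (of_real t)"
  have w: "w * cnj w = 1" unfolding w_def complex_norm_square[symmetric] by simp
  have w2: "cis (4 * t) = w\<^sup>2"
    by (simp add: w_def phase_def cis_conv_exp exp_of_nat_mult[symmetric] mult_ac)
  have "cis (- (4 * t)) = cnj (cis (4 * t))" by (simp add: cis_cnj)
  then have w2': "cis (- (4 * t)) = (cnj w)\<^sup>2" by (simp add: w2)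
  have eq: "six (\<lambda>k. evol (a k) t x) =
      exp ((QA + QB) / 4 - w\<^sup>2 * QA / 4 - (cnj w)\<^sup>2 * QB / 4) *
      exp (of_real (- 3 * x\<^sup>2) + (w * SA + cnj w * SB) * of_real x)" for x
    unfolding six_def evol_def w_def[symmetric] exp_add[symmetric] exp_cnj
      SA_def SB_def QA_def QB_def
    by (rule arg_cong[where f=exp]) (simp add: field_simps power_mult_distrib)
  have "(LINT x|lborel. six (\<lambda>k. evol (a k) t x)) =
      exp ((QA + QB) / 4 - w\<^sup>2 * QA / 4 - (cnj w)\<^sup>2 * QB / 4) *
      (of_real (sqrt (pi / 3)) * exp ((w * SA + cnj w * SB)\<^sup>2 / of_real (4 * 3)))"
    unfolding eq
    using has_bochner_integral_gaussian[of 3 "w * SA + cnj w * SB"]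
    by (simp add: has_bochner_integral_iff)
  also have "\<dots> = of_real (sqrt (pi / 3)) * exp ((QA + QB) / 4 - w\<^sup>2 * QA / 4 - (cnj w)\<^sup>2 * QB / 4 + (w * SA + cnj w * SB)\<^sup>2 / of_real (4 * 3))"
    by (simp add: exp_add)
  also have "(QA + QB) / 4 - w\<^sup>2 * QA / 4 - (cnj w)\<^sup>2 * QB / 4 + (w * SA + cnj w * SB)\<^sup>2 / of_real (4 * 3) =
      G + (P * cis (4 * t) + Q * cis (- (4 * t)))"
  proof -
    have "(w * SA + cnj w * SB)\<^sup>2 = w\<^sup>2 * SA\<^sup>2 + (cnj w)\<^sup>2 * SB\<^sup>2 + 2 * SA * SB"
      using w by algebra
    then show ?thesis
      unfolding w2 w2' G_def P_def Q_def by (simp add: field_simps)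
  qed
  finally show ?thesis by (simp add: exp_add)
qed

text \<open>Write A for the vector of the first three parameters and B for that of the conjugated
  last three. \<open>\<alpha>\<close> is the bilinear dot product of their components orthogonal to
  the axis, and \<open>\<beta>\<close> is the component of B x A along the unit axis. The second
  claim is Lagrange's identity for those orthogonal components.\<close>

lemma integral_rot_evol:
  defines "\<alpha> \<equiv> (2 * (a 0 * cnj (a 3) + a 1 * cnj (a 4) + a 2 * cnj (a 5))
      - (a 2 * cnj (a 3) + a 0 * cnj (a 4) + a 1 * cnj (a 5)) - (a 1 * cnj (a 3) + a 2 * cnj (a 4) + a 0 * cnj (a 5))) / 3"
    and "\<beta> \<equiv> ((a 1 * cnj (a 3) + a 2 * cnj (a 4) + a 0 * cnj (a 5))
      - (a 2 * cnj (a 3) + a 0 * cnj (a 4) + a 1 * cnj (a 5))) / of_real (sqrt 3)"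
  shows "(LINT x|lborel. rot_integrand (\<lambda>k. evol (a k) 0) \<theta> x) =
     of_real (sqrt pi ^ 3) * (exp G * exp ((\<alpha> - \<i> * \<beta>) / 4 * cis \<theta> + (\<alpha> + \<i> * \<beta>) / 4 * cis (- \<theta>)))"
    and "(\<alpha> - \<i> * \<beta>) / 4 * ((\<alpha> + \<i> * \<beta>) / 4) = P * Q"
proof -
  define b0 b1 b2 where "b0 = cnj (a 3)" and "b1 = cnj (a 4)" and "b2 = cnj (a 5)"
  note b = b0_def[symmetric] b1_def[symmetric] b2_def[symmetric]
  define w :: complex where "w = 1 / of_real (sqrt 3)"
  have "(complex_of_real (sqrt 3))\<^sup>2 = 3" by (simp flip: of_real_power)
  then have w: "3 * w * w = 1" by (simp add: w_def power2_eq_square)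
  have SB: "SB = b0 + b1 + b2" and QB: "QB = b0\<^sup>2 + b1\<^sup>2 + b2\<^sup>2"
    by (simp_all add: SB_def QB_def b)
  have \<alpha>: "3 * \<alpha> = 2 * (a 0 * b0 + a 1 * b1 + a 2 * b2)
      - (a 2 * b0 + a 0 * b1 + a 1 * b2) - (a 1 * b0 + a 2 * b1 + a 0 * b2)"
    and \<beta>: "\<beta> = ((a 1 * b0 + a 2 * b1 + a 0 * b2) - (a 2 * b0 + a 0 * b1 + a 1 * b2)) * w"
    by (simp_all add: \<alpha>_def \<beta>_def b w_def)
  \<comment> \<open>Lagrange's identity: \<open>3 * QA - SA\<^sup>2\<close> and
    \<open>3 * QB - SB\<^sup>2\<close> are three times the bilinear squares of the orthogonal
    components.\<close>
  have "9 * (\<alpha>\<^sup>2 + \<beta>\<^sup>2) = (3 * QA - SA\<^sup>2) * (3 * QB - SB\<^sup>2)"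
    using \<alpha> \<beta> w unfolding SA_def QA_def SB QB by algebra
  moreover have "(\<alpha> - \<i> * \<beta>) / 4 * ((\<alpha> + \<i> * \<beta>) / 4) = 9 * (\<alpha>\<^sup>2 + \<beta>\<^sup>2) / 144"
  proof -
    have "(\<alpha> - \<i> * \<beta>) * (\<alpha> + \<i> * \<beta>) = \<alpha>\<^sup>2 + \<beta>\<^sup>2" by (simp add: algebra_simps power2_eq_square)
    then show ?thesis by simp
  qed
  moreover have "P * Q = (3 * QA - SA\<^sup>2) * (3 * QB - SB\<^sup>2) / 144"
    unfolding P_def Q_def by (simp add: field_simps)
  ultimately show "(\<alpha> - \<i> * \<beta>) / 4 * ((\<alpha> + \<i> * \<beta>) / 4) = P * Q" by (simp only:)
  define p q r where "p = complex_of_real (rot_p \<theta>)" and "q = complex_of_real (rot_q \<theta>)" and "r = complex_of_real (rot_r \<theta>)"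
  have sq: "p\<^sup>2 + q\<^sup>2 + r\<^sup>2 = 1" "p * q + q * r + r * p = 0"
    using arg_cong[OF rot_squares[of \<theta>], of complex_of_real] arg_cong[OF rot_products[of \<theta>], of complex_of_real]
    by (simp_all add: p_def q_def r_def)
  define c s where "c = complex_of_real (cos \<theta>)" and "s = complex_of_real (sin \<theta>)"
  have pqr: "3 * p = 1 + 2 * c" "3 * q = 1 - c - 3 * s * w" "3 * r = 1 - c + 3 * s * w"
    by (simp_all add: p_def q_def r_def rot_p_def rot_q_def rot_r_def w_def c_def s_def)
  \<comment> \<open>The linear coefficients in x: the transposed rotation applied to the first three
    parameters, plus the conjugated last three.\<close>
  define m1 m2 m3 where "m1 = p * a 0 + r * a 1 + q * a 2 + b0"
    and "m2 = q * a 0 + p * a 1 + r * a 2 + b1" and "m3 = r * a 0 + q * a 1 + p * a 2 + b2"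
  have mm: "m1\<^sup>2 + m2\<^sup>2 + m3\<^sup>2 = 4 * (G + (c * \<alpha> + s * \<beta>) / 2)"
  proof -
    have "m1\<^sup>2 + m2\<^sup>2 + m3\<^sup>2 = QA + QB + 2 * (p * (a 0 * b0 + a 1 * b1 + a 2 * b2)
        + q * (a 2 * b0 + a 0 * b1 + a 1 * b2) + r * (a 1 * b0 + a 2 * b1 + a 0 * b2))"
      using sq unfolding m1_def m2_def m3_def QA_def QB by algebra
    moreover have "3 * (p * (a 0 * b0 + a 1 * b1 + a 2 * b2)
        + q * (a 2 * b0 + a 0 * b1 + a 1 * b2) + r * (a 1 * b0 + a 2 * b1 + a 0 * b2)) =
        SA * SB + 3 * (c * \<alpha> + s * \<beta>)"
      using pqr \<alpha> \<beta> unfolding SA_def SB by algebra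
    moreover have "M = 4 * (((QA + QB) / 4 + SA * SB / 6) + Y / 2)"
      if "M = QA + QB + 2 * X" "3 * X = SA * SB + 3 * Y" for M X Y
    proof -
      have X: "X = (SA * SB + 3 * Y) / 3" using that(2) by (simp add: eq_divide_eq mult.commute)
      show ?thesis unfolding that(1) X by (simp add: field_simps)
    qed
    ultimately show ?thesis unfolding G_def by blast
  qed
  have eq: "rot_integrand (\<lambda>k. evol (a k) 0) \<theta> x =
      exp (of_real (- 1 * (x $ 1)\<^sup>2) + m1 * of_real (x $ 1)) *
      (exp (of_real (- 1 * (x $ 2)\<^sup>2) + m2 * of_real (x $ 2)) * exp (of_real (- 1 * (x $ 3)\<^sup>2) + m3 * of_real (x $ 3)))" for x
  proof -
    define x1 x2 x3 where "x1 = complex_of_real (x $ 1)" and "x2 = complex_of_real (x $ 2)" and "x3 = complex_of_real (x $ 3)"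
    define y1 y2 y3 where "y1 = p * x1 + q * x2 + r * x3" and "y2 = r * x1 + p * x2 + q * x3"
      and "y3 = q * x1 + r * x2 + p * x3"
    have y: "complex_of_real (diagonal_rotation \<theta> x $ 1) = y1" "complex_of_real (diagonal_rotation \<theta> x $ 2) = y2"
      "complex_of_real (diagonal_rotation \<theta> x $ 3) = y3"
      by (simp_all add: diagonal_rotation_nth y1_def y2_def y3_def p_def q_def r_def x1_def x2_def x3_def)
    \<comment> \<open>The rotation leaves the quadratic part unchanged, so the integrand splits into
      three one-dimensional Gaussians with \<open>s = 1\<close>.\<close>
    have yy: "y1\<^sup>2 + y2\<^sup>2 + y3\<^sup>2 = x1\<^sup>2 + x2\<^sup>2 + x3\<^sup>2"
      using sq unfolding y1_def y2_def y3_def by algebra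
    have cn: "cnj x1 = x1" "cnj x2 = x2" "cnj x3 = x3" by (simp_all add: x1_def x2_def x3_def)
    have "rot_integrand (\<lambda>k. evol (a k) 0) \<theta> x =
        exp (- (y1\<^sup>2 + y2\<^sup>2 + y3\<^sup>2) / 2 - (x1\<^sup>2 + x2\<^sup>2 + x3\<^sup>2) / 2 + a 0 * y1 + a 1 * y2 + a 2 * y3
          + b0 * x1 + b1 * x2 + b2 * x3)"
      unfolding rot_integrand_def six_def evol_def phase_def rot_args_simps y x1_def[symmetric] x2_def[symmetric] x3_def[symmetric]
        exp_add[symmetric] exp_cnj
      by (rule arg_cong[where f=exp]) (simp add: b cn field_simps)
    also have "- (y1\<^sup>2 + y2\<^sup>2 + y3\<^sup>2) / 2 - (x1\<^sup>2 + x2\<^sup>2 + x3\<^sup>2) / 2 + a 0 * y1 + a 1 * y2 + a 2 * y3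
          + b0 * x1 + b1 * x2 + b2 * x3 = (- x1\<^sup>2 + m1 * x1) + ((- x2\<^sup>2 + m2 * x2) + (- x3\<^sup>2 + m3 * x3))"
      unfolding yy unfolding y1_def y2_def y3_def m1_def m2_def m3_def by (simp add: field_simps)
    finally show ?thesis
      by (simp only: exp_add[symmetric] x1_def x2_def x3_def of_real_mult of_real_minus of_real_power of_real_1 mult_minus_left mult_1_left)
  qed
  have "(LINT x|lborel. rot_integrand (\<lambda>k. evol (a k) 0) \<theta> x) =
      of_real (sqrt pi) * exp (m1\<^sup>2 / 4) * (of_real (sqrt pi) * exp (m2\<^sup>2 / 4) * (of_real (sqrt pi) * exp (m3\<^sup>2 / 4)))"
    using has_bochner_integral_vec3_times[OF has_bochner_integral_gaussian[of 1 m1] has_bochner_integral_gaussian[of 1 m2] has_bochner_integral_gaussian[of 1 m3]]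
    unfolding eq by (simp add: has_bochner_integral_iff)
  also have "\<dots> = of_real (sqrt pi ^ 3) * exp ((m1\<^sup>2 + m2\<^sup>2 + m3\<^sup>2) / 4)"
    by (simp only: exp_add add_divide_distrib power3_eq_cube of_real_mult mult_ac)
  also have "(m1\<^sup>2 + m2\<^sup>2 + m3\<^sup>2) / 4 = G + ((\<alpha> - \<i> * \<beta>) / 4 * cis \<theta> + (\<alpha> + \<i> * \<beta>) / 4 * cis (- \<theta>))"
  proof -
    have cs: "cis \<theta> = c + \<i> * s" "cis (- \<theta>) = c - \<i> * s" by (simp_all add: complex_eq_iff c_def s_def)
    show ?thesis unfolding mm cs by (simp add: field_simps)
  qed
  finally show "(LINT x|lborel. rot_integrand (\<lambda>k. evol (a k) 0) \<theta> x) =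
     of_real (sqrt pi ^ 3) * (exp G * exp ((\<alpha> - \<i> * \<beta>) / 4 * cis \<theta> + (\<alpha> + \<i> * \<beta>) / 4 * cis (- \<theta>)))"
    by (simp only: exp_add)
qed

lemma sextic_identity_evol:
  "of_real (2 / pi) * (LINT t|slab (- pi / 4) (pi / 4). LINT x|lborel. six (\<lambda>k. evol (a k) t x)) =
   of_real (1 / (2 * sqrt 3 * pi\<^sup>2)) * (LINT \<theta>|slab 0 (2 * pi). LINT x|lborel. rot_integrand (\<lambda>k. evol (a k) 0) \<theta> x)"
proof -
  obtain p' q' where r: "\<And>\<theta>. (LINT x|lborel. rot_integrand (\<lambda>k. evol (a k) 0) \<theta> x) =
     of_real (sqrt pi ^ 3) * (exp G * exp (p' * cis \<theta> + q' * cis (- \<theta>)))" and pq: "P * Q = p' * q'"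
    using integral_rot_evol by metis
  define J where "J = (LINT \<theta>|slab 0 (2 * pi). exp (p' * cis \<theta> + q' * cis (- \<theta>)))"
  \<comment> \<open>The time interval has length pi/2, exactly one period at frequency 4, and is
    compared with one period at frequency 1.\<close>
  have J: "4 * (LINT t|slab (- pi / 4) (pi / 4). exp (P * cis (4 * t) + Q * cis (- (4 * t)))) = J"
    using integral_exp_cis_eq[of 4 1 P Q p' q' "- pi / 4" 0] pq by (simp add: J_def)
  have "of_real (2 / pi) * (LINT t|slab (- pi / 4) (pi / 4). LINT x|lborel. six (\<lambda>k. evol (a k) t x)) =
      of_real (2 / pi * sqrt (pi / 3) / 4) * exp G * J"
    unfolding integral_six_evol J[symmetric] by simp
  \<comment> \<open>Here the constant is forced: the one-dimensional Gaussian contributes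
    sqrt(pi/3), the three-dimensional one pi^(3/2), and the ratio of the periods 1/4.\<close>
  also have "2 / pi * sqrt (pi / 3) / 4 = 1 / (2 * sqrt 3 * pi\<^sup>2) * sqrt pi ^ 3"
  proof -
    have "sqrt pi ^ 3 = pi * sqrt pi" by (simp add: power3_eq_cube)
    then show ?thesis by (simp add: real_sqrt_divide power2_eq_square field_simps)
  qed
  also have "of_real (1 / (2 * sqrt 3 * pi\<^sup>2) * sqrt pi ^ 3) * exp G * J =
      of_real (1 / (2 * sqrt 3 * pi\<^sup>2)) * (LINT \<theta>|slab 0 (2 * pi). LINT x|lborel. rot_integrand (\<lambda>k. evol (a k) 0) \<theta> x)"
    unfolding r J_def by simp
  finally show ?thesis .
qed

end

section \<open>Sums of Gaussians and the Strichartz estimate\<close>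

lemma six_cong: "(\<And>k. k < 6 \<Longrightarrow> z k = z' k) \<Longrightarrow> six z = six z'"
  by (simp add: six_def)

lemma six_slot_zero: "k < 6 \<Longrightarrow> six (z(k := 0)) = 0"
  using six_slot[of k z 0 0 0 0] by simp

lemma borel_measurable_six:
  "(\<And>k. k < 6 \<Longrightarrow> u k \<in> borel_measurable M) \<Longrightarrow> (\<lambda>\<omega>. six (\<lambda>k. u k \<omega>)) \<in> borel_measurable M"
  unfolding six_def by (intro borel_measurable_times borel_measurable_cnj_comp) auto

lemma has_bochner_integral_six_slot:
  assumes k: "k < 6" and v: "has_bochner_integral M (\<lambda>\<omega>. six ((\<lambda>j. u j \<omega>)(k := v \<omega>))) a"
    and w: "has_bochner_integral M (\<lambda>\<omega>. six ((\<lambda>j. u j \<omega>)(k := w \<omega>))) b"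
  shows "has_bochner_integral M (\<lambda>\<omega>. six ((\<lambda>j. u j \<omega>)(k := of_real r * v \<omega> + of_real s * w \<omega>)))
      (of_real r * a + of_real s * b)"
  unfolding six_slot[OF k] by (intro has_bochner_integral_add has_bochner_integral_mult_right v w)

text \<open>The slots are enlarged from \<open>A\<close> to \<open>B\<close> one at a time, with
  slots below the current one already general. It is used twice: from single packets to finite sums,
  and from finite sums to all of \<open>L2\<close>.\<close>

lemma slot_induct:
  fixes Z :: "(nat \<Rightarrow> 'a) \<Rightarrow> bool"
  assumes PQ: "A \<subseteq> B"
    and base: "\<And>F. (\<And>k. k < n \<Longrightarrow> F k \<in> A) \<Longrightarrow> Z F"
    and step: "\<And>k F q. k < n \<Longrightarrow> (\<And>j. j < n \<Longrightarrow> F j \<in> B) \<Longrightarrow> q \<in> B \<Longrightarrow>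
      (\<And>p. p \<in> A \<Longrightarrow> Z (F(k := p))) \<Longrightarrow> Z (F(k := q))"
    and F: "\<And>k. k < n \<Longrightarrow> F k \<in> B"
  shows "Z F"
proof -
  have "m \<le> n \<Longrightarrow> (\<forall>k<m. F k \<in> B) \<Longrightarrow> (\<forall>k<n. m \<le> k \<longrightarrow> F k \<in> A) \<Longrightarrow> Z F" for m F
  proof (induction m arbitrary: F)
    case 0
    then show ?case by (intro base) auto
  next
    case (Suc m)
    have "Z (F(m := F m))"
    proof (rule step)
      show "m < n" using Suc.prems by simp
      show "F j \<in> B" if "j < n" for j using Suc.prems PQ that by (cases "j < Suc m") auto
      show "F m \<in> B" using Suc.prems by simp
      fix p assume "p \<in> A"
      then show "Z (F(m := p))" using Suc.prems by (intro Suc.IH) auto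
    qed
    then show ?case by simp
  qed
  from this[of n F] F show ?thesis by simp
qed

abbreviation rot_space :: "(real \<times> (real^3)) measure" where
  "rot_space \<equiv> slab 0 (2 * pi) \<Otimes>\<^sub>M lborel"

abbreviation time_space :: "(real \<times> real) measure" where
  "time_space \<equiv> slab (- pi / 4) (pi / 4) \<Otimes>\<^sub>M lborel"

lemma pair_sigma_finite_slab: "sigma_finite_measure N \<Longrightarrow> pair_sigma_finite (slab a b) N"
  by (rule pair_sigma_finite.intro[OF finite_measure.axioms(1)[OF finite_measure_slab]])

lemmas pair_sigma_finite_slab_lborel = pair_sigma_finite_slab[OF lborel.sigma_finite_measure_axioms]

lemma measurable_slab_pair:
  assumes f: "f \<in> borel_measurable (borel \<Otimes>\<^sub>M N)"
  shows "f \<in> borel_measurable (slab a b \<Otimes>\<^sub>M N)"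
proof -
  have "(\<lambda>p. (fst p, snd p)) \<in> slab a b \<Otimes>\<^sub>M N \<rightarrow>\<^sub>M borel \<Otimes>\<^sub>M N"
  proof (rule measurable_Pair)
    have "(\<lambda>x. x) \<in> slab a b \<rightarrow>\<^sub>M borel"
      by (rule measurable_restrict_space1) simp
    from measurable_compose[OF measurable_fst this] show "fst \<in> slab a b \<Otimes>\<^sub>M N \<rightarrow>\<^sub>M borel" .
  qed simp
  from measurable_compose[OF this f] show ?thesis by simp
qed

lemma borel_measurable_rot_args:
  assumes "k < 6"
  shows "(\<lambda>(\<theta>, x). rot_args \<theta> x k) \<in> borel_measurable (borel \<Otimes>\<^sub>M borel)"
proof -
  have [measurable]: "(\<lambda>p. diagonal_rotation (fst p) (snd p) $ i) \<in> borel_measurable (borel \<Otimes>\<^sub>M borel)" for i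
    using measurable_compose[OF borel_measurable_diagonal_rotation borel_measurable_vec_nth]
    by (simp add: case_prod_beta')
  have [measurable]: "(\<lambda>p::real \<times> (real^3). snd p $ i) \<in> borel_measurable (borel \<Otimes>\<^sub>M borel)" for i
    using measurable_compose[OF measurable_snd borel_measurable_vec_nth] by simp
  from assms show ?thesis
    unfolding less_6_cases by (elim disjE) (simp_all add: case_prod_beta' measurable)
qed

definition prod_bound :: "(nat \<Rightarrow> real \<Rightarrow> complex) \<Rightarrow> real" where
  "prod_bound F = l2_square (F 0) * (l2_square (F 1) * l2_square (F 2)) + l2_square (F 3) * (l2_square (F 4) * l2_square (F 5))"

lemma borel_measurable_rot_integrand:
  assumes "\<And>k. k < 6 \<Longrightarrow> F k \<in> borel_measurable borel"
  shows "(\<lambda>(\<theta>, x). rot_integrand F \<theta> x) \<in> borel_measurable (borel \<Otimes>\<^sub>M borel)"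
  unfolding rot_integrand_def case_prod_beta'
  by (rule borel_measurable_six)
    (use measurable_compose[OF borel_measurable_rot_args assms] in \<open>simp add: case_prod_beta'\<close>)

lemma integrable_rot_integrand1:
  assumes "\<And>k. k < 6 \<Longrightarrow> F k \<in> L2"
  shows "integrable lborel (rot_integrand F \<theta>)"
    "(LINT x|lborel. cmod (rot_integrand F \<theta> x)) \<le> prod_bound F"
  unfolding rot_integrand_eq prod_bound_def
  using assms by (intro isometry_integrand_bound orthogonal_transformation_diagonal_rotation; simp)+

text \<open>The integral of the modulus over each slice is bounded independently of the angle, and
  the angles range over a set of finite measure.\<close>

lemma integrable_rot_integrand:
  assumes F: "\<And>k. k < 6 \<Longrightarrow> F k \<in> L2"
  shows "integrable rot_space (\<lambda>(\<theta>, x). rot_integrand F \<theta> x)" (is ?A)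
    and "cmod (integral\<^sup>L rot_space (\<lambda>(\<theta>, x). rot_integrand F \<theta> x)) \<le> 2 * pi * prod_bound F" (is ?B)
proof -
  interpret fm: finite_measure "slab 0 (2 * pi)" by (rule finite_measure_slab)
  interpret pair_sigma_finite "slab 0 (2 * pi)" "lborel :: (real^3) measure" by (rule pair_sigma_finite_slab_lborel)
  let ?f = "\<lambda>(\<theta>, x). rot_integrand F \<theta> x"
  have m: "?f \<in> borel_measurable rot_space"
    using measurable_slab_pair[OF borel_measurable_rot_integrand, of F 0 "2 * pi"] F
    by (simp add: L2_measurable cong: measurable_cong_sets)
  have n: "(\<lambda>\<theta>. LINT x|lborel. cmod (rot_integrand F \<theta> x)) \<in> borel_measurable (slab 0 (2 * pi))"
    using lborel.borel_measurable_lebesgue_integral[of "\<lambda>\<theta> x. cmod (rot_integrand F \<theta> x)"] m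
    by (simp add: case_prod_beta')
  have i: "integrable (slab 0 (2 * pi)) (\<lambda>\<theta>. LINT x|lborel. cmod (rot_integrand F \<theta> x))"
    by (rule fm.integrable_const_bound[where B="prod_bound F"])
      (use n integrable_rot_integrand1(2)[OF F] in \<open>auto\<close>)
  show A: ?A
    by (rule Fubini_integrable[OF m]) (use i integrable_rot_integrand1(1)[OF F] in auto)
  have "cmod (integral\<^sup>L rot_space ?f) \<le> (LINT p|rot_space. cmod (?f p))" by (rule integral_norm_bound)
  also have "\<dots> = (LINT \<theta>|slab 0 (2 * pi). LINT x|lborel. cmod (rot_integrand F \<theta> x))"
    using integral_fst'[OF integrable_norm[OF A]] by simp
  also have "\<dots> \<le> (LINT \<theta>|slab 0 (2 * pi). prod_bound F)"
    by (rule integral_mono) (use i integrable_rot_integrand1(2)[OF F] in auto)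
  also have "\<dots> = 2 * pi * prod_bound F" using measure_slab[of 0 "2 * pi"] by simp
  finally show ?B .
qed

definition rot_form :: "(nat \<Rightarrow> real \<Rightarrow> complex) \<Rightarrow> complex" where
  "rot_form F = of_real (1 / (2 * sqrt 3 * pi\<^sup>2)) * integral\<^sup>L rot_space (\<lambda>(\<theta>, x). rot_integrand F \<theta> x)"

lemma norm_rot_form_le:
  assumes "\<And>k. k < 6 \<Longrightarrow> F k \<in> L2"
  shows "cmod (rot_form F) \<le> prod_bound F"
proof -
  have p0: "0 \<le> prod_bound F" by (simp add: prod_bound_def)
  \<comment> \<open>The prefactor times the length of the interval of angles is 1/(sqrt(3) pi),
    which is at most one.\<close>
  have "1 * 1 \<le> sqrt 3 * pi" using pi_gt3 by (intro mult_mono) auto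
  then have "1 / (2 * sqrt 3 * pi\<^sup>2) * (2 * pi) \<le> 1" using pi_gt3 by (simp add: field_simps power2_eq_square)
  have "cmod (rot_form F) \<le> 1 / (2 * sqrt 3 * pi\<^sup>2) * (2 * pi * prod_bound F)"
    unfolding rot_form_def norm_mult norm_of_real
    by (intro mult_mono integrable_rot_integrand(2) assms) (auto simp: p0)
  also have "\<dots> = 1 / (2 * sqrt 3 * pi\<^sup>2) * (2 * pi) * prod_bound F" by simp
  also have "\<dots> \<le> 1 * prod_bound F" by (rule mult_right_mono) fact+
  finally show ?thesis by simp
qed

lemma rot_form_slot:
  assumes k: "k < 6" and F: "\<And>j. j < 6 \<Longrightarrow> F j \<in> L2" and f: "f \<in> L2" and g: "g \<in> L2"
  shows "rot_form (F(k := \<lambda>x. of_real r * f x + of_real s * g x)) =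
    of_real r * rot_form (F(k := f)) + of_real s * rot_form (F(k := g))"
proof -
  have eq: "(\<lambda>(\<theta>, x). rot_integrand (F(k := h)) \<theta> x) =
      (\<lambda>\<omega>. six ((\<lambda>j. F j (rot_args (fst \<omega>) (snd \<omega>) j))(k := h (rot_args (fst \<omega>) (snd \<omega>) k))))" for h
    by (auto simp: rot_integrand_def fun_eq_iff intro!: six_cong)
  have i: "has_bochner_integral rot_space (\<lambda>(\<theta>, x). rot_integrand (F(k := h)) \<theta> x)
      (integral\<^sup>L rot_space (\<lambda>(\<theta>, x). rot_integrand (F(k := h)) \<theta> x))" if "h \<in> L2" for h
    by (rule has_bochner_integral_integrable, rule integrable_rot_integrand) (use F that in auto)
  from has_bochner_integral_six_slot[OF k i[OF f, unfolded eq] i[OF g, unfolded eq], of r s]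
  show ?thesis
    unfolding rot_form_def eq by (simp add: has_bochner_integral_iff algebra_simps)
qed

section \<open>Finite sums of wave packets\<close>

definition gsum :: "(complex \<times> complex) list \<Rightarrow> real \<Rightarrow> real \<Rightarrow> complex" where
  "gsum L t x = (\<Sum>(c, a)\<leftarrow>L. c * evol a t x)"

lemma gsum_Nil [simp]: "gsum [] t x = 0"
  and gsum_Cons: "gsum (p # L) t x = fst p * evol (snd p) t x + gsum L t x"
  by (simp_all add: gsum_def case_prod_beta)

lemma borel_measurable_gsum: "(\<lambda>(t, x). gsum L t x) \<in> borel_measurable (borel \<Otimes>\<^sub>M borel)"
proof (induction L)
  case (Cons p L)
  have "(\<lambda>z. evol (snd p) (fst z) (snd z)) \<in> borel_measurable (borel \<Otimes>\<^sub>M borel)"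
    unfolding borel_prod by (intro borel_measurable_continuous_onI continuous_intros)
  with Cons show ?case by (simp add: gsum_Cons case_prod_beta')
qed simp

lemma gsum_bound: "\<exists>C\<ge>0. \<forall>t x. cmod (gsum L t x) \<le> C * exp (- x\<^sup>2 / 4)"
proof (induction L)
  case (Cons p L)
  then obtain C where C: "C \<ge> 0" "\<And>t x. cmod (gsum L t x) \<le> C * exp (- x\<^sup>2 / 4)" by blast
  show ?case
  proof (intro exI[of _ "cmod (fst p) * gauss_const (snd p) + C"] conjI allI)
    show "0 \<le> cmod (fst p) * gauss_const (snd p) + C" using C gauss_const_pos[of "snd p"] by simp
    fix t x
    have "cmod (gsum (p # L) t x) \<le> cmod (fst p) * cmod (evol (snd p) t x) + cmod (gsum L t x)"
      unfolding gsum_Cons by (rule order_trans[OF norm_triangle_ineq]) (simp add: norm_mult)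
    also have "\<dots> \<le> cmod (fst p) * (gauss_const (snd p) * exp (- x\<^sup>2 / 4)) + C * exp (- x\<^sup>2 / 4)"
      by (intro add_mono mult_left_mono norm_evol_le C) auto
    finally show "cmod (gsum (p # L) t x) \<le> (cmod (fst p) * gauss_const (snd p) + C) * exp (- x\<^sup>2 / 4)"
      by (simp add: algebra_simps)
  qed
qed auto

lemma gsum_L2: "gsum L t \<in> L2"
proof -
  obtain C where "\<And>t x. cmod (gsum L t x) \<le> C * exp (- x\<^sup>2 / 4)" using gsum_bound by blast
  moreover have "gsum L t \<in> borel_measurable borel"
    using measurable_compose[OF _ borel_measurable_gsum[of L], of "\<lambda>x. (t, x)" borel] by simp
  ultimately show ?thesis by (intro L2_gaussian_bound)
qed

lemma integrable_six_gsum: "integrable time_space (\<lambda>(t, x). six (\<lambda>k. gsum (L k) t x))"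
proof -
  interpret fm: finite_measure "slab (- pi / 4) (pi / 4)" by (rule finite_measure_slab)
  interpret pair_sigma_finite "slab (- pi / 4) (pi / 4)" "lborel :: real measure" by (rule pair_sigma_finite_slab_lborel)
  have "\<forall>k. \<exists>C\<ge>0. \<forall>t x. cmod (gsum (L k) t x) \<le> C * exp (- x\<^sup>2 / 4)" using gsum_bound by blast
  then obtain C where C: "\<And>k. C k \<ge> 0" "\<And>k t x. cmod (gsum (L k) t x) \<le> C k * exp (- x\<^sup>2 / 4)" by metis
  have "has_bochner_integral (slab (- pi / 4) (pi / 4)) (\<lambda>t. \<Prod>k<6. C k) (LINT t|slab (- pi / 4) (pi / 4). (\<Prod>k<6. C k))"
    by (rule has_bochner_integral_integrable[OF fm.integrable_const])
  \<comment> \<open>The exponent 3/2 collects six decay factors exp(-x^2/4); the remaining constant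
    is integrable over the bounded time interval.\<close>
  moreover have "has_bochner_integral lborel (\<lambda>x::real. exp (- (3/2) * x\<^sup>2)) (LINT x|lborel. exp (- (3/2) * x\<^sup>2))"
    using integrable_real_gaussian[of "3/2"] by (simp add: has_bochner_integral_iff)
  ultimately have i: "integrable time_space (\<lambda>(t, x). (\<Prod>k<6. C k) * exp (- (3/2) * x\<^sup>2))"
    unfolding has_bochner_integral_iff
    by (rule has_bochner_integral_times[THEN has_bochner_integral_iff[THEN iffD1], THEN conjunct1, unfolded has_bochner_integral_iff])
  show ?thesis
  proof (rule Bochner_Integration.integrable_bound[OF i])
    have "(\<lambda>(t, x). six (\<lambda>k. gsum (L k) t x)) \<in> borel_measurable (borel \<Otimes>\<^sub>M borel)"
      unfolding case_prod_beta' by (rule borel_measurable_six) (use borel_measurable_gsum in \<open>simp add: case_prod_beta'\<close>)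
    from measurable_slab_pair[OF this] show "(\<lambda>(t, x). six (\<lambda>k. gsum (L k) t x)) \<in> borel_measurable time_space"
      by (simp cong: measurable_cong_sets)
    have "cmod (six (\<lambda>k. gsum (L k) t x)) \<le> (\<Prod>k<6. C k) * exp (- (3/2) * x\<^sup>2)" for t x
    proof -
      have "cmod (six (\<lambda>k. gsum (L k) t x)) \<le> (\<Prod>k<6. C k * exp (- x\<^sup>2 / 4))"
        unfolding norm_six by (intro prod_mono conjI norm_ge_zero C)
      also have "\<dots> = (\<Prod>k<6. C k) * exp (- (3/2) * x\<^sup>2)"
        by (simp add: prod.distrib flip: exp_of_nat_mult)
      finally show ?thesis .
    qed
    then show "AE p in time_space. norm (case p of (t, x) \<Rightarrow> six (\<lambda>k. gsum (L k) t x)) \<le>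
        norm (case p of (t, x) \<Rightarrow> (\<Prod>k<6. C k) * exp (- (3/2) * x\<^sup>2))"
      by (intro AE_I2) (auto simp: abs_mult prod_nonneg C intro: order_trans[OF _ abs_ge_self])
  qed
qed

definition gsum_form :: "(nat \<Rightarrow> (complex \<times> complex) list) \<Rightarrow> complex" where
  "gsum_form L = of_real (2 / pi) * integral\<^sup>L time_space (\<lambda>(t, x). six (\<lambda>k. gsum (L k) t x))"

lemma gsum_form_Cons:
  assumes k: "k < 6"
  shows "gsum_form (L(k := p # q)) = gsum_form (L(k := [p])) + gsum_form (L(k := q))"
proof -
  have eq: "(\<lambda>(t, x). six (\<lambda>j. gsum ((L(k := q)) j) t x)) =
     (\<lambda>\<omega>. six ((\<lambda>j. gsum (L j) (fst \<omega>) (snd \<omega>))(k := gsum q (fst \<omega>) (snd \<omega>))))" for q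
    by (auto simp: fun_eq_iff intro!: six_cong)
  have i: "has_bochner_integral time_space (\<lambda>(t, x). six (\<lambda>j. gsum ((L(k := q)) j) t x))
      (integral\<^sup>L time_space (\<lambda>(t, x). six (\<lambda>j. gsum ((L(k := q)) j) t x)))" for q
    by (rule has_bochner_integral_integrable, rule integrable_six_gsum)
  from has_bochner_integral_six_slot[OF k i[of "[p]", unfolded eq] i[of q, unfolded eq], of 1 1]
  show ?thesis
    unfolding gsum_form_def eq by (simp add: has_bochner_integral_iff algebra_simps gsum_Cons)
qed

text \<open>Single packets are covered by the Gaussian computation, their coefficients being pulled
  out of all slots at once. Within a slot, additivity lets the list be consumed one packet at a
  time.\<close>

lemma gsum_identity: "gsum_form L = rot_form (\<lambda>k. gsum (L k) 0)"
proof (rule slot_induct[where n=6 and A="range (\<lambda>p. [p])" and B=UNIV and Z="\<lambda>L. gsum_form L = rot_form (\<lambda>k. gsum (L k) 0)"])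
  fix L :: "nat \<Rightarrow> (complex \<times> complex) list"
  assume "\<And>k. k < 6 \<Longrightarrow> L k \<in> range (\<lambda>p. [p])"
  then have "\<forall>k. \<exists>p. k < 6 \<longrightarrow> L k = [p]" by blast
  then obtain p where p: "\<And>k. k < 6 \<Longrightarrow> L k = [p k]" by metis
  let ?c = "\<lambda>k. fst (p k)" and ?a = "\<lambda>k. snd (p k)"
  have g: "gsum (L k) t x = ?c k * evol (?a k) t x" if "k < 6" for k t x
    using p[OF that] by (simp add: gsum_Cons)
  have e1: "six (\<lambda>k. gsum (L k) t x) = six ?c * six (\<lambda>k. evol (?a k) t x)" for t x
    unfolding six_mult[symmetric] by (rule six_cong) (rule g)
  have e2: "rot_integrand (\<lambda>k. gsum (L k) 0) \<theta> x = six ?c * rot_integrand (\<lambda>k. evol (?a k) 0) \<theta> x" for \<theta> x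
    unfolding rot_integrand_def six_mult[symmetric] by (rule six_cong) (rule g)
  have "gsum_form L = of_real (2 / pi) * (LINT t|slab (- pi / 4) (pi / 4). LINT x|lborel. six (\<lambda>k. gsum (L k) t x))"
    unfolding gsum_form_def
    using pair_sigma_finite.integral_fst'[OF pair_sigma_finite_slab_lborel integrable_six_gsum[of L]] by simp
  also have "\<dots> = six ?c * (of_real (2 / pi) * (LINT t|slab (- pi / 4) (pi / 4). LINT x|lborel. six (\<lambda>k. evol (?a k) t x)))"
    unfolding e1 by simp
  also have "\<dots> = of_real (1 / (2 * sqrt 3 * pi\<^sup>2)) * (LINT \<theta>|slab 0 (2 * pi). LINT x|lborel. rot_integrand (\<lambda>k. gsum (L k) 0) \<theta> x)"
    unfolding sextic_identity_evol e2 by simp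
  also have "\<dots> = rot_form (\<lambda>k. gsum (L k) 0)"
    unfolding rot_form_def
    using pair_sigma_finite.integral_fst'[OF pair_sigma_finite_slab_lborel integrable_rot_integrand(1)[of "\<lambda>k. gsum (L k) 0"]]
    by (simp add: gsum_L2)
  finally show "gsum_form L = rot_form (\<lambda>k. gsum (L k) 0)" .
next
  fix k :: nat and L :: "nat \<Rightarrow> (complex \<times> complex) list" and q
  assume k: "k < 6" and IH: "\<And>p. p \<in> range (\<lambda>p. [p]) \<Longrightarrow> gsum_form (L(k := p)) = rot_form (\<lambda>j. gsum ((L(k := p)) j) 0)"
  have r: "(\<lambda>j. gsum ((L(k := q)) j) 0) = (\<lambda>j. gsum (L j) 0)(k := gsum q 0)" for q by auto
  show "gsum_form (L(k := q)) = rot_form (\<lambda>j. gsum ((L(k := q)) j) 0)"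
  proof (induction q)
    case Nil
    have z: "six (\<lambda>j. gsum ((L(k := [])) j) t (y j)) = 0" for t y
    proof -
      have "(\<lambda>j. gsum ((L(k := [])) j) t (y j)) = (\<lambda>j. gsum (L j) t (y j))(k := 0)" by auto
      then show ?thesis using six_slot_zero[OF k] by (simp only:)
    qed
    have "six (\<lambda>j. gsum ((L(k := [])) j) t x) = 0" for t x by (rule z)
    moreover have "rot_integrand (\<lambda>j. gsum ((L(k := [])) j) 0) \<theta> x = 0" for \<theta> x
      unfolding rot_integrand_def by (rule z)
    ultimately show ?case unfolding gsum_form_def rot_form_def by (simp only: case_prod_beta' Bochner_Integration.integral_zero mult_zero_right)
  next
    case (Cons p q)
    have "gsum (p # q) 0 = (\<lambda>x. of_real 1 * gsum [p] 0 x + of_real 1 * gsum q 0 x)"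
      by (simp add: gsum_Cons fun_eq_iff)
    then have "rot_form (\<lambda>j. gsum ((L(k := p # q)) j) 0) = rot_form (\<lambda>j. gsum ((L(k := [p])) j) 0) + rot_form (\<lambda>j. gsum ((L(k := q)) j) 0)"
      unfolding r using rot_form_slot[OF k, of "\<lambda>j. gsum (L j) 0" "gsum [p] 0" "gsum q 0" 1 1] by (simp add: gsum_L2)
    then show ?case
      using gsum_form_Cons[OF k, of L p q] Cons IH[OF rangeI[of "\<lambda>p. [p]" p]] by (simp only:)
  qed
qed auto

text \<open>With six equal functions the integrand is the sixth power of the modulus. Both summands
  of \<open>prod_bound\<close> become the cube of the squared norm, and the prefactor 2/pi turns
  their sum into the constant pi.\<close>

lemma gsum_strichartz:
  "integrable time_space (\<lambda>(t, x). cmod (gsum L t x) ^ 6)" (is ?A)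
  "(LINT (t, x)|time_space. cmod (gsum L t x) ^ 6) \<le> pi * l2_square (gsum L 0) ^ 3" (is ?B)
proof -
  let ?f = "\<lambda>(t, x). cmod (gsum L t x) ^ 6"
  have eq: "(\<lambda>(t, x). six (\<lambda>k. gsum L t x)) = (\<lambda>p. complex_of_real (?f p))"
    by (auto simp: six_const)
  show i: ?A
    using integrable_norm[OF integrable_six_gsum[of "\<lambda>k. L"]] unfolding eq by (simp add: case_prod_beta' norm_power)
  have "complex_of_real (2 / pi * integral\<^sup>L time_space ?f) = gsum_form (\<lambda>k. L)"
    unfolding gsum_form_def eq by simp
  then have "\<bar>2 / pi * integral\<^sup>L time_space ?f\<bar> = cmod (rot_form (\<lambda>k. gsum L 0))"
    unfolding gsum_identity by (metis norm_of_real)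
  also have "\<dots> \<le> prod_bound (\<lambda>k. gsum L 0)" by (rule norm_rot_form_le) (rule gsum_L2)
  also have "\<dots> = 2 * l2_square (gsum L 0) ^ 3" by (simp add: prod_bound_def power3_eq_cube)
  finally have "2 / pi * integral\<^sup>L time_space ?f \<le> 2 * l2_square (gsum L 0) ^ 3"
    by (rule order_trans[OF abs_ge_self])
  then show ?B by (simp add: field_simps)
qed

section \<open>Density of the Gaussian sums\<close>

lemma evol_0: "evol a 0 x = exp (- (of_real x)\<^sup>2 / 2) * exp (a * of_real x)"
  by (simp add: evol_def phase_def exp_add[symmetric])

text \<open>Exponential sums stripped of the Gaussian weight form an algebra, which the packets
  themselves do not. This is what lets polynomials enter.\<close>

definition texp :: "(complex \<times> complex) list \<Rightarrow> real \<Rightarrow> complex" where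
  "texp L x = (\<Sum>(c, a)\<leftarrow>L. c * exp (a * of_real x))"

lemma texp_simps: "texp [] x = 0" "texp ((c, a) # L) x = c * exp (a * of_real x) + texp L x"
  "texp (L @ M) x = texp L x + texp M x"
  by (simp_all add: texp_def)

lemma gsum_0_texp: "gsum L 0 x = exp (- (of_real x)\<^sup>2 / 2) * texp L x"
  by (induction L) (auto simp: gsum_Cons texp_simps evol_0 algebra_simps)

lemma texp_times_exp: "\<exists>M. \<forall>x. texp M x = c * exp (a * of_real x) * texp L x"
proof (intro exI allI)
  fix x show "texp (map (\<lambda>(d, b). (c * d, a + b)) L) x = c * exp (a * of_real x) * texp L x"
    by (induction L) (auto simp: texp_simps algebra_simps exp_add)
qed

lemma texp_times: "\<exists>M. \<forall>x. texp M x = texp K x * texp L x"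
proof (induction K)
  case Nil then show ?case by (intro exI[of _ "[]"]) (simp add: texp_simps)
next
  case (Cons p K)
  obtain M where "\<And>x. texp M x = texp K x * texp L x" using Cons by blast
  moreover obtain M' where "\<And>x. texp M' x = fst p * exp (snd p * of_real x) * texp L x"
    using texp_times_exp by blast
  ultimately have "\<forall>x. texp (M' @ M) x = texp (p # K) x * texp L x"
    by (cases p) (simp add: texp_simps algebra_simps)
  then show ?case by blast
qed

text \<open>A real linear functional on the plane is a combination of real and imaginary part, and
  on the unit circle these are combinations of two opposite exponentials. The algebra structure does
  the rest.\<close>

lemma real_polynomial_function_texp:
  "real_polynomial_function f \<Longrightarrow> \<exists>L. \<forall>x. of_real (f (cis (\<kappa> * x))) = texp L x"
proof (induction f rule: real_polynomial_function.induct)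
  case (linear f)
  interpret bounded_linear f by fact
  have f: "f z = Re z * f 1 + Im z * f \<i>" for z
  proof -
    have "f z = f (Re z *\<^sub>R 1 + Im z *\<^sub>R \<i>)"
      by (rule arg_cong[where f=f]) (simp add: complex_eq_iff)
    then show ?thesis by (simp only: add scaleR real_scaleR_def)
  qed
  let ?e = "\<lambda>x. exp (\<i> * of_real \<kappa> * of_real x)" and ?d = "\<lambda>x. exp (- \<i> * of_real \<kappa> * of_real x)"
  have "of_real (f (cis (\<kappa> * x))) = texp [((f 1 - \<i> * f \<i>) / 2, \<i> * of_real \<kappa>), ((f 1 + \<i> * f \<i>) / 2, - \<i> * of_real \<kappa>)] x" for x
  proof -
    have e: "?e x = cos (\<kappa> * x) + \<i> * sin (\<kappa> * x)" "?d x = cos (\<kappa> * x) - \<i> * sin (\<kappa> * x)"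
      using cis_conv_exp[of "\<kappa> * x"] cis_conv_exp[of "- (\<kappa> * x)"]
      by (simp_all add: complex_eq_iff mult.assoc)
    show ?thesis unfolding texp_simps e f[of "cis _"] by (simp add: complex_eq_iff field_simps)
  qed
  then show ?case by blast
next
  case (const c)
  have "\<forall>x. of_real c = texp [(of_real c, 0)] x" by (simp add: texp_simps)
  then show ?case by blast
next
  case (add f g)
  then obtain K L where "\<And>x. of_real (f (cis (\<kappa> * x))) = texp K x" "\<And>x. of_real (g (cis (\<kappa> * x))) = texp L x"
    by blast
  then have "\<forall>x. of_real (f (cis (\<kappa> * x)) + g (cis (\<kappa> * x))) = texp (K @ L) x" by (simp add: texp_simps)
  then show ?case by blast
next
  case (mult f g)
  then obtain K L where "\<And>x. of_real (f (cis (\<kappa> * x))) = texp K x" "\<And>x. of_real (g (cis (\<kappa> * x))) = texp L x"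
    by blast
  moreover obtain M where "\<And>x. texp M x = texp K x * texp L x" using texp_times by blast
  ultimately have "\<forall>x. of_real (f (cis (\<kappa> * x)) * g (cis (\<kappa> * x))) = texp M x" by simp
  then show ?case by blast
qed

lemma polynomial_function_texp:
  fixes g :: "complex \<Rightarrow> complex"
  assumes "polynomial_function g"
  shows "\<exists>L. \<forall>x. g (cis (\<kappa> * x)) = texp L x"
proof -
  have "real_polynomial_function (Re \<circ> g)" "real_polynomial_function (Im \<circ> g)"
    using assms unfolding polynomial_function_def by (auto intro: bounded_linear_Re bounded_linear_Im)
  then obtain K L where K: "\<And>x. of_real ((Re \<circ> g) (cis (\<kappa> * x))) = texp K x"
    and L: "\<And>x. of_real ((Im \<circ> g) (cis (\<kappa> * x))) = texp L x"
    using real_polynomial_function_texp by metis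
  obtain M where M: "\<And>x. texp M x = \<i> * texp L x" using texp_times_exp[of \<i> 0 L] by auto
  have "g (cis (\<kappa> * x)) = texp (K @ M) x" for x
    unfolding texp_simps M K[symmetric] L[symmetric] by (simp add: complex_eq_iff)
  then show ?thesis by blast
qed

text \<open>The line is wrapped around the circle by x to cis(pi x / R), and the Stone-Weierstrass
  theorem applies there. Closeness holds on one period; periodicity extends the bound
  \<open>B + e\<close> to the whole line, which later provides domination outside the
  window.\<close>

lemma texp_approx:
  fixes h :: "real \<Rightarrow> complex"
  assumes h: "continuous_on UNIV h" and supp: "\<And>x. M < \<bar>x\<bar> \<Longrightarrow> h x = 0" and M: "0 < M" and R: "2 * M < R"
    and B: "\<And>x. cmod (h x) \<le> B" and e: "0 < e"
  shows "\<exists>L. (\<forall>x. cmod (texp L x) \<le> B + e) \<and> (\<forall>x. \<bar>x\<bar> < R \<longrightarrow> cmod (h x - texp L x) < e)"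
proof -
  let ?S = "sphere 0 1 \<inter> {z. 0 \<le> Re z}" and ?T = "sphere 0 1 \<inter> {z. Re z \<le> 0}"
  \<comment> \<open>Because \<open>2 * M < R\<close>, the support occupies only the open right half
    of the circle. The function therefore glues continuously with zero, away from the branch cut of
    \<open>Arg\<close>.\<close>
  define H where "H z = (if 0 \<le> Re z then h (R / pi * Arg z) else 0)" for z
  have R0: "0 < R" using M R by simp
  have far: "h (R / pi * y) = 0" if "pi / 2 \<le> \<bar>y\<bar>" for y
  proof (rule supp)
    have "M < R / pi * (pi / 2)" using R by simp
    also have "\<dots> \<le> R / pi * \<bar>y\<bar>" using that R0 by (intro mult_left_mono) auto
    also have "\<dots> = \<bar>R / pi * y\<bar>" using R0 by (simp add: abs_mult)
    finally show "M < \<bar>R / pi * y\<bar>" .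
  qed
  have "continuous_on (?S \<union> ?T) H"
    unfolding H_def
  proof (rule continuous_on_cases)
    show "closed ?S" "closed ?T" by (auto intro!: closed_Int closed_halfspace_Re_ge closed_halfspace_Re_le)
    show "continuous_on ?S (\<lambda>z. h (R / pi * Arg z))"
    proof (rule continuous_on_compose2[OF h])
      have "z \<notin> \<real>\<^sub>\<le>\<^sub>0" if "z \<in> ?S" for z
      proof
        assume "z \<in> \<real>\<^sub>\<le>\<^sub>0"
        then have "z = 0" using that by (auto simp: complex_nonpos_Reals_iff complex_eq_iff)
        then show False using that by simp
      qed
      then show "continuous_on ?S (\<lambda>z. R / pi * Arg z)"
        by (intro continuous_intros continuous_at_imp_continuous_on ballI continuous_at_Arg)
    qed auto
    show "\<forall>z. z \<in> ?S \<and> \<not> 0 \<le> Re z \<or> z \<in> ?T \<and> 0 \<le> Re z \<longrightarrow> h (R / pi * Arg z) = 0"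
    proof (intro allI impI)
      fix z assume "z \<in> ?S \<and> \<not> 0 \<le> Re z \<or> z \<in> ?T \<and> 0 \<le> Re z"
      then have "Re z = 0" "z \<noteq> 0" by auto
      then show "h (R / pi * Arg z) = 0" using Arg_Re_pos[of z] by (intro far) auto
    qed
  qed auto
  moreover have "?S \<union> ?T = sphere 0 1" by auto
  ultimately have "continuous_on (sphere 0 1) H" by simp
  from Stone_Weierstrass_polynomial_function[OF compact_sphere this e]
  obtain g where g: "polynomial_function g" "\<And>z. z \<in> sphere 0 1 \<Longrightarrow> cmod (H z - g z) < e" by blast
  obtain L where L: "\<And>x. g (cis (pi / R * x)) = texp L x"
    using polynomial_function_texp[OF g(1)] by blast
  have near: "cmod (H (cis (pi / R * x)) - texp L x) < e" for x
    using g(2)[of "cis (pi / R * x)", unfolded L] by simp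
  have "cmod (H z) \<le> B" for z
    using B order_trans[OF norm_ge_zero B] by (simp add: H_def)
  then have "cmod (texp L x) \<le> B + e" for x
    using near[of x] norm_triangle_sub[of "texp L x" "H (cis (pi / R * x))"]
    by (smt (verit, best) norm_minus_commute)
  moreover have "H (cis (pi / R * x)) = h x" if x: "\<bar>x\<bar> < R" for x
  proof -
    have "\<bar>pi / R * x\<bar> < pi" using x R0 by (simp add: abs_mult field_simps)
    then have "- pi < pi / R * x" "pi / R * x \<le> pi" by linarith+
    then have A: "Arg (cis (pi / R * x)) = pi / R * x"
      by (intro Arg_cis) (simp only: greaterThanAtMost_iff)
    have rx: "R / pi * (pi / R * x) = x" using R0 by simp
    show ?thesis
    proof (cases "0 \<le> Re (cis (pi / R * x))")
      case True then show ?thesis by (simp only: H_def A rx if_True)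
    next
      case False
      then have "pi / 2 \<le> \<bar>pi / R * x\<bar>" using Arg_Re_pos[of "cis (pi / R * x)"] A by (simp del: cis.simps) 
      from far[OF this] have "h x = 0" unfolding rx .
      then show ?thesis using False by (simp only: H_def if_False)
    qed
  qed
  ultimately show ?thesis using near by metis
qed

definition l2_close :: "(real \<Rightarrow> complex) \<Rightarrow> bool" where
  "l2_close f \<longleftrightarrow> (\<forall>e>0. \<exists>L. l2_square (\<lambda>x. f x - gsum L 0 x) < e)"

lemma l2_square_add_le:
  assumes "f \<in> L2" "g \<in> L2"
  shows "l2_square (\<lambda>x. f x + g x) \<le> 2 * l2_square f + 2 * l2_square g"
proof -
  have "l2_square (\<lambda>x. f x + g x) \<le> (LINT x|lborel. 2 * (cmod (f x))\<^sup>2 + 2 * (cmod (g x))\<^sup>2)"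
    unfolding l2_square_def
    by (rule integral_mono) (use assms in \<open>auto intro!: L2_integrable L2_add norm_add_square_le\<close>)
  then show ?thesis using L2_integrable[OF assms(1)] L2_integrable[OF assms(2)] by (simp add: l2_square_def)
qed

lemma l2_close_limit:
  assumes f: "f \<in> L2" and lim: "(\<lambda>n. l2_square (\<lambda>x. f x - g n x)) \<longlonglongrightarrow> 0"
    and g: "\<And>n. g n \<in> L2" "\<And>n. l2_close (g n)"
  shows "l2_close f"
  unfolding l2_close_def
proof (intro allI impI)
  fix e :: real assume e: "0 < e"
  then have "eventually (\<lambda>n. l2_square (\<lambda>x. f x - g n x) < e / 4) sequentially"
    using lim by (intro order_tendstoD(2)) auto
  then obtain n where n: "l2_square (\<lambda>x. f x - g n x) < e / 4" by (auto simp: eventually_sequentially)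
  have "0 < e / 4" using e by simp
  then obtain L where L: "l2_square (\<lambda>x. g n x - gsum L 0 x) < e / 4"
    using g(2)[of n] unfolding l2_close_def by blast
  have "l2_square (\<lambda>x. f x - gsum L 0 x) = l2_square (\<lambda>x. (f x - g n x) + (g n x - gsum L 0 x))" by simp
  also have "\<dots> \<le> 2 * l2_square (\<lambda>x. f x - g n x) + 2 * l2_square (\<lambda>x. g n x - gsum L 0 x)"
    by (intro l2_square_add_le L2_diff f g gsum_L2)
  also have "\<dots> < e" using n L by simp
  finally show "\<exists>L. l2_square (\<lambda>x. f x - gsum L 0 x) < e" by blast
qed

lemma l2_square_tendsto_0:
  assumes m: "\<And>n. f n \<in> borel_measurable borel" and w: "integrable lborel w"
    and b: "\<And>n x. (cmod (f n x))\<^sup>2 \<le> w x" and lim: "AE x in lborel. (\<lambda>n. f n x) \<longlonglongrightarrow> 0"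
  shows "(\<lambda>n. l2_square (f n)) \<longlonglongrightarrow> 0"
proof -
  have "(\<lambda>n. LINT x|lborel. (cmod (f n x))\<^sup>2) \<longlonglongrightarrow> (LINT x::real|lborel. (0::real))"
  proof (rule integral_dominated_convergence[where w=w])
    show "AE x in lborel. (\<lambda>n. (cmod (f n x))\<^sup>2) \<longlonglongrightarrow> 0"
      using lim by eventually_elim (intro tendsto_null_power tendsto_norm_zero, simp_all)
  qed (use m w b in auto)
  then show ?thesis by (simp add: l2_square_def)
qed

text \<open>The error tends to zero on windows that exhaust the line. Outside a window only
  boundedness of the approximants is known, and there the Gaussian weight supplies the integrable
  majorant.\<close>

lemma l2_close_continuous:
  fixes h :: "real \<Rightarrow> complex"
  assumes h: "continuous_on UNIV h" and supp: "\<And>x. M < \<bar>x\<bar> \<Longrightarrow> h x = 0" and M: "0 < M"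
    and B: "\<And>x. cmod (h x) \<le> B"
  shows "l2_close (\<lambda>x. exp (- (of_real x)\<^sup>2 / 2) * h x)"
proof -
  have B0: "0 \<le> B" using order_trans[OF norm_ge_zero B] .
  have "\<exists>L. (\<forall>x. cmod (texp L x) \<le> B + 1 / real (Suc n)) \<and>
      (\<forall>x. \<bar>x\<bar> < 2 * M + real (Suc n) \<longrightarrow> cmod (h x - texp L x) < 1 / real (Suc n))" for n
    by (rule texp_approx[OF h supp M _ B]) auto
  then obtain L where L: "\<And>n x. cmod (texp (L n) x) \<le> B + 1 / real (Suc n)"
    "\<And>n x. \<bar>x\<bar> < 2 * M + real (Suc n) \<Longrightarrow> cmod (h x - texp (L n) x) < 1 / real (Suc n)"
    by metis
  let ?f = "\<lambda>n x. exp (- (of_real x)\<^sup>2 / 2) * h x - gsum (L n) 0 x"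
  have eq: "?f n x = of_real (exp (- x\<^sup>2 / 2)) * (h x - texp (L n) x)" for n x
    by (simp add: gsum_0_texp algebra_simps flip: exp_of_real)
  have "(\<lambda>n. l2_square (?f n)) \<longlonglongrightarrow> 0"
  proof (rule l2_square_tendsto_0)
    show "integrable lborel (\<lambda>x. (2 * B + 1)\<^sup>2 * exp (- 1 * x\<^sup>2))"
      by (intro integrable_mult_right integrable_real_gaussian) simp
    have [measurable]: "h \<in> borel_measurable borel" by (rule borel_measurable_continuous_onI[OF h])
    have [measurable]: "gsum (L n) 0 \<in> borel_measurable borel" for n by (intro L2_measurable gsum_L2)
    show "?f n \<in> borel_measurable borel" for n by measurable
    show "(cmod (?f n x))\<^sup>2 \<le> (2 * B + 1)\<^sup>2 * exp (- 1 * x\<^sup>2)" for n x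
    proof -
      have "cmod (h x - texp (L n) x) \<le> B + (B + 1 / real (Suc n))"
        by (rule norm_triangle_le_diff) (intro add_mono B L)
      also have "\<dots> \<le> 2 * B + 1" by simp
      finally have "(cmod (h x - texp (L n) x))\<^sup>2 \<le> (2 * B + 1)\<^sup>2" by (intro power_mono) auto
      then have "(cmod (h x - texp (L n) x))\<^sup>2 * exp (- 1 * x\<^sup>2) \<le> (2 * B + 1)\<^sup>2 * exp (- 1 * x\<^sup>2)"
        by (intro mult_right_mono) auto
      moreover have "(cmod (?f n x))\<^sup>2 = (cmod (h x - texp (L n) x))\<^sup>2 * exp (- 1 * x\<^sup>2)"
        unfolding eq by (simp add: norm_mult power_mult_distrib mult.commute flip: exp_of_nat_mult)
      ultimately show ?thesis by simp
    qed
    show "AE x in lborel. (\<lambda>n. ?f n x) \<longlonglongrightarrow> 0"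
    proof (intro AE_I2)
      fix x :: real
      obtain N where N: "\<bar>x\<bar> < real N" using reals_Archimedean2 by blast
      have "(\<lambda>n. h x - texp (L n) x) \<longlonglongrightarrow> 0"
      proof (rule Lim_null_comparison)
        show "(\<lambda>n. 1 / real (Suc n)) \<longlonglongrightarrow> 0" by (rule LIMSEQ_Suc[OF lim_1_over_n])
        show "\<forall>\<^sub>F n in sequentially. norm (h x - texp (L n) x) \<le> 1 / real (Suc n)"
          unfolding eventually_sequentially
        proof (intro exI allI impI)
          fix n assume "N \<le> n"
          then have "\<bar>x\<bar> < 2 * M + real (Suc n)" using N M by linarith
          from L(2)[OF this] show "norm (h x - texp (L n) x) \<le> 1 / real (Suc n)" by simp
        qed
      qed
      then show "(\<lambda>n. ?f n x) \<longlonglongrightarrow> 0" unfolding eq by (rule tendsto_mult_right_zero)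
    qed
  qed
  then show ?thesis
    unfolding l2_close_def
  proof (intro allI impI)
    fix e :: real assume "(\<lambda>n. l2_square (?f n)) \<longlonglongrightarrow> 0" "0 < e"
    then have "eventually (\<lambda>n. l2_square (?f n) < e) sequentially" by (intro order_tendstoD(2)) auto
    then show "\<exists>L. l2_square (\<lambda>x. exp (- (of_real x)\<^sup>2 / 2) * h x - gsum L 0 x) < e"
      by (auto simp: eventually_sequentially)
  qed
qed

text \<open>The weight is divided out beforehand; its reciprocal is at most exp(M^2/2) on the
  support.\<close>

lemma l2_close_continuous':
  fixes h :: "real \<Rightarrow> complex"
  assumes h: "continuous_on UNIV h" and supp: "\<And>x. M < \<bar>x\<bar> \<Longrightarrow> h x = 0" and M: "0 < M"
    and B: "\<And>x. cmod (h x) \<le> B"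
  shows "l2_close h"
proof -
  let ?h = "\<lambda>x. exp ((of_real x)\<^sup>2 / 2) * h x"
  have B0: "0 \<le> B" using order_trans[OF norm_ge_zero B] .
  have "l2_close (\<lambda>x. exp (- (of_real x)\<^sup>2 / 2) * ?h x)"
  proof (rule l2_close_continuous[of _ M "exp (M\<^sup>2 / 2) * B"])
    show "continuous_on UNIV ?h" by (intro continuous_intros h) auto
    fix x
    show "cmod (?h x) \<le> exp (M\<^sup>2 / 2) * B"
    proof (cases "\<bar>x\<bar> \<le> M")
      case True
      then have "x\<^sup>2 \<le> M\<^sup>2" using M by (simp add: abs_le_square_iff[symmetric])
      have "cmod (?h x) = exp (x\<^sup>2 / 2) * cmod (h x)" by (simp add: norm_mult norm_exp_eq_Re flip: of_real_power)
      also have "\<dots> \<le> exp (M\<^sup>2 / 2) * B" using \<open>x\<^sup>2 \<le> M\<^sup>2\<close> by (intro mult_mono B) auto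
      finally show ?thesis .
    qed (use supp B0 in auto)
  qed (use supp M in auto)
  moreover have "exp (- (of_real x)\<^sup>2 / 2) * ?h x = h x" for x
    by (simp add: mult.assoc[symmetric] exp_add[symmetric])
  ultimately show ?thesis by (simp only:)
qed

text \<open>A measurable function is almost everywhere a limit of continuous ones. These are
  truncated in the variable and in the value, so that they share a majorant and dominated
  convergence applies.\<close>

lemma l2_close_bounded:
  fixes f :: "real \<Rightarrow> complex"
  assumes m: "f \<in> borel_measurable borel" and M: "0 < M" and b: "\<And>x. cmod (f x) \<le> M"
    and supp: "\<And>x. M < \<bar>x\<bar> \<Longrightarrow> f x = 0"
  shows "f \<in> L2" "l2_close f"
proof -
  have w: "integrable lborel (\<lambda>x. indicator {- (M + 1)..M + 1} x * C)" for C :: real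
    by (intro integrable_mult_left) (simp add: emeasure_lborel_Icc_eq)
  show f: "f \<in> L2"
    by (rule L2_bound[OF m w[of "M\<^sup>2"]]) (use b supp M in \<open>auto simp: indicator_def intro!: power_mono\<close>)
  have "f measurable_on UNIV" using measurable_completion[of f lborel borel] m
    by (intro lebesgue_measurable_imp_measurable_on) auto
  then obtain N g where N: "negligible N" and g: "\<And>n. continuous_on UNIV (g n)"
    "\<And>x. x \<notin> N \<Longrightarrow> (\<lambda>n. g n x) \<longlonglongrightarrow> f x"
    unfolding measurable_on_def by auto
  \<comment> \<open>A tent equal to 1 for \<open>\<bar>x\<bar> \<le> M\<close> and to 0 beyond
    \<open>M + 1\<close>.\<close>
  define ct where "ct x = max 0 (min 1 (M + 1 - \<bar>x\<bar>))" for x :: real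
  \<comment> \<open>The projection onto the disc of radius \<open>M\<close> is continuous, bounds
    all approximants, and fixes the values of \<open>f\<close>, so the limit is unchanged.\<close>
  define cl where "cl = closest_point (cball (0::complex) M)"
  have cl: "continuous_on UNIV cl" unfolding cl_def by (rule continuous_on_closest_point) (use M in auto)
  have clb: "cmod (cl z) \<le> M" for z
    using closest_point_in_set[of "cball (0::complex) M" z] M unfolding cl_def by auto
  have clf: "cl (f x) = f x" for x unfolding cl_def by (rule closest_point_self) (use b in auto)
  define \<phi> where "\<phi> n x = of_real (ct x) * cl (g n x)" for n x
  have \<phi>c: "continuous_on UNIV (\<phi> n)" for n
    unfolding \<phi>_def ct_def by (intro continuous_intros continuous_on_compose2[OF cl g(1)]) auto
  have ct1: "0 \<le> ct x" "ct x \<le> 1" for x by (auto simp: ct_def)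
  have \<phi>b: "cmod (\<phi> n x) \<le> M" for n x
    using mult_mono[OF ct1(2)[of x] clb[of "g n x"]] ct1(1)[of x] M by (simp add: \<phi>_def norm_mult)
  have \<phi>s: "\<phi> n x = 0" if "M + 1 < \<bar>x\<bar>" for n x using that by (simp add: \<phi>_def ct_def)
  have "\<phi> n \<in> L2" for n
    by (rule L2_bound[OF borel_measurable_continuous_onI[OF \<phi>c] w[of "M\<^sup>2"]])
      (use \<phi>b \<phi>s M in \<open>auto simp: indicator_def intro!: power_mono\<close>)
  moreover have "l2_close (\<phi> n)" for n
    by (rule l2_close_continuous'[where M="M + 1" and B=M]) (use M \<phi>c \<phi>s \<phi>b in auto)
  moreover have "(\<lambda>n. l2_square (\<lambda>x. f x - \<phi> n x)) \<longlonglongrightarrow> 0"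
  proof (rule l2_square_tendsto_0[OF _ w[of "(2 * M)\<^sup>2"]])
    show "(\<lambda>x. f x - \<phi> n x) \<in> borel_measurable borel" for n
      using m borel_measurable_continuous_onI[OF \<phi>c[of n]] by (intro borel_measurable_diff)
    show "(cmod (f x - \<phi> n x))\<^sup>2 \<le> indicator {- (M + 1)..M + 1} x * (2 * M)\<^sup>2" for n x
    proof (cases "\<bar>x\<bar> \<le> M + 1")
      case True
      have "cmod (f x - \<phi> n x) \<le> 2 * M" by (rule norm_triangle_le_diff) (use b[of x] \<phi>b[of n x] in auto)
      then have "(cmod (f x - \<phi> n x))\<^sup>2 \<le> (2 * M)\<^sup>2" by (intro power_mono) auto
      then show ?thesis using True by (simp add: indicator_def abs_le_iff)
    qed (use supp \<phi>s in auto)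
    have "N \<in> null_sets lebesgue" using N by (simp add: negligible_iff_null_sets)
    then have "AE x in lebesgue. x \<notin> N" by (rule AE_not_in)
    then have "AE x in lborel. x \<notin> N" using AE_completion_iff by blast
    then show "AE x in lborel. (\<lambda>n. f x - \<phi> n x) \<longlonglongrightarrow> 0"
    proof eventually_elim
      case (elim x)
      have "(\<lambda>n. cl (g n x)) \<longlonglongrightarrow> cl (f x)"
        by (rule continuous_on_tendsto_compose[OF cl g(2)[OF elim]]) auto
      then have "(\<lambda>n. f x - \<phi> n x) \<longlonglongrightarrow> f x - of_real (ct x) * f x"
        unfolding \<phi>_def clf by (intro tendsto_intros)
      moreover have "of_real (ct x) * f x = f x"
        using supp[of x] by (cases "M < \<bar>x\<bar>") (auto simp: ct_def)
      ultimately show ?case by simp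
    qed
  qed
  ultimately show "l2_close f" by (intro l2_close_limit[OF f])
qed

lemma l2_close_L2:
  assumes f: "f \<in> L2"
  shows "l2_close f"
proof -
  define g where "g n x = (if \<bar>x\<bar> \<le> real (Suc n) \<and> cmod (f x) \<le> real (Suc n) then f x else 0)" for n x
  have [measurable]: "f \<in> borel_measurable borel" by (rule L2_measurable[OF f])
  have gm [measurable]: "g n \<in> borel_measurable borel" for n unfolding g_def by measurable
  have g: "g n \<in> L2" "l2_close (g n)" for n
    by (rule l2_close_bounded[OF gm, of "real (Suc n)"]; simp add: g_def)+
  show ?thesis
  proof (rule l2_close_limit[OF f _ g])
    show "(\<lambda>n. l2_square (\<lambda>x. f x - g n x)) \<longlonglongrightarrow> 0"
    proof (rule l2_square_tendsto_0[OF _ L2_integrable[OF f]])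
      show "(\<lambda>x. f x - g n x) \<in> borel_measurable borel" for n by measurable
      show "(cmod (f x - g n x))\<^sup>2 \<le> (cmod (f x))\<^sup>2" for n x by (simp add: g_def)
      show "AE x in lborel. (\<lambda>n. f x - g n x) \<longlonglongrightarrow> 0"
      proof (intro AE_I2)
        fix x
        obtain N where N: "max \<bar>x\<bar> (cmod (f x)) < real N" using reals_Archimedean2 by blast
        have "eventually (\<lambda>n. f x - g n x = 0) sequentially"
          unfolding eventually_sequentially
        proof (intro exI allI impI)
          fix n assume "N \<le> n"
          then have "real N \<le> real (Suc n)" by simp
          then show "f x - g n x = 0" using N by (simp add: g_def)
        qed
        then show "(\<lambda>n. f x - g n x) \<longlonglongrightarrow> 0" by (rule tendsto_eventually)
      qed
    qed
  qed
qed

section \<open>Extension to square-integrable functions\<close>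

text \<open>The geometric rate makes the sum of the squares integrable, hence finite almost
  everywhere. The whole sequence converges, without passing to a subsequence that could depend on
  the time.\<close>

lemma AE_tendsto_0_of_l2_square:
  assumes d: "\<And>n. d n \<in> L2" and b: "\<And>n. l2_square (d n) \<le> (1/4) ^ n"
  shows "AE x in lborel. (\<lambda>n. d n x) \<longlonglongrightarrow> 0"
proof -
  have [measurable]: "d n \<in> borel_measurable borel" for n by (rule L2_measurable[OF d])
  have "(\<integral>\<^sup>+x. (\<Sum>n. ennreal ((cmod (d n x))\<^sup>2)) \<partial>lborel) = (\<Sum>n. \<integral>\<^sup>+x. ennreal ((cmod (d n x))\<^sup>2) \<partial>lborel)"
    by (rule nn_integral_suminf) measurable
  also have "\<dots> = (\<Sum>n. ennreal (l2_square (d n)))"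
    unfolding l2_square_def by (intro suminf_cong nn_integral_eq_integral L2_integrable d) auto
  also have "\<dots> \<le> (\<Sum>n. ennreal ((1/4) ^ n))" by (intro suminf_le ennreal_leI b) auto
  also have "\<dots> = ennreal (\<Sum>n. (1/4) ^ n)" by (rule suminf_ennreal2) (auto intro: summable_geometric)
  also have "\<dots> < \<infinity>" by simp
  finally have "(\<integral>\<^sup>+x. (\<Sum>n. ennreal ((cmod (d n x))\<^sup>2)) \<partial>lborel) \<noteq> \<infinity>" by simp
  then have "AE x in lborel. (\<Sum>n. ennreal ((cmod (d n x))\<^sup>2)) \<noteq> \<infinity>"
    by (intro nn_integral_noteq_infinite) measurable
  then show ?thesis
  proof eventually_elim
    case (elim x)
    then have "summable (\<lambda>n. (cmod (d n x))\<^sup>2)" by (intro summable_suminf_not_top) auto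
    then have "(\<lambda>n. (cmod (d n x))\<^sup>2) \<longlonglongrightarrow> 0" by (rule summable_LIMSEQ_zero)
    then have "(\<lambda>n. sqrt ((cmod (d n x))\<^sup>2)) \<longlonglongrightarrow> sqrt 0" by (rule tendsto_real_sqrt)
    then show ?case by (simp add: tendsto_norm_zero_iff)
  qed
qed

text \<open>Both sides are compared with the power of the largest factor. With six factors this
  takes the place of Hoelder's inequality.\<close>

lemma prod_le_sum_power:
  fixes b :: "nat \<Rightarrow> real"
  assumes b: "\<And>k. 0 \<le> b k" and n: "0 < n"
  shows "(\<Prod>k<n. b k) \<le> (\<Sum>k<n. b k ^ n)"
proof -
  let ?m = "Max (b ` {..<n})"
  have "?m \<in> b ` {..<n}" using n by (intro Max_in) auto
  then obtain j where j: "j < n" "?m = b j" by auto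
  have "b k \<le> b j" if "k < n" for k unfolding j(2)[symmetric] using that by (intro Max_ge) auto
  then have "(\<Prod>k<n. b k) \<le> (\<Prod>k<n. b j)" using b by (intro prod_mono) auto
  also have "\<dots> = b j ^ n" by simp
  also have "\<dots> \<le> (\<Sum>k<n. b k ^ n)" using j b by (intro member_le_sum) auto
  finally show ?thesis .
qed

section \<open>Jointly measurable versions of the flow\<close>

context
  fixes U assumes U: "oscillator_propagator U"
begin

lemma propagator_gsum: "AE x in lborel. U t (gsum L 0) x = gsum L t x"
proof (induction L)
  case Nil
  \<comment> \<open>Linearity with both coefficients zero shows that the propagator maps zero to
    zero.\<close>
  have "AE x in lborel. U t (\<lambda>y. 0 * gsum [] 0 y + 0 * gsum [] 0 y) x = 0 * U t (gsum [] 0) x + 0 * U t (gsum [] 0) x"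
    by (rule propagator_linear[OF U gsum_L2 gsum_L2])
  moreover have "gsum [] 0 = (\<lambda>y. 0)" by (rule ext) simp
  ultimately show ?case by simp
next
  case (Cons p L)
  have "AE x in lborel. U t (\<lambda>y. fst p * evol (snd p) 0 y + 1 * gsum L 0 y) x = fst p * U t (evol (snd p) 0) x + 1 * U t (gsum L 0) x"
    by (rule propagator_linear[OF U evol_L2 gsum_L2])
  moreover have "gsum (p # L) 0 = (\<lambda>y. fst p * evol (snd p) 0 y + 1 * gsum L 0 y)" by (rule ext) (simp add: gsum_Cons)
  ultimately have "AE x in lborel. U t (gsum (p # L) 0) x = fst p * U t (evol (snd p) 0) x + U t (gsum L 0) x" by simp
  then show ?case
    using propagator_evol[OF U, of t "snd p"] Cons by eventually_elim (simp add: gsum_Cons[of p L t])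
qed

text \<open>The error of approximation by a sum of packets is the same at every time. Hence
  approximating the initial datum approximates the whole trajectory.\<close>

lemma propagator_square_diff_gsum:
  assumes f: "f \<in> L2"
  shows "l2_square (\<lambda>x. U t f x - gsum L t x) = l2_square (\<lambda>x. f x - gsum L 0 x)"
proof -
  have "l2_square (\<lambda>x. U t f x - gsum L t x) = l2_square (U t (\<lambda>x. f x - gsum L 0 x))"
  proof (rule l2_square_cong_AE)
    show "AE x in lborel. U t f x - gsum L t x = U t (\<lambda>x. f x - gsum L 0 x) x"
      using propagator_gsum[of t L] propagator_diff[OF U f gsum_L2, of t L 0] by eventually_elim simp
  qed (intro L2_measurable L2_diff propagator_L2[OF U] f gsum_L2)+
  also have "\<dots> = l2_square (\<lambda>x. f x - gsum L 0 x)"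
    by (intro propagator_square[OF U] L2_diff f gsum_L2)
  finally show ?thesis .
qed

text \<open>The propagator need not be measurable in both variables, as Fubini's theorem requires.
  A good version is a limit of Gaussian sums; Fatou's lemma carries the estimate over.\<close>

lemma propagator_version:
  assumes f: "f \<in> L2"
  shows "\<exists>V. (\<lambda>(t, x). V t x) \<in> borel_measurable (borel \<Otimes>\<^sub>M borel) \<and>
    (\<forall>t. AE x in lborel. V t x = U t f x) \<and>
    integrable time_space (\<lambda>(t, x). cmod (V t x) ^ 6) \<and>
    (LINT (t, x)|time_space. cmod (V t x) ^ 6) \<le> pi * (2 * l2_square f + 2) ^ 3"
proof -
  have "\<exists>L. l2_square (\<lambda>x. f x - gsum L 0 x) < (1/4) ^ n" for n :: nat
    using l2_close_L2[OF f] unfolding l2_close_def by simp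
  \<comment> \<open>One sequence of lists for all times: the rate is fast enough for almost
    everywhere convergence and is preserved by the propagator.\<close>
  then obtain L where L: "\<And>n. l2_square (\<lambda>x. f x - gsum (L n) 0 x) < (1/4) ^ n" by metis
  define g where "g n p = gsum (L n) (fst p) (snd p)" for n p
  have gm [measurable]: "g n \<in> borel_measurable (borel \<Otimes>\<^sub>M borel)" for n
    using borel_measurable_gsum[of "L n"] by (simp add: g_def[abs_def] case_prod_beta')
  \<comment> \<open>The limit is taken where the sequence is Cauchy, with value 0 elsewhere. That
    keeps \<open>W\<close> measurable in both variables and makes Fatou's inequality trivial at the
    exceptional points.\<close>
  define W where "W p = lim (\<lambda>n. if Cauchy (\<lambda>i. g i p) then g n p else 0)" for p
  have Wm: "W \<in> borel_measurable (borel \<Otimes>\<^sub>M borel)" unfolding W_def by measurable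
  have Wc: "(\<lambda>n. g n p) \<longlonglongrightarrow> W p" if "Cauchy (\<lambda>n. g n p)" for p
    using that by (simp add: W_def Cauchy_convergent_iff convergent_LIMSEQ_iff)
  have W0: "W p = 0" if "\<not> Cauchy (\<lambda>n. g n p)" for p
    using that by (simp add: W_def)
  have eq: "AE x in lborel. W (t, x) = U t f x" for t
  proof -
    have "AE x in lborel. (\<lambda>n. U t f x - gsum (L n) t x) \<longlonglongrightarrow> 0"
    proof (rule AE_tendsto_0_of_l2_square)
      show "(\<lambda>x. U t f x - gsum (L n) t x) \<in> L2" for n by (intro L2_diff propagator_L2[OF U] f gsum_L2)
      show "l2_square (\<lambda>x. U t f x - gsum (L n) t x) \<le> (1/4) ^ n" for n
        unfolding propagator_square_diff_gsum[OF f] using L[of n] by simp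
    qed
    then show ?thesis
    proof eventually_elim
      case (elim x)
      from tendsto_diff[OF tendsto_const[of "U t f x"] elim] have *: "(\<lambda>n. g n (t, x)) \<longlonglongrightarrow> U t f x"
        by (simp add: g_def)
      then have "Cauchy (\<lambda>n. g n (t, x))" by (rule LIMSEQ_imp_Cauchy)
      from Wc[OF this] * show ?case by (rule LIMSEQ_unique)
    qed
  qed
  \<comment> \<open>The approximation errors are below one, so \<open>2 * l2_square f + 2\<close>
    bounds the squared norms of all approximants.\<close>
  let ?C = "pi * (2 * l2_square f + 2) ^ 3"
  have C0: "0 \<le> ?C" by simp
  have gi: "(\<integral>\<^sup>+p. ennreal (cmod (g n p) ^ 6) \<partial>time_space) \<le> ennreal ?C" for n
  proof -
    have s: "integrable time_space (\<lambda>p. cmod (g n p) ^ 6)"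
      "(LINT p|time_space. cmod (g n p) ^ 6) \<le> pi * l2_square (gsum (L n) 0) ^ 3"
      using gsum_strichartz[of "L n"] by (simp_all add: g_def case_prod_beta')
    have "l2_square (gsum (L n) 0) = l2_square (\<lambda>x. f x + (gsum (L n) 0 x - f x))" by simp
    also have "\<dots> \<le> 2 * l2_square f + 2 * l2_square (\<lambda>x. gsum (L n) 0 x - f x)"
      by (intro l2_square_add_le L2_diff f gsum_L2)
    also have "l2_square (\<lambda>x. gsum (L n) 0 x - f x) = l2_square (\<lambda>x. f x - gsum (L n) 0 x)"
      unfolding l2_square_def by (simp add: norm_minus_commute)
    also have "2 * l2_square f + 2 * l2_square (\<lambda>x. f x - gsum (L n) 0 x) \<le> 2 * l2_square f + 2"
    proof -
      have "(1/4) ^ n \<le> (1 :: real)" by (rule power_le_one) auto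
      then show ?thesis using L[of n] by linarith
    qed
    finally have "pi * l2_square (gsum (L n) 0) ^ 3 \<le> ?C" by (intro mult_left_mono power_mono) auto
    with s have "(LINT p|time_space. cmod (g n p) ^ 6) \<le> ?C" by linarith
    then show ?thesis using s(1) by (subst nn_integral_eq_integral) (auto intro: ennreal_leI)
  qed
  have gmt: "(\<lambda>p. ennreal (cmod (g n p) ^ 6)) \<in> borel_measurable time_space" for n
  proof -
    have "(\<lambda>p. ennreal (cmod (g n p) ^ 6)) \<in> borel_measurable (borel \<Otimes>\<^sub>M lborel)" by measurable
    from measurable_slab_pair[where f="\<lambda>p. ennreal (cmod (g n p) ^ 6)", OF this] show ?thesis .
  qed
  have Wmt: "W \<in> borel_measurable time_space"
    using measurable_slab_pair[of W lborel] Wm by (simp cong: measurable_cong_sets)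
  have "(\<integral>\<^sup>+p. ennreal (cmod (W p) ^ 6) \<partial>time_space) \<le> (\<integral>\<^sup>+p. liminf (\<lambda>n. ennreal (cmod (g n p) ^ 6)) \<partial>time_space)"
  proof (rule nn_integral_mono)
    fix p
    show "ennreal (cmod (W p) ^ 6) \<le> liminf (\<lambda>n. ennreal (cmod (g n p) ^ 6))"
    proof (cases "Cauchy (\<lambda>n. g n p)")
      case True
      have "(\<lambda>n. ennreal (cmod (g n p) ^ 6)) \<longlonglongrightarrow> ennreal (cmod (W p) ^ 6)"
        by (intro tendsto_ennrealI tendsto_power tendsto_norm Wc True)
      from lim_imp_Liminf[OF sequentially_bot this] show ?thesis by (simp only: order_refl)
    qed (simp add: W0)
  qed
  also have "\<dots> \<le> liminf (\<lambda>n. \<integral>\<^sup>+p. ennreal (cmod (g n p) ^ 6) \<partial>time_space)"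
    by (rule nn_integral_liminf) (rule gmt)
  also have "\<dots> \<le> ennreal ?C"
    using Liminf_bounded Liminf_le[of sequentially] gi by (simp add: Liminf_le always_eventually)
  finally have Wn: "(\<integral>\<^sup>+p. ennreal (cmod (W p) ^ 6) \<partial>time_space) \<le> ennreal ?C" .
  have Wi: "integrable time_space (\<lambda>p. cmod (W p) ^ 6)"
  proof (rule integrableI_bounded)
    show "(\<lambda>p. cmod (W p) ^ 6) \<in> borel_measurable time_space" using Wmt by measurable
    have "(\<integral>\<^sup>+p. ennreal (norm (cmod (W p) ^ 6)) \<partial>time_space) \<le> ennreal ?C" using Wn by simp
    also have "\<dots> < \<infinity>" by simp
    finally show "(\<integral>\<^sup>+p. ennreal (norm (cmod (W p) ^ 6)) \<partial>time_space) < \<infinity>" .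
  qed
  have "ennreal (LINT p|time_space. cmod (W p) ^ 6) \<le> ennreal ?C"
    using Wn nn_integral_eq_integral[OF Wi] by simp
  then have "(LINT p|time_space. cmod (W p) ^ 6) \<le> ?C" by (simp add: ennreal_le_iff[OF C0])
  then show ?thesis
    using Wm Wi eq by (intro exI[of _ "\<lambda>t x. W (t, x)"]) (simp add: case_prod_beta')
qed

definition version :: "(real \<Rightarrow> complex) \<Rightarrow> real \<Rightarrow> real \<Rightarrow> complex" where
  "version f = (SOME V. (\<lambda>(t, x). V t x) \<in> borel_measurable (borel \<Otimes>\<^sub>M borel) \<and>
    (\<forall>t. AE x in lborel. V t x = U t f x) \<and>
    integrable time_space (\<lambda>(t, x). cmod (V t x) ^ 6) \<and>
    (LINT (t, x)|time_space. cmod (V t x) ^ 6) \<le> pi * (2 * l2_square f + 2) ^ 3)"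

lemma version:
  assumes "f \<in> L2"
  shows borel_measurable_version: "(\<lambda>p. version f (fst p) (snd p)) \<in> borel_measurable (borel \<Otimes>\<^sub>M borel)"
    and version_eq: "AE x in lborel. version f t x = U t f x"
    and integrable_version: "integrable time_space (\<lambda>p. cmod (version f (fst p) (snd p)) ^ 6)"
    and integral_version_le: "(LINT p|time_space. cmod (version f (fst p) (snd p)) ^ 6) \<le> pi * (2 * l2_square f + 2) ^ 3"
  using someI_ex[OF propagator_version[OF assms], folded version_def] by (auto simp: case_prod_beta')

lemma borel_measurable_version_time:
  "f \<in> L2 \<Longrightarrow> (\<lambda>p. version f (fst p) (snd p)) \<in> borel_measurable time_space"
  using measurable_slab_pair[of "\<lambda>p. version f (fst p) (snd p)" lborel] borel_measurable_version[of f]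
  by (simp cong: measurable_cong_sets)

text \<open>The product of six factors is dominated by the sum of their sixth powers, each of which
  is integrable by the Strichartz estimate.\<close>

lemma integrable_six_version:
  assumes F: "\<And>k. k < 6 \<Longrightarrow> F k \<in> L2"
  shows "integrable time_space (\<lambda>p. six (\<lambda>k. version (F k) (fst p) (snd p)))" (is ?A)
    and "cmod (integral\<^sup>L time_space (\<lambda>p. six (\<lambda>k. version (F k) (fst p) (snd p))))
      \<le> (\<Sum>k<6. pi * (2 * l2_square (F k) + 2) ^ 3)" (is ?B)
proof -
  let ?s = "\<lambda>p. \<Sum>k<6. cmod (version (F k) (fst p) (snd p)) ^ 6"
  have s: "integrable time_space ?s"
    by (intro Bochner_Integration.integrable_sum integrable_version F) simp
  have le: "cmod (six (\<lambda>k. version (F k) (fst p) (snd p))) \<le> ?s p" for p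
    unfolding norm_six by (rule prod_le_sum_power) auto
  show A: ?A
  proof (rule Bochner_Integration.integrable_bound[OF s])
    show "(\<lambda>p. six (\<lambda>k. version (F k) (fst p) (snd p))) \<in> borel_measurable time_space"
      by (rule borel_measurable_six) (intro borel_measurable_version_time F)
    show "AE p in time_space. cmod (six (\<lambda>k. version (F k) (fst p) (snd p))) \<le> norm (?s p)"
      by (intro AE_I2 order_trans[OF le]) simp
  qed
  have "cmod (integral\<^sup>L time_space (\<lambda>p. six (\<lambda>k. version (F k) (fst p) (snd p))))
      \<le> (LINT p|time_space. cmod (six (\<lambda>k. version (F k) (fst p) (snd p))))"
    by (rule integral_norm_bound)
  also have "\<dots> \<le> integral\<^sup>L time_space ?s"
    by (rule integral_mono[OF integrable_norm[OF A] s le])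
  also have "\<dots> = (\<Sum>k<6. LINT p|time_space. cmod (version (F k) (fst p) (snd p)) ^ 6)"
    by (intro Bochner_Integration.integral_sum integrable_version F) simp
  also have "\<dots> \<le> (\<Sum>k<6. pi * (2 * l2_square (F k) + 2) ^ 3)"
    by (intro sum_mono integral_version_le F) simp
  finally show ?B .
qed

definition time_form :: "(nat \<Rightarrow> real \<Rightarrow> complex) \<Rightarrow> complex" where
  "time_form F = of_real (2 / pi) * integral\<^sup>L time_space (\<lambda>p. six (\<lambda>k. version (F k) (fst p) (snd p)))"

text \<open>Agreement almost everywhere on each slice passes to the product because the set of
  agreement is jointly measurable.\<close>

lemma AE_time_space:
  assumes f: "f \<in> borel_measurable (borel \<Otimes>\<^sub>M borel)" and g: "g \<in> borel_measurable (borel \<Otimes>\<^sub>M borel)"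
    and eq: "\<And>t. AE x in lborel. f (t, x) = (g (t, x) :: complex)"
  shows "AE p in time_space. f p = g p"
proof (rule pair_sigma_finite.AE_pair_measure[OF pair_sigma_finite_slab_lborel])
  have [measurable]: "f \<in> borel_measurable time_space" "g \<in> borel_measurable time_space"
    using measurable_slab_pair[of f lborel] measurable_slab_pair[of g lborel] f g by (simp_all cong: measurable_cong_sets)
  show "{p \<in> space time_space. f p = g p} \<in> sets time_space" by measurable
qed (use eq in auto)

text \<open>Versions are chosen for each function separately, so linearity is inherited from the
  propagator only off a null set of the product.\<close>

lemma version_linear:
  assumes f: "f \<in> L2" and g: "g \<in> L2"
  shows "AE p in time_space. version (\<lambda>x. a * f x + b * g x) (fst p) (snd p) =
    a * version f (fst p) (snd p) + b * version g (fst p) (snd p)"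
proof (rule AE_time_space)
  have fg: "(\<lambda>x. a * f x + b * g x) \<in> L2" by (intro L2_add L2_scale f g)
  show "(\<lambda>p. version (\<lambda>x. a * f x + b * g x) (fst p) (snd p)) \<in> borel_measurable (borel \<Otimes>\<^sub>M borel)"
    by (rule borel_measurable_version[OF fg])
  show "(\<lambda>p. a * version f (fst p) (snd p) + b * version g (fst p) (snd p)) \<in> borel_measurable (borel \<Otimes>\<^sub>M borel)"
    by (intro borel_measurable_add borel_measurable_times borel_measurable_const borel_measurable_version f g)
  fix t
  show "AE x in lborel. version (\<lambda>x. a * f x + b * g x) (fst (t, x)) (snd (t, x)) =
      a * version f (fst (t, x)) (snd (t, x)) + b * version g (fst (t, x)) (snd (t, x))"
    using version_eq[OF fg, of t] version_eq[OF f, of t] version_eq[OF g, of t] propagator_linear[OF U f g, of t a b]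
    by eventually_elim simp
qed

lemma time_form_slot:
  assumes k: "k < 6" and F: "\<And>j. j < 6 \<Longrightarrow> F j \<in> L2" and f: "f \<in> L2" and g: "g \<in> L2"
  shows "time_form (F(k := \<lambda>x. of_real r * f x + of_real s * g x)) =
    of_real r * time_form (F(k := f)) + of_real s * time_form (F(k := g))"
proof -
  let ?v = "\<lambda>h p. version h (fst p) (snd p)"
  let ?h = "\<lambda>x. of_real r * f x + of_real s * g x"
  have h: "?h \<in> L2" by (intro L2_add L2_scale f g)
  have eq: "(\<lambda>p. six (\<lambda>j. ?v ((F(k := h)) j) p)) = (\<lambda>p. six ((\<lambda>j. ?v (F j) p)(k := ?v h p)))" for h
    by (auto simp: fun_eq_iff intro!: six_cong)
  have m: "(\<lambda>p. six (\<lambda>j. ?v ((F(k := h)) j) p)) \<in> borel_measurable time_space" if "h \<in> L2" for h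
    by (rule borel_measurable_six, rule borel_measurable_version_time) (use F that in auto)
  have i: "has_bochner_integral time_space (\<lambda>p. six (\<lambda>j. ?v ((F(k := h)) j) p))
      (integral\<^sup>L time_space (\<lambda>p. six (\<lambda>j. ?v ((F(k := h)) j) p)))" if "h \<in> L2" for h
    by (rule has_bochner_integral_integrable, rule integrable_six_version) (use F that in auto)
  note S = has_bochner_integral_six_slot[OF k i[OF f, unfolded eq] i[OF g, unfolded eq], of r s]
  have "integral\<^sup>L time_space (\<lambda>p. six (\<lambda>j. ?v ((F(k := ?h)) j) p)) =
     integral\<^sup>L time_space (\<lambda>p. six ((\<lambda>j. ?v (F j) p)(k := of_real r * ?v f p + of_real s * ?v g p)))"
  proof (rule integral_cong_AE)
    show "(\<lambda>p. six (\<lambda>j. ?v ((F(k := ?h)) j) p)) \<in> borel_measurable time_space" by (rule m[OF h])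
    show "(\<lambda>p. six ((\<lambda>j. ?v (F j) p)(k := of_real r * ?v f p + of_real s * ?v g p))) \<in> borel_measurable time_space"
      using S by (simp add: has_bochner_integral_iff borel_measurable_integrable)
    show "AE p in time_space. six (\<lambda>j. ?v ((F(k := ?h)) j) p) =
        six ((\<lambda>j. ?v (F j) p)(k := of_real r * ?v f p + of_real s * ?v g p))"
      using version_linear[OF f g, of "of_real r" "of_real s"]
      by eventually_elim (rule six_cong, simp)
  qed
  also have "\<dots> = of_real r * integral\<^sup>L time_space (\<lambda>p. six (\<lambda>j. ?v ((F(k := f)) j) p)) +
      of_real s * integral\<^sup>L time_space (\<lambda>p. six (\<lambda>j. ?v ((F(k := g)) j) p))"
    using S unfolding eq by (simp add: has_bochner_integral_iff)
  finally show ?thesis unfolding time_form_def by (simp add: algebra_simps)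
qed

lemma time_form_gsum: "time_form (\<lambda>k. gsum (L k) 0) = rot_form (\<lambda>k. gsum (L k) 0)"
proof -
  have v: "AE p in time_space. version (gsum (L k) 0) (fst p) (snd p) = gsum (L k) (fst p) (snd p)" for k
  proof (rule AE_time_space)
    show "(\<lambda>p. gsum (L k) (fst p) (snd p)) \<in> borel_measurable (borel \<Otimes>\<^sub>M borel)"
      using borel_measurable_gsum[of "L k"] by (simp add: case_prod_beta')
    fix t
    show "AE x in lborel. version (gsum (L k) 0) (fst (t, x)) (snd (t, x)) = gsum (L k) (fst (t, x)) (snd (t, x))"
      using version_eq[OF gsum_L2[of "L k" 0], of t] propagator_gsum[of t "L k"] by eventually_elim simp
  qed (rule borel_measurable_version[OF gsum_L2])
  have "time_form (\<lambda>k. gsum (L k) 0) = gsum_form L"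
    unfolding time_form_def gsum_form_def case_prod_beta'
  proof (intro arg_cong2[where f="(*)"] refl integral_cong_AE)
    show "(\<lambda>p. six (\<lambda>k. version (gsum (L k) 0) (fst p) (snd p))) \<in> borel_measurable time_space"
      by (rule borel_measurable_six, rule borel_measurable_version_time, rule gsum_L2)
    show "(\<lambda>p. six (\<lambda>k. gsum (L k) (fst p) (snd p))) \<in> borel_measurable time_space"
      using integrable_six_gsum[of L] by (simp add: case_prod_beta' borel_measurable_integrable)
    have "AE p in time_space. \<forall>k. version (gsum (L k) 0) (fst p) (snd p) = gsum (L k) (fst p) (snd p)"
      unfolding AE_all_countable using v by blast
    then show "AE p in time_space. six (\<lambda>k. version (gsum (L k) 0) (fst p) (snd p)) = six (\<lambda>k. gsum (L k) (fst p) (snd p))"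
      by eventually_elim simp
  qed
  then show ?thesis unfolding gsum_identity .
qed

text \<open>Six summands times \<open>pi\<close> times the prefactor \<open>2 / pi\<close> give the
  constant 12. Only finiteness on bounded sets matters here.\<close>

lemma forms_bounded:
  assumes G: "\<And>k. k < 6 \<Longrightarrow> G k \<in> L2" and B: "\<And>k. k < 6 \<Longrightarrow> l2_square (G k) \<le> B"
  shows "cmod (time_form G - rot_form G) \<le> 12 * (2 * B + 2) ^ 3 + 2 * B ^ 3"
proof -
  have B0: "0 \<le> B" using order_trans[OF l2_square_nonneg B[of 0]] by simp
  have "cmod (time_form G) \<le> 2 / pi * (\<Sum>k<6. pi * (2 * l2_square (G k) + 2) ^ 3)"
    unfolding time_form_def norm_mult norm_of_real
    by (intro mult_mono integrable_six_version G) auto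
  also have "\<dots> \<le> 2 / pi * (\<Sum>k<(6::nat). pi * (2 * B + 2) ^ 3)"
    by (intro mult_left_mono sum_mono power_mono add_mono B) auto
  also have "\<dots> = 12 * (2 * B + 2) ^ 3" by simp
  finally have 1: "cmod (time_form G) \<le> 12 * (2 * B + 2) ^ 3" .
  have "cmod (rot_form G) \<le> prod_bound G" by (rule norm_rot_form_le[OF G])
  also have "\<dots> \<le> B * (B * B) + B * (B * B)"
    unfolding prod_bound_def by (intro add_mono mult_mono mult_nonneg_nonneg B B0 l2_square_nonneg) auto
  also have "\<dots> = 2 * B ^ 3" by (simp add: power3_eq_cube)
  finally show ?thesis using 1 norm_triangle_ineq4[of "time_form G" "rot_form G"] by linarith
qed

lemma time_form_eq_rot_form:
  assumes "\<And>k. k < 6 \<Longrightarrow> F k \<in> L2"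
  shows "time_form F = rot_form F"
proof (rule slot_induct[where n=6 and A="range (\<lambda>L. gsum L 0)" and B=L2 and Z="\<lambda>F. time_form F = rot_form F"])
  show "range (\<lambda>L. gsum L 0) \<subseteq> L2" using gsum_L2 by auto
  fix F :: "nat \<Rightarrow> real \<Rightarrow> complex"
  assume "\<And>k. k < 6 \<Longrightarrow> F k \<in> range (\<lambda>L. gsum L 0)"
  then have "\<forall>k. \<exists>L. k < 6 \<longrightarrow> F k = gsum L 0" by blast
  then obtain L where L: "\<And>k. k < 6 \<Longrightarrow> F k = gsum (L k) 0" by metis
  have "time_form F = time_form (\<lambda>k. gsum (L k) 0)"
    unfolding time_form_def by (simp add: L cong: six_cong)
  moreover have "rot_form F = rot_form (\<lambda>k. gsum (L k) 0)"
    unfolding rot_form_def rot_integrand_def by (simp add: L cong: six_cong)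
  ultimately show "time_form F = rot_form F" using time_form_gsum by simp
next
  fix k :: nat and F :: "nat \<Rightarrow> real \<Rightarrow> complex" and q
  assume k: "k < 6" and F: "\<And>j. j < 6 \<Longrightarrow> F j \<in> L2" and q: "q \<in> L2"
    and IH: "\<And>p. p \<in> range (\<lambda>L. gsum L 0) \<Longrightarrow> time_form (F(k := p)) = rot_form (F(k := p))"
  \<comment> \<open>The summand 1 makes room for the normalised error \<open>w\<close>, and the sum
    bounds every other slot.\<close>
  define B where "B = 1 + (\<Sum>j<6. l2_square (F j))"
  define C where "C = 12 * (2 * B + 2) ^ 3 + 2 * B ^ 3"
  let ?X = "\<lambda>f. time_form (F(k := f)) - rot_form (F(k := f))"
  have B: "l2_square (F j) \<le> B" if "j < 6" for j
    using member_le_sum[of j "{..<6}" "\<lambda>j. l2_square (F j)"] that by (simp add: B_def)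
  have B1: "1 \<le> B" by (simp add: B_def sum_nonneg)
  have small: "cmod (?X q) \<le> \<delta> * C" if \<delta>: "0 < \<delta>" for \<delta>
  proof -
    have "0 < \<delta>\<^sup>2" using \<delta> by simp
    then obtain L where L: "l2_square (\<lambda>x. q x - gsum L 0 x) < \<delta>\<^sup>2"
      using l2_close_L2[OF q] unfolding l2_close_def by blast
    \<comment> \<open>Dividing the error by \<open>\<delta>\<close> normalises it. Real linearity in
      the slot then puts the factor \<open>\<delta>\<close> in front of a bounded quantity, which
      turns the inhomogeneous bound into smallness.\<close>
    define w where "w x = of_real (1 / \<delta>) * (q x - gsum L 0 x)" for x
    have w: "w \<in> L2" unfolding w_def[abs_def] by (intro L2_scale L2_diff q gsum_L2)
    have "l2_square w = (1 / \<delta>)\<^sup>2 * l2_square (\<lambda>x. q x - gsum L 0 x)"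
      unfolding w_def[abs_def] l2_square_scale by (simp add: norm_divide power_divide)
    also have "\<dots> \<le> (1 / \<delta>)\<^sup>2 * \<delta>\<^sup>2" using L by (intro mult_left_mono) auto
    also have "\<dots> = 1" using \<delta> by (simp add: power_divide)
    finally have w1: "l2_square w \<le> 1" .
    have qe: "q = (\<lambda>x. of_real 1 * gsum L 0 x + of_real \<delta> * w x)"
      using \<delta> by (auto simp: w_def fun_eq_iff)
    have "time_form (F(k := q)) = of_real 1 * time_form (F(k := gsum L 0)) + of_real \<delta> * time_form (F(k := w))"
      by (subst qe, rule time_form_slot[OF k _ gsum_L2 w], rule F)
    moreover have "rot_form (F(k := q)) = of_real 1 * rot_form (F(k := gsum L 0)) + of_real \<delta> * rot_form (F(k := w))"
      by (subst qe, rule rot_form_slot[OF k _ gsum_L2 w], rule F)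
    ultimately have "?X q = of_real 1 * ?X (gsum L 0) + of_real \<delta> * ?X w"
      by (simp add: algebra_simps)
    also have "?X (gsum L 0) = 0" using IH by simp
    finally have e: "?X q = of_real 1 * 0 + of_real \<delta> * ?X w" .
    have "cmod (?X q) = \<delta> * cmod (?X w)"
      unfolding e using \<delta> by (simp only: mult_zero_right add_0_left norm_mult norm_of_real abs_of_pos)
    also have "cmod (?X w) \<le> C"
      unfolding C_def by (rule forms_bounded) (use F w B w1 B1 in auto)
    finally show ?thesis using \<delta> by simp
  qed
  have "cmod (?X q) \<le> 0"
  proof (rule field_le_epsilon)
    fix e :: real assume e: "0 < e"
    have C0: "0 \<le> C" using B1 by (simp add: C_def)
    have "cmod (?X q) \<le> e / (C + 1) * C" using e C0 by (intro small) simp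
    also have "\<dots> \<le> e" using e C0 by (simp add: field_simps)
    finally show "cmod (?X q) \<le> 0 + e" by simp
  qed
  then show "time_form (F(k := q)) = rot_form (F(k := q))" by simp
qed (use assms in auto)

text \<open>The passage back from versions to the propagator itself: at each fixed time they agree
  almost everywhere in x, so the inner integrals coincide exactly for every
  \<open>t\<close>.\<close>

lemma sextic_form_eq:
  assumes F: "\<And>k. k < 6 \<Longrightarrow> F k \<in> L2"
  shows "AE t in slab (- pi / 4) (pi / 4). integrable lborel (sextic_integrand U (F 0) (F 1) (F 2) (F 3) (F 4) (F 5) t)"
    and "integrable (slab (- pi / 4) (pi / 4)) (\<lambda>t. LINT x|lborel. sextic_integrand U (F 0) (F 1) (F 2) (F 3) (F 4) (F 5) t x)"
    and "sextic_form U (F 0) (F 1) (F 2) (F 3) (F 4) (F 5) = rot_form F"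
proof -
  let ?s = "sextic_integrand U (F 0) (F 1) (F 2) (F 3) (F 4) (F 5)"
  let ?v = "\<lambda>t x. six (\<lambda>k. version (F k) t x)"
  have m: "?s t \<in> borel_measurable lborel" "?v t \<in> borel_measurable lborel" for t
  proof -
    have [measurable]: "U t (F k) \<in> borel_measurable borel" if "k < 6" for k
      using F[OF that] by (intro L2_measurable propagator_L2[OF U])
    show "?s t \<in> borel_measurable lborel" unfolding sextic_integrand_def[abs_def] by measurable
    show "?v t \<in> borel_measurable lborel"
      using measurable_compose[OF _ borel_measurable_version[OF F], of "\<lambda>x. (t, x)" borel]
      by (intro borel_measurable_six) simp
  qed
  have eq: "AE x in lborel. ?v t x = ?s t x" for t
  proof -
    have "AE x in lborel. \<forall>k\<in>{..<6}. version (F k) t x = U t (F k) x"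
      using version_eq[OF F] by (intro AE_finite_allI) auto
    then show ?thesis
      by eventually_elim (simp add: six_def sextic_integrand_def)
  qed
  have i: "integrable time_space (\<lambda>p. six (\<lambda>k. version (F k) (fst p) (snd p)))"
    by (rule integrable_six_version) (rule F)
  interpret pair_sigma_finite "slab (- pi / 4) (pi / 4)" "lborel :: real measure" by (rule pair_sigma_finite_slab_lborel)
  have ii: "(LINT x|lborel. ?v t x) = (LINT x|lborel. ?s t x)" for t
    by (rule integral_cong_AE) (use m eq in auto)
  show "AE t in slab (- pi / 4) (pi / 4). integrable lborel (?s t)"
    using AE_integrable_fst'[OF i]
  proof eventually_elim
    case (elim t)
    then show ?case using integrable_cong_AE[OF m(2) m(1) eq, of t] by simp
  qed
  show "integrable (slab (- pi / 4) (pi / 4)) (\<lambda>t. LINT x|lborel. ?s t x)"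
    using integrable_fst'[OF i] by (simp add: ii)
  have "sextic_form U (F 0) (F 1) (F 2) (F 3) (F 4) (F 5) = time_form F"
    unfolding sextic_form_def time_form_def set_integral_slab
    using integral_fst'[OF i] by (simp add: ii)
  then show "sextic_form U (F 0) (F 1) (F 2) (F 3) (F 4) (F 5) = rot_form F"
    by (simp add: time_form_eq_rot_form F)
qed

end

section \<open>The operators\<close>

text \<open>The third coordinate, the argument of the test function, comes first, so that Fubini's
  theorem leaves it as the outer variable.\<close>

definition vec3_last :: "real \<times> real \<times> real \<Rightarrow> real^3" where
  "vec3_last = (\<lambda>(y, x1, x2). vec3 (x1, x2, y))"

lemma vec3_last_nth [simp]: "vec3_last (y, p) $ 1 = fst p" "vec3_last (y, p) $ 2 = snd p" "vec3_last (y, p) $ 3 = y"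
  by (simp_all add: vec3_last_def case_prod_beta)

lemma borel_measurable_vec3_last [measurable]: "vec3_last \<in> borel_measurable (lborel \<Otimes>\<^sub>M (lborel \<Otimes>\<^sub>M lborel))"
  unfolding vec3_last_def vec3_def by measurable

text \<open>A cyclic permutation of the coordinates is orthogonal and hence preserves Lebesgue
  measure.\<close>

lemma lborel_vec3_last: "(lborel :: (real^3) measure) = distr (lborel \<Otimes>\<^sub>M (lborel \<Otimes>\<^sub>M lborel)) borel vec3_last"
proof -
  define A where "A x = vec3 (x $ 2, x $ 3, x $ 1)" for x :: "real^3"
  have A: "orthogonal_transformation A"
    unfolding orthogonal_transformation
  proof (intro conjI allI)
    show "linear A" by (rule linearI) (simp_all add: A_def vec_eq_iff forall_3)
    show "norm (A v) = norm v" for v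
      by (simp add: norm_vec_def L2_set_def sum_3 A_def add_ac)
  qed
  have Am: "A \<in> borel_measurable borel"
    by (rule borel_measurable_orthogonal_transformation[OF A])
  have "A \<circ> vec3 = vec3_last" by (auto simp: A_def vec3_last_def fun_eq_iff)
  then have "distr (distr (lborel \<Otimes>\<^sub>M (lborel \<Otimes>\<^sub>M lborel)) borel vec3) borel A =
      distr (lborel \<Otimes>\<^sub>M (lborel \<Otimes>\<^sub>M lborel)) borel vec3_last"
    by (subst distr_distr[OF Am borel_measurable_vec3]) simp
  then show ?thesis
    unfolding lborel_vec3[symmetric] distr_orthogonal_transformation[OF A] .
qed

lemma integrable_vec3_last:
  fixes f :: "real^3 \<Rightarrow> 'b::{banach, second_countable_topology}"
  assumes f: "integrable lborel f"
  shows "integrable (lborel \<Otimes>\<^sub>M (lborel \<Otimes>\<^sub>M lborel)) (\<lambda>p. f (vec3_last p))"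
    and "integral\<^sup>L (lborel \<Otimes>\<^sub>M (lborel \<Otimes>\<^sub>M lborel)) (\<lambda>p. f (vec3_last p)) = integral\<^sup>L lborel f"
proof -
  have fm: "f \<in> borel_measurable borel" using f by (auto dest: borel_measurable_integrable)
  have "integrable (distr (lborel \<Otimes>\<^sub>M (lborel \<Otimes>\<^sub>M lborel)) borel vec3_last) f"
    using f unfolding lborel_vec3_last[symmetric] .
  then show "integrable (lborel \<Otimes>\<^sub>M (lborel \<Otimes>\<^sub>M lborel)) (\<lambda>p. f (vec3_last p))"
    by (subst (asm) integrable_distr_eq[OF borel_measurable_vec3_last fm])
  show "integral\<^sup>L (lborel \<Otimes>\<^sub>M (lborel \<Otimes>\<^sub>M lborel)) (\<lambda>p. f (vec3_last p)) = integral\<^sup>L lborel f"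
    using integral_distr[OF borel_measurable_vec3_last fm] unfolding lborel_vec3_last[symmetric] by simp
qed

text \<open>Cauchy-Schwarz on each slice. It is applied to the plane of the first two coordinates to
  bound the kernel, and to the interval of angles with \<open>b = 1\<close> to bound its
  average.\<close>

lemma L2_integral_slices:
  fixes a :: "real \<times> 'p \<Rightarrow> complex" and b :: "'p \<Rightarrow> complex"
  assumes M: "sigma_finite_measure M" and am: "a \<in> borel_measurable (lborel \<Otimes>\<^sub>M M)"
    and bm: "b \<in> borel_measurable M"
    and a: "integrable (lborel \<Otimes>\<^sub>M M) (\<lambda>p. (cmod (a p))\<^sup>2)" and b: "integrable M (\<lambda>p. (cmod (b p))\<^sup>2)"
  shows "(\<lambda>y. LINT p|M. a (y, p) * b p) \<in> L2" (is "?h \<in> L2")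
    and "l2_square (\<lambda>y. LINT p|M. a (y, p) * b p) \<le>
      (LINT p|(lborel \<Otimes>\<^sub>M M). (cmod (a p))\<^sup>2) * (LINT p|M. (cmod (b p))\<^sup>2)"
proof -
  interpret sigma_finite_measure M by (rule M)
  interpret P: pair_sigma_finite "lborel :: real measure" M
    by (intro pair_sigma_finite.intro lborel.sigma_finite_measure_axioms M)
  note [measurable] = am bm
  have hm: "?h \<in> borel_measurable borel"
  proof -
    have "(\<lambda>y. LINT p|M. a (y, p) * b p) \<in> borel_measurable lborel"
      by (rule borel_measurable_lebesgue_integral) measurable
    then show ?thesis by simp
  qed
  let ?A = "\<lambda>y. LINT p|M. (cmod (a (y, p)))\<^sup>2" and ?B = "LINT p|M. (cmod (b p))\<^sup>2"
  have Ai: "integrable lborel ?A" using P.integrable_fst'[OF a] by simp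
  have le: "AE y in lborel. (cmod (?h y))\<^sup>2 \<le> ?A y * ?B"
    using P.AE_integrable_fst'[OF a]
  proof eventually_elim
    case (elim y)
    have [measurable]: "(\<lambda>p. a (y, p)) \<in> borel_measurable M" by measurable
    have "cmod (?h y) \<le> (LINT p|M. cmod (a (y, p)) * cmod (b p))"
      using integral_norm_bound[of M "\<lambda>p. a (y, p) * b p"] by (simp add: norm_mult)
    then have "(cmod (?h y))\<^sup>2 \<le> (LINT p|M. cmod (a (y, p)) * cmod (b p))\<^sup>2" by (rule power_mono) simp
    also have "\<dots> \<le> ?A y * ?B"
      by (rule Cauchy_Schwarz_integral) (use elim b in auto)
    finally show ?case .
  qed
  have hi: "integrable lborel (\<lambda>y. (cmod (?h y))\<^sup>2)"
  proof (rule Bochner_Integration.integrable_bound[of _ "\<lambda>y. ?A y * ?B"])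
    show "AE y in lborel. norm ((cmod (?h y))\<^sup>2) \<le> norm (?A y * ?B)"
      using le by eventually_elim simp
  qed (use Ai hm in auto)
  then show "?h \<in> L2" using hm unfolding L2_def by simp
  have "l2_square ?h \<le> (LINT y|lborel. ?A y * ?B)"
    unfolding l2_square_def by (rule integral_mono_AE[OF hi _ le]) (use Ai in simp)
  also have "\<dots> = (LINT p|(lborel \<Otimes>\<^sub>M M). (cmod (a p))\<^sup>2) * ?B"
    using P.integral_fst'[OF a] by simp
  finally show "l2_square ?h \<le> (LINT p|(lborel \<Otimes>\<^sub>M M). (cmod (a p))\<^sup>2) * ?B" .
qed

lemma represents_riesz_vector: "represents h F \<Longrightarrow> represents (riesz_vector F) F"
  unfolding riesz_vector_def by (rule someI[of "\<lambda>h. represents h F"])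

lemma sigma_finite_lborel2: "sigma_finite_measure (lborel \<Otimes>\<^sub>M lborel :: (real \<times> real) measure)"
  by (rule lborel_pair.sigma_finite_measure_axioms[unfolded lborel_prod[symmetric]])

abbreviation kern_space :: "(real \<times> real) measure" where
  "kern_space \<equiv> lborel \<Otimes>\<^sub>M slab 0 (2 * pi)"

lemma pair_sigma_finite_kern_space: "pair_sigma_finite (lborel :: real measure) (slab 0 (2 * pi))"
  by (intro pair_sigma_finite.intro lborel.sigma_finite_measure_axioms finite_measure.axioms(1)[OF finite_measure_slab])

lemma measurable_kern_space:
  assumes "(\<lambda>(\<theta>, y). f \<theta> y) \<in> borel_measurable (lborel \<Otimes>\<^sub>M lborel)"
  shows "(\<lambda>p. f (snd p) (fst p)) \<in> borel_measurable kern_space"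
proof -
  have "(\<lambda>p. (snd p, fst p)) \<in> kern_space \<rightarrow>\<^sub>M lborel \<Otimes>\<^sub>M lborel"
  proof (rule measurable_Pair)
    have "(\<lambda>x. x) \<in> slab 0 (2 * pi) \<rightarrow>\<^sub>M lborel" by (rule measurable_restrict_space1) simp
    from measurable_compose[OF measurable_snd this] show "snd \<in> kern_space \<rightarrow>\<^sub>M lborel" .
  qed simp
  from measurable_compose[OF this assms] show ?thesis by simp
qed

section \<open>The kernel of the operators\<close>

context
  fixes f1 f2 f3 f4 f5 :: "real \<Rightarrow> complex"
  assumes L: "f1 \<in> L2" "f2 \<in> L2" "f3 \<in> L2" "f4 \<in> L2" "f5 \<in> L2"
begin

text \<open>An explicit candidate for the operator of the rotation by \<open>\<theta>\<close>.
  Unlike a representative chosen for each angle by duality, it is jointly measurable in the angle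
  and the point.\<close>

definition kern :: "real \<Rightarrow> real \<Rightarrow> complex" where
  "kern \<theta> y = (LINT p|(lborel \<Otimes>\<^sub>M lborel). tri f1 f2 f3 (diagonal_rotation \<theta> (vec3_last (y, p))) * cnj (f4 (fst p) * f5 (snd p)))"

definition kern_bound :: real where
  "kern_bound = l2_square f1 * (l2_square f2 * l2_square f3) * (l2_square f4 * l2_square f5)"

lemma measurable_L: "f1 \<in> borel_measurable borel" "f2 \<in> borel_measurable borel" "f3 \<in> borel_measurable borel"
  "f4 \<in> borel_measurable borel" "f5 \<in> borel_measurable borel"
  by (intro L2_measurable L)+

lemma borel_measurable_kern: "(\<lambda>(\<theta>, y). kern \<theta> y) \<in> borel_measurable (borel \<Otimes>\<^sub>M borel)"
proof -
  note [measurable] = measurable_L borel_measurable_tri[OF L(1-3)]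
  have [measurable]: "(\<lambda>q. diagonal_rotation (fst (fst q)) (vec3_last (snd (fst q), snd q)))
      \<in> borel_measurable ((borel \<Otimes>\<^sub>M borel) \<Otimes>\<^sub>M (lborel \<Otimes>\<^sub>M lborel))"
  proof -
    have v: "(\<lambda>q. (fst (fst q), vec3_last (snd (fst q), snd q)))
      \<in> ((borel \<Otimes>\<^sub>M borel) \<Otimes>\<^sub>M (lborel \<Otimes>\<^sub>M lborel)) \<rightarrow>\<^sub>M (borel \<Otimes>\<^sub>M borel)"
    proof (rule measurable_Pair)
      have "(\<lambda>q. (snd (fst q), snd q)) \<in> ((borel \<Otimes>\<^sub>M borel) \<Otimes>\<^sub>M (lborel \<Otimes>\<^sub>M lborel)) \<rightarrow>\<^sub>M (lborel \<Otimes>\<^sub>M (lborel \<Otimes>\<^sub>M lborel))"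
        by measurable
      from measurable_compose[OF this borel_measurable_vec3_last]
      show "(\<lambda>q. vec3_last (snd (fst q), snd q)) \<in> borel_measurable ((borel \<Otimes>\<^sub>M borel) \<Otimes>\<^sub>M (lborel \<Otimes>\<^sub>M lborel))" .
    qed measurable
    from measurable_compose[OF v borel_measurable_diagonal_rotation] show ?thesis by simp
  qed
  have [measurable]: "(\<lambda>q. tri f1 f2 f3 (diagonal_rotation (fst (fst q)) (vec3_last (snd (fst q), snd q))))
      \<in> borel_measurable ((borel \<Otimes>\<^sub>M borel) \<Otimes>\<^sub>M (lborel \<Otimes>\<^sub>M lborel))"
    by measurable
  have "(\<lambda>z. LINT p|(lborel \<Otimes>\<^sub>M lborel). tri f1 f2 f3 (diagonal_rotation (fst z) (vec3_last (snd z, p))) * cnj (f4 (fst p) * f5 (snd p)))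
      \<in> borel_measurable (borel \<Otimes>\<^sub>M borel)"
    by (rule sigma_finite_measure.borel_measurable_lebesgue_integral[OF sigma_finite_lborel2])
      (simp add: case_prod_beta', measurable)
  then show ?thesis by (simp add: kern_def case_prod_beta')
qed

lemma kern_L2: "kern \<theta> \<in> L2" "l2_square (kern \<theta>) \<le> kern_bound"
proof -
  let ?a = "\<lambda>p. tri f1 f2 f3 (diagonal_rotation \<theta> (vec3_last p))" and ?b = "\<lambda>p. cnj (f4 (fst p) * f5 (snd p))"
  let ?M = "lborel \<Otimes>\<^sub>M lborel :: (real \<times> real) measure"
  note [measurable] = measurable_L borel_measurable_tri[OF L(1-3)]
  have Rm: "diagonal_rotation \<theta> \<in> borel_measurable borel"
    by (rule borel_measurable_orthogonal_transformation[OF orthogonal_transformation_diagonal_rotation])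
  have am: "?a \<in> borel_measurable (lborel \<Otimes>\<^sub>M ?M)"
    by (intro measurable_compose[OF measurable_compose[OF borel_measurable_vec3_last Rm]] borel_measurable_tri L)
  have bm: "?b \<in> borel_measurable ?M" by measurable
  have T: "has_bochner_integral lborel (\<lambda>x. (cmod (tri f1 f2 f3 (diagonal_rotation \<theta> x)))\<^sup>2) (l2_square f1 * (l2_square f2 * l2_square f3))"
    by (rule has_bochner_integral_tri_orthogonal[OF L(1-3) orthogonal_transformation_diagonal_rotation])
  have Ti: "integrable lborel (\<lambda>x. (cmod (tri f1 f2 f3 (diagonal_rotation \<theta> x)))\<^sup>2)"
    using T by (simp add: has_bochner_integral_iff)
  note ai = integrable_vec3_last[OF Ti]
  have "has_bochner_integral lborel (\<lambda>x. (cmod (f x))\<^sup>2) (l2_square f)" if "f \<in> L2" for f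
    using L2_integrable[OF that] by (simp add: has_bochner_integral_iff l2_square_def)
  from lborel_pair.has_bochner_integral_times[OF this[OF L(4)] this[OF L(5)]]
  have b: "has_bochner_integral ?M (\<lambda>p. (cmod (?b p))\<^sup>2) (l2_square f4 * l2_square f5)"
    by (simp add: case_prod_beta' norm_mult power_mult_distrib)
  then have bi: "integrable ?M (\<lambda>p. (cmod (?b p))\<^sup>2)" by (simp add: has_bochner_integral_iff)
  have k: "kern \<theta> = (\<lambda>y. LINT p|?M. ?a (y, p) * ?b p)" by (rule ext) (simp add: kern_def)
  show "kern \<theta> \<in> L2" unfolding k by (rule L2_integral_slices(1)[OF sigma_finite_lborel2 am bm ai(1) bi])
  have "l2_square (kern \<theta>) \<le> (LINT p|(lborel \<Otimes>\<^sub>M ?M). (cmod (?a p))\<^sup>2) * (LINT p|?M. (cmod (?b p))\<^sup>2)"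
    unfolding k by (rule L2_integral_slices(2)[OF sigma_finite_lborel2 am bm ai(1) bi])
  also have "\<dots> = kern_bound"
    using T b unfolding ai(2) by (simp add: has_bochner_integral_iff kern_bound_def)
  finally show "l2_square (kern \<theta>) \<le> kern_bound" .
qed

text \<open>The conjugated test function depends only on the third coordinate, so it leaves the
  integral over the other two.\<close>

lemma represents_kern:
  "represents (kern \<theta>) (isometry_form (diagonal_rotation \<theta>) f1 f2 f3 f4 f5)"
  unfolding represents_def
proof (intro conjI ballI kern_L2)
  fix g assume g: "g \<in> L2"
  let ?I = "isometry_integrand (diagonal_rotation \<theta>) f1 f2 f3 f4 f5 g"
  have i: "integrable lborel ?I"
    by (rule isometry_integrand_bound(1)[OF orthogonal_transformation_diagonal_rotation L g])
  note v = integrable_vec3_last[OF i]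
  have "isometry_form (diagonal_rotation \<theta>) f1 f2 f3 f4 f5 g = integral\<^sup>L (lborel \<Otimes>\<^sub>M (lborel \<Otimes>\<^sub>M lborel)) (\<lambda>p. ?I (vec3_last p))"
    unfolding isometry_form_def v(2) ..
  also have "\<dots> = (LINT y|lborel. LINT p|(lborel \<Otimes>\<^sub>M lborel). ?I (vec3_last (y, p)))"
    by (rule pair_sigma_finite.integral_fst'[OF pair_sigma_finite_lborel2 v(1), symmetric])
  also have "\<dots> = (LINT y|lborel. kern \<theta> y * cnj (g y))"
  proof (rule Bochner_Integration.integral_cong[OF refl])
    fix y
    have "?I (vec3_last (y, p)) = tri f1 f2 f3 (diagonal_rotation \<theta> (vec3_last (y, p))) * cnj (f4 (fst p) * f5 (snd p)) * cnj (g y)" for p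
      by (simp add: isometry_integrand_tri tri_def)
    then show "(LINT p|(lborel \<Otimes>\<^sub>M lborel). ?I (vec3_last (y, p))) = kern \<theta> y * cnj (g y)"
      unfolding kern_def by simp
  qed
  finally show "l2_inner (kern \<theta>) g = isometry_form (diagonal_rotation \<theta>) f1 f2 f3 f4 f5 g"
    unfolding l2_inner_def ..
qed

lemma borel_measurable_kern': "(\<lambda>(\<theta>, y). kern \<theta> y) \<in> borel_measurable (lborel \<Otimes>\<^sub>M lborel)"
  using borel_measurable_kern by (simp cong: measurable_cong_sets)

text \<open>The norms of the kernels are bounded uniformly in the angle, and the interval of angles
  is finite.\<close>

lemma integrable_kern_square: "integrable kern_space (\<lambda>p. (cmod (kern (snd p) (fst p)))\<^sup>2)"
proof -
  interpret fm: finite_measure "slab 0 (2 * pi)" by (rule finite_measure_slab)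
  interpret P: pair_sigma_finite "slab 0 (2 * pi)" "lborel :: real measure" by (rule pair_sigma_finite_slab_lborel)
  let ?f = "\<lambda>(\<theta>, y). (cmod (kern \<theta> y))\<^sup>2"
  have "?f \<in> borel_measurable (borel \<Otimes>\<^sub>M lborel)" using borel_measurable_kern by (simp add: case_prod_beta' cong: measurable_cong_sets)
  then have m: "?f \<in> borel_measurable (slab 0 (2 * pi) \<Otimes>\<^sub>M lborel)" by (rule measurable_slab_pair)
  have "(\<lambda>\<theta>. LINT y|lborel. (cmod (kern \<theta> y))\<^sup>2) \<in> borel_measurable (slab 0 (2 * pi))"
    using lborel.borel_measurable_lebesgue_integral[OF m] .
  then have "integrable (slab 0 (2 * pi)) (\<lambda>\<theta>. LINT y|lborel. (cmod (kern \<theta> y))\<^sup>2)"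
    by (rule fm.integrable_const_bound[where B=kern_bound, rotated]) (use kern_L2(2) in \<open>simp add: l2_square_def\<close>)
  then have "integrable (slab 0 (2 * pi) \<Otimes>\<^sub>M lborel) ?f"
    by (intro P.Fubini_integrable[OF m]) (simp_all add: L2_integrable[OF kern_L2(1)])
  from P.integrable_product_swap[OF this] show ?thesis by (simp add: case_prod_beta')
qed

definition kern_average :: "real \<Rightarrow> complex" where
  "kern_average y = (LINT \<theta>|slab 0 (2 * pi). kern \<theta> y)"

lemma kern_average_L2: "kern_average \<in> L2"
proof -
  interpret fm: finite_measure "slab 0 (2 * pi)" by (rule finite_measure_slab)
  have "(\<lambda>y. LINT \<theta>|slab 0 (2 * pi). (\<lambda>p. kern (snd p) (fst p)) (y, \<theta>) * 1) \<in> L2"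
    by (rule L2_integral_slices[OF fm.sigma_finite_measure_axioms _ _ integrable_kern_square])
      (use measurable_kern_space[OF borel_measurable_kern'] in auto)
  then show ?thesis by (simp add: kern_average_def[abs_def])
qed

text \<open>The integrals may be exchanged because the kernel and the test function, constant in the
  angle, are both square integrable over the product.\<close>

lemma kern_average_inner:
  assumes g: "g \<in> L2"
  shows "l2_inner kern_average g = (LINT \<theta>|slab 0 (2 * pi). isometry_form (diagonal_rotation \<theta>) f1 f2 f3 f4 f5 g)"
proof -
  interpret fm: finite_measure "slab 0 (2 * pi)" by (rule finite_measure_slab)
  interpret P: pair_sigma_finite "lborel :: real measure" "slab 0 (2 * pi)" by (rule pair_sigma_finite_kern_space)
  have [measurable]: "g \<in> borel_measurable borel" by (rule L2_measurable[OF g])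
  have g2: "integrable kern_space (\<lambda>p. (cmod (g (fst p)))\<^sup>2)"
    using P.has_bochner_integral_times[of "\<lambda>x. (cmod (g x))\<^sup>2" _ "\<lambda>\<theta>. 1", OF has_bochner_integral_integrable[OF L2_integrable[OF g]] has_bochner_integral_integrable[OF fm.integrable_const]]
    by (simp add: has_bochner_integral_iff case_prod_beta')
  have m: "(\<lambda>p. kern (snd p) (fst p)) \<in> borel_measurable kern_space"
    by (rule measurable_kern_space[OF borel_measurable_kern'])
  have "integrable kern_space (\<lambda>p. cmod (kern (snd p) (fst p)) * cmod (g (fst p)))"
    by (rule integrable_mult_of_squares) (use m g2 integrable_kern_square in auto)
  then have i: "integrable kern_space (\<lambda>p. kern (snd p) (fst p) * cnj (g (fst p)))"
    by (rule Bochner_Integration.integrable_bound) (use m in \<open>auto simp: norm_mult\<close>)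
  have "l2_inner kern_average g = (LINT y|lborel. LINT \<theta>|slab 0 (2 * pi). kern \<theta> y * cnj (g y))"
    unfolding l2_inner_def kern_average_def by simp
  also have "\<dots> = (LINT \<theta>|slab 0 (2 * pi). LINT y|lborel. kern \<theta> y * cnj (g y))"
    using P.Fubini_integral[of "\<lambda>y \<theta>. kern \<theta> y * cnj (g y)"] i by (simp add: case_prod_beta')
  also have "\<dots> = (LINT \<theta>|slab 0 (2 * pi). isometry_form (diagonal_rotation \<theta>) f1 f2 f3 f4 f5 g)"
    using represents_kern g unfolding represents_def l2_inner_def by simp
  finally show ?thesis .
qed

text \<open>For almost every point the slice is square integrable, and on a measure space of finite
  total mass this implies integrability.\<close>

lemma AE_integrable_kern: "AE y in lborel. integrable (slab 0 (2 * pi)) (\<lambda>\<theta>. kern \<theta> y)"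
  using pair_sigma_finite.AE_integrable_fst'[OF pair_sigma_finite_kern_space integrable_kern_square]
proof eventually_elim
  case (elim y)
  interpret fm: finite_measure "slab 0 (2 * pi)" by (rule finite_measure_slab)
  have m: "(\<lambda>\<theta>. kern \<theta> y) \<in> borel_measurable (slab 0 (2 * pi))"
  proof -
    have "(\<lambda>\<theta>. (\<theta>, y)) \<in> borel \<rightarrow>\<^sub>M borel \<Otimes>\<^sub>M borel" by simp
    from measurable_compose[OF this borel_measurable_kern] show ?thesis
      by (intro measurable_restrict_space1) simp
  qed
  show ?case
  proof (rule Bochner_Integration.integrable_bound)
    show "integrable (slab 0 (2 * pi)) (\<lambda>\<theta>. (cmod (kern \<theta> y))\<^sup>2 + 1)" using elim by simp
    have "a \<le> a\<^sup>2 + 1" for a :: real using zero_le_power2[of "a - 1/2"] by (simp add: power2_diff field_simps)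
    then show "AE \<theta> in slab 0 (2 * pi). cmod (kern \<theta> y) \<le> norm ((cmod (kern \<theta> y))\<^sup>2 + 1)" by simp
  qed (rule m)
qed

end

section \<open>From slots back to named functions\<close>

lemma isometry_form_integrals:
  assumes L: "f1 \<in> L2" "f2 \<in> L2" "f3 \<in> L2" "f4 \<in> L2" "f5 \<in> L2" "f6 \<in> L2"
  defines "F \<equiv> (!) [f1, f2, f3, f4, f5, f6]"
  shows "integrable (slab 0 (2 * pi)) (\<lambda>\<theta>. isometry_form (diagonal_rotation \<theta>) f1 f2 f3 f4 f5 f6)"
    and "rot_form F = of_real (1 / (2 * sqrt 3 * pi\<^sup>2)) *
      (LINT \<theta>|slab 0 (2 * pi). isometry_form (diagonal_rotation \<theta>) f1 f2 f3 f4 f5 f6)"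
proof -
  have F: "F k \<in> L2" if "k < 6" for k
    using that L unfolding less_6_cases F_def by (elim disjE) simp_all
  have e: "isometry_form (diagonal_rotation \<theta>) f1 f2 f3 f4 f5 f6 = (LINT x|lborel. rot_integrand F \<theta> x)" for \<theta>
    unfolding isometry_form_def rot_integrand_eq by (simp add: F_def)
  have i: "integrable rot_space (\<lambda>(\<theta>, x). rot_integrand F \<theta> x)"
    by (rule integrable_rot_integrand) (rule F)
  show "integrable (slab 0 (2 * pi)) (\<lambda>\<theta>. isometry_form (diagonal_rotation \<theta>) f1 f2 f3 f4 f5 f6)"
    using pair_sigma_finite.integrable_fst'[OF pair_sigma_finite_slab_lborel i] by (simp add: e)
  show "rot_form F = of_real (1 / (2 * sqrt 3 * pi\<^sup>2)) *
      (LINT \<theta>|slab 0 (2 * pi). isometry_form (diagonal_rotation \<theta>) f1 f2 f3 f4 f5 f6)"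
    using pair_sigma_finite.integral_fst'[OF pair_sigma_finite_slab_lborel i] by (simp add: e rot_form_def)
qed

lemma sextic_representation:
  assumes U: "oscillator_propagator U"
    and L: "f1 \<in> L2" "f2 \<in> L2" "f3 \<in> L2" "f4 \<in> L2" "f5 \<in> L2" "f6 \<in> L2"
  shows "AE t in slab (- pi / 4) (pi / 4). integrable lborel (\<lambda>x. sextic_integrand U f1 f2 f3 f4 f5 f6 t x)"
    and "integrable (slab (- pi / 4) (pi / 4)) (\<lambda>t. LINT x|lborel. sextic_integrand U f1 f2 f3 f4 f5 f6 t x)"
    and "sextic_form U f1 f2 f3 f4 f5 f6 = of_real (1 / (2 * sqrt 3 * pi\<^sup>2)) *
      (LINT \<theta>|slab 0 (2 * pi). isometry_form (diagonal_rotation \<theta>) f1 f2 f3 f4 f5 f6)"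
proof -
  let ?F = "(!) [f1, f2, f3, f4, f5, f6]"
  have F: "?F k \<in> L2" if "k < 6" for k
    using that L unfolding less_6_cases by (elim disjE) simp_all
  show "AE t in slab (- pi / 4) (pi / 4). integrable lborel (\<lambda>x. sextic_integrand U f1 f2 f3 f4 f5 f6 t x)"
    using sextic_form_eq(1)[OF U, of ?F] F by simp
  show "integrable (slab (- pi / 4) (pi / 4)) (\<lambda>t. LINT x|lborel. sextic_integrand U f1 f2 f3 f4 f5 f6 t x)"
    using sextic_form_eq(2)[OF U, of ?F] F by simp
  show "sextic_form U f1 f2 f3 f4 f5 f6 = of_real (1 / (2 * sqrt 3 * pi\<^sup>2)) *
      (LINT \<theta>|slab 0 (2 * pi). isometry_form (diagonal_rotation \<theta>) f1 f2 f3 f4 f5 f6)"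
    using sextic_form_eq(3)[OF U, of ?F] F isometry_form_integrals(2)[OF L] by simp
qed

lemma represents_sextic:
  assumes U: "oscillator_propagator U"
    and L: "f1 \<in> L2" "f2 \<in> L2" "f3 \<in> L2" "f4 \<in> L2" "f5 \<in> L2"
  shows "represents (\<lambda>x. of_real (sqrt 3 / pi\<^sup>2) * kern_average f1 f2 f3 f4 f5 x)
    (\<lambda>g. 6 * sextic_form U f1 f2 f3 f4 f5 g)"
  unfolding represents_def
proof (intro conjI ballI L2_scale kern_average_L2 L)
  fix g assume g: "g \<in> L2"
  \<comment> \<open>The factor 6 from the duality defining the sextic operator turns the constant of
    the form into that of the operator.\<close>
  have c: "6 * (1 / (2 * sqrt 3 * pi\<^sup>2)) = sqrt 3 / pi\<^sup>2"
    by (simp add: field_simps)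
  have "l2_inner (\<lambda>x. of_real (sqrt 3 / pi\<^sup>2) * kern_average f1 f2 f3 f4 f5 x) g =
      of_real (sqrt 3 / pi\<^sup>2) * l2_inner (kern_average f1 f2 f3 f4 f5) g"
    unfolding l2_inner_def by (simp add: mult.assoc)
  also have "\<dots> = of_real (6 * (1 / (2 * sqrt 3 * pi\<^sup>2))) *
      (LINT \<theta>|slab 0 (2 * pi). isometry_form (diagonal_rotation \<theta>) f1 f2 f3 f4 f5 g)"
    unfolding c kern_average_inner[OF L g] ..
  also have "\<dots> = 6 * sextic_form U f1 f2 f3 f4 f5 g"
    unfolding sextic_representation(3)[OF U L g] by simp
  finally show "l2_inner (\<lambda>x. of_real (sqrt 3 / pi\<^sup>2) * kern_average f1 f2 f3 f4 f5 x) g = 6 * sextic_form U f1 f2 f3 f4 f5 g" .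
qed

theorem theorem3p7:
  fixes U :: "real \<Rightarrow> (real \<Rightarrow> complex) \<Rightarrow> real \<Rightarrow> complex"
    and f1 f2 f3 f4 f5 f6 :: "real \<Rightarrow> complex"
  assumes "oscillator_propagator U"
    and "f1 \<in> L2" and "f2 \<in> L2" and "f3 \<in> L2" and "f4 \<in> L2" and "f5 \<in> L2" and "f6 \<in> L2"
  shows
    "(AE t in lborel. t \<in> {- pi / 4..pi / 4} \<longrightarrow>
       integrable lborel (\<lambda>x. sextic_integrand U f1 f2 f3 f4 f5 f6 t x)) \<and>
     (set_integrable lborel {- pi / 4..pi / 4}
       (\<lambda>t. LINT x|lborel. sextic_integrand U f1 f2 f3 f4 f5 f6 t x)) \<and>
     (\<forall>\<theta>. integrable lborel (\<lambda>x. isometry_integrand (diagonal_rotation \<theta>) f1 f2 f3 f4 f5 f6 x)) \<and>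
     (set_integrable lborel {0..2 * pi} (\<lambda>\<theta>. isometry_form (diagonal_rotation \<theta>) f1 f2 f3 f4 f5 f6)) \<and>
     (sextic_form U f1 f2 f3 f4 f5 f6 =
       of_real (1 / (2 * sqrt 3 * pi\<^sup>2)) *
       (LINT \<theta>:{0..2 * pi}|lborel. isometry_form (diagonal_rotation \<theta>) f1 f2 f3 f4 f5 f6)) \<and>
     (represents (sextic_operator U f1 f2 f3 f4 f5) (\<lambda>g. 6 * sextic_form U f1 f2 f3 f4 f5 g)) \<and>
     (\<forall>\<theta>. represents (isometry_operator (diagonal_rotation \<theta>) f1 f2 f3 f4 f5)
           (\<lambda>g. isometry_form (diagonal_rotation \<theta>) f1 f2 f3 f4 f5 g)) \<and>
     (\<exists>K. measurable_version {0..2 * pi} (\<lambda>\<theta>. isometry_operator (diagonal_rotation \<theta>) f1 f2 f3 f4 f5) K) \<and>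
     (\<forall>K. measurable_version {0..2 * pi} (\<lambda>\<theta>. isometry_operator (diagonal_rotation \<theta>) f1 f2 f3 f4 f5) K \<longrightarrow>
       (AE x in lborel.
          set_integrable lborel {0..2 * pi} (\<lambda>\<theta>. K \<theta> x) \<and>
          sextic_operator U f1 f2 f3 f4 f5 x =
            of_real (sqrt 3 / pi\<^sup>2) * (LINT \<theta>:{0..2 * pi}|lborel. K \<theta> x)))"
proof -
  note U = assms(1) and L = assms(2-6) and L6 = assms(2-7)
  let ?k = "kern f1 f2 f3 f4 f5" and ?T = "\<lambda>\<theta>. isometry_operator (diagonal_rotation \<theta>) f1 f2 f3 f4 f5"
  have rs: "represents (sextic_operator U f1 f2 f3 f4 f5) (\<lambda>g. 6 * sextic_form U f1 f2 f3 f4 f5 g)"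
    unfolding sextic_operator_def by (rule represents_riesz_vector[OF represents_sextic[OF U L]])
  have ri: "represents (?T \<theta>) (\<lambda>g. isometry_form (diagonal_rotation \<theta>) f1 f2 f3 f4 f5 g)" for \<theta>
    unfolding isometry_operator_def by (rule represents_riesz_vector[OF represents_kern[OF L]])
  \<comment> \<open>For each angle separately the chosen representative agrees with the kernel
    almost everywhere; this makes the kernel itself a measurable version.\<close>
  have kT: "AE x in lborel. ?k \<theta> x = ?T \<theta> x" for \<theta>
    by (rule represents_unique[OF represents_kern[OF L] ri])
  have ex: "\<exists>K. measurable_version {0..2 * pi} ?T K"
    unfolding measurable_version_def by (intro exI[of _ ?k] conjI ballI borel_measurable_kern'[OF L] kT)
  have uniq: "AE x in lborel. set_integrable lborel {0..2 * pi} (\<lambda>\<theta>. K \<theta> x) \<and>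
      sextic_operator U f1 f2 f3 f4 f5 x = of_real (sqrt 3 / pi\<^sup>2) * (LINT \<theta>:{0..2 * pi}|lborel. K \<theta> x)"
    if K: "measurable_version {0..2 * pi} ?T K" for K
  proof -
    interpret P: pair_sigma_finite "lborel :: real measure" "slab 0 (2 * pi)" by (rule pair_sigma_finite_kern_space)
    have Km: "(\<lambda>(\<theta>, x). K \<theta> x) \<in> borel_measurable (lborel \<Otimes>\<^sub>M lborel)"
      and KT: "\<And>\<theta>. \<theta> \<in> {0..2 * pi} \<Longrightarrow> AE x in lborel. K \<theta> x = ?T \<theta> x"
      using K unfolding measurable_version_def by auto
    have [measurable]: "(\<lambda>p. K (snd p) (fst p)) \<in> borel_measurable (lborel \<Otimes>\<^sub>M slab 0 (2 * pi))"
      "(\<lambda>p. ?k (snd p) (fst p)) \<in> borel_measurable (lborel \<Otimes>\<^sub>M slab 0 (2 * pi))"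
      by (rule measurable_kern_space[OF Km], rule measurable_kern_space[OF borel_measurable_kern'[OF L]])
    have "AE \<theta> in slab 0 (2 * pi). AE x in lborel. K \<theta> x = ?k \<theta> x"
    proof (rule AE_I2)
      fix \<theta> assume "\<theta> \<in> space (slab 0 (2 * pi))"
      then have "\<theta> \<in> {0..2 * pi}" by (simp add: space_restrict_space)
      from KT[OF this] kT[of \<theta>] show "AE x in lborel. K \<theta> x = ?k \<theta> x" by eventually_elim simp
    qed
    \<comment> \<open>The null set in x depends on the angle. Joint measurability of both versions
      allows the quantifiers to be exchanged, giving agreement for almost every angle at almost
      every point, as an integral over the angle requires.\<close>
    then have Kk: "AE x in lborel. AE \<theta> in slab 0 (2 * pi). K \<theta> x = ?k \<theta> x"
      by (subst P.AE_commute) measurable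
    have s: "AE x in lborel. sextic_operator U f1 f2 f3 f4 f5 x = of_real (sqrt 3 / pi\<^sup>2) * kern_average f1 f2 f3 f4 f5 x"
      by (rule represents_unique[OF rs represents_sextic[OF U L]])
    show ?thesis
      using Kk s AE_integrable_kern[OF L]
    proof eventually_elim
      case (elim x)
      have slice: "(\<lambda>\<theta>. f \<theta> x) \<in> borel_measurable (slab 0 (2 * pi))"
        if "(\<lambda>(\<theta>, x). f \<theta> x) \<in> borel_measurable (lborel \<Otimes>\<^sub>M lborel)" for f :: "real \<Rightarrow> real \<Rightarrow> complex"
      proof -
        have "(\<lambda>\<theta>. (\<theta>, x)) \<in> borel \<rightarrow>\<^sub>M lborel \<Otimes>\<^sub>M lborel" by simp
        from measurable_compose[OF this that] show ?thesis by (intro measurable_restrict_space1) simp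
      qed
      note m = slice[OF Km] slice[OF borel_measurable_kern'[OF L]]
      have "integrable (slab 0 (2 * pi)) (\<lambda>\<theta>. K \<theta> x)"
        using integrable_cong_AE[OF m elim(1)] elim(3) by simp
      moreover have "kern_average f1 f2 f3 f4 f5 x = (LINT \<theta>|slab 0 (2 * pi). K \<theta> x)"
        unfolding kern_average_def[OF L] using integral_cong_AE[OF m elim(1)] by simp
      ultimately show ?case
        using elim(2) unfolding set_integrable_slab set_integral_slab by simp
    qed
  qed
  have AE: "AE t in lborel. t \<in> {- pi / 4..pi / 4} \<longrightarrow>
       integrable lborel (\<lambda>x. sextic_integrand U f1 f2 f3 f4 f5 f6 t x)"
    using sextic_representation(1)[OF U L6] by (subst (asm) AE_restrict_space_iff) auto
  show ?thesis
    unfolding set_integrable_slab set_integral_slab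
    using AE sextic_representation(2,3)[OF U L6] isometry_form_integrals(1)[OF L6]
      isometry_integrand_bound(1)[OF orthogonal_transformation_diagonal_rotation L6] rs ri ex
      uniq[unfolded set_integrable_slab set_integral_slab]
    by blast
qed

end
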